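(* Let $E\subset\mathbb{R}^n$ be compact, and let $p>n$. Then there exists a continuous mapping $f\in W^{1,p}(\mathbb{R}^n:\mathbb{R}^n)$ so that $$\overline{\dim}_\theta f(E)=\frac{p\,\overline{\dim}_\theta E}{p-n+\overline{\dim}_\theta E}\qquad\text{for all }0<\theta\le1.$$
   Context: For a bounded set $A\subset\mathbb{R}^n$ and $0<\theta<1$, the upper $\theta$-intermediate dimension $\overline{\dim}_\theta A$ is the infimum of those $s>0$ such that for each $\epsilon>0$ there exists $\delta_0>0$ so that for each $0<\delta\le\delta_0$ there is a countable covering $(A_i)$ of $A$ by subsets of $\mathbb{R}^n$ with $\delta^{1/\theta}\le\operatorname{diam}(A_i)\le\delta$ for all $i$ and $\sum_i(\operatorname{diam}A_i)^s<\epsilon$. For $\theta=1$, $\overline{\dim}_1A:=\overline{\dim}_BA=\limsup_{r\to0}\frac{\log N(A,r)}{-\log r}$ is the upper box-counting dimension, where $N(A,r)$ is the minimal number of sets of diameter $r$ needed to cover $A$. $W^{1,p}(\mathbb{R}^n:\mathbb{R}^n)$ is the Sobolev space of maps whose components lie in $W^{1,p}(\mathbb{R}^n)$. *)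

theory Defs
  imports "HOL-Analysis.Analysis"
begin

section \<open>Intermediate dimensions\<close>

text \<open>
  Boundedness is demanded of every covering set, since \<^const>\<open>diameter\<close> is only meaningful on bounded
  sets. The index set is an arbitrary set of natural numbers, so coverings may be finite or
  countably infinite.
\<close>

definition intermediate_cover ::
    "real \<Rightarrow> real \<Rightarrow> 'a::euclidean_space set \<Rightarrow> nat set \<Rightarrow> (nat \<Rightarrow> 'a set) \<Rightarrow> bool" where
  "intermediate_cover \<theta> \<delta> A I C \<longleftrightarrow>
     A \<subseteq> (\<Union>i\<in>I. C i) \<and>
     (\<forall>i\<in>I. bounded (C i) \<and> \<delta> powr (1 / \<theta>) \<le> diameter (C i) \<and> diameter (C i) \<le> \<delta>)"

definition covering_number :: "'a::euclidean_space set \<Rightarrow> real \<Rightarrow> nat" where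
  "covering_number A r =
     (LEAST k. \<exists>\<C>. finite \<C> \<and> card \<C> = k \<and> A \<subseteq> \<Union>\<C> \<and>
        (\<forall>X\<in>\<C>. bounded X \<and> diameter X = r))"

text \<open>
  The upper limit is taken in the extended reals; for bounded \<open>A\<close> it is finite. As \<open>ln 0 = 0\<close>,
  the empty set has dimension \<open>0\<close>, which agrees with the value of \<open>upper_intermediate_dim\<close>
  below for \<open>\<theta> < 1\<close>.
\<close>

definition upper_box_dim :: "'a::euclidean_space set \<Rightarrow> real" where
  "upper_box_dim A =
     real_of_ereal
       (Limsup (at_right 0) (\<lambda>r. ereal (ln (real (covering_number A r)) / (- ln r))))"

text \<open>Only meaningful for bounded \<open>A\<close> and \<open>0 < \<theta> \<le> 1\<close>.\<close>

definition upper_intermediate_dim :: "real \<Rightarrow> 'a::euclidean_space set \<Rightarrow> real" where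
  "upper_intermediate_dim \<theta> A =
     (if \<theta> = 1 then upper_box_dim A
      else Inf {s. 0 < s \<and>
             (\<forall>\<epsilon>>0. \<exists>\<delta>\<^sub>0>0. \<forall>\<delta>. 0 < \<delta> \<and> \<delta> \<le> \<delta>\<^sub>0 \<longrightarrow>
               (\<exists>I C. intermediate_cover \<theta> \<delta> A I C \<and>
                  (\<lambda>i. diameter (C i) powr s) summable_on I \<and>
                  (\<Sum>\<^sub>\<infinity>i\<in>I. diameter (C i) powr s) < \<epsilon>))})"

section \<open>First-order Sobolev spaces\<close>

definition partial_deriv :: "'n::finite \<Rightarrow> (real^'n \<Rightarrow> real) \<Rightarrow> real^'n \<Rightarrow> real" where
  "partial_deriv i u x = frechet_derivative u (at x) (axis i 1)"

primrec C_k :: "nat \<Rightarrow> (real^'n::finite \<Rightarrow> real) \<Rightarrow> bool" where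
  "C_k 0 u \<longleftrightarrow> continuous_on UNIV u"
| "C_k (Suc k) u \<longleftrightarrow> (\<forall>x. u differentiable (at x)) \<and> (\<forall>i. C_k k (partial_deriv i u))"

definition test_function :: "(real^'n::finite \<Rightarrow> real) \<Rightarrow> bool" where
  "test_function \<phi> \<longleftrightarrow> (\<forall>k. C_k k \<phi>) \<and> compact (closure {x. \<phi> x \<noteq> 0})"

definition Lp_functions :: "real \<Rightarrow> (real^'n::finite \<Rightarrow> real) set" where
  "Lp_functions p =
     {u. u \<in> borel_measurable lebesgue \<and> integrable lebesgue (\<lambda>x. \<bar>u x\<bar> powr p)}"

definition weak_partial_deriv ::
    "'n::finite \<Rightarrow> (real^'n \<Rightarrow> real) \<Rightarrow> (real^'n \<Rightarrow> real) \<Rightarrow> bool" where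
  "weak_partial_deriv i u g \<longleftrightarrow>
     (\<forall>\<phi>. test_function \<phi> \<longrightarrow>
        (LINT x|lebesgue. u x * partial_deriv i \<phi> x) = - (LINT x|lebesgue. g x * \<phi> x))"

text \<open>
  Members are functions rather than almost-everywhere classes. In the definition below both \<open>u\<close>
  and its weak derivatives are in \<open>L\<^sup>p\<close>, so for \<open>p \<ge> 1\<close> all integrals in
  \<open>weak_partial_deriv\<close> exist.
\<close>

definition sobolev_W1 :: "real \<Rightarrow> (real^'n::finite \<Rightarrow> real) set" where
  "sobolev_W1 p =
     {u \<in> Lp_functions p. \<forall>i. \<exists>g\<in>Lp_functions p. weak_partial_deriv i u g}"

definition sobolev_W1_maps :: "real \<Rightarrow> (real^'n::finite \<Rightarrow> real^'m::finite) set" where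
  "sobolev_W1_maps p = {f. \<forall>j. (\<lambda>x. f x $ j) \<in> sobolev_W1 p}"

end

(*
  The map is a series f = sum_l sum_z phi_{l,z} a_{l,z} over the dyadic cells z of
  level l that meet E, where phi_{l,z} is a C^1 bump of height about 1 on z and Lipschitz constant
  about 2^l, and where sum_z |a_{l,z}|^p <= C beta_l^p 2^{-l(p-n)} with beta_l = (l+1)^{-4}. This
  bound alone gives f in W^{1,p} and sum_Q osc(f,Q)^p <= C 2^{-k(p-n)} over the cells Q of level k,
  and the latter yields the upper bound: a cover of E by cells of levels in [k, k/theta] is turned
  into a cover of f(E) whose scales are comparable to 2^{-alpha k} and finer, alpha = (p-n+s)/p,
  by subdividing the few cells whose image is too large.

  For the lower bound, whenever E has large content at scale k for parameters (theta, s), a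
  discrete Frostman lemma gives a probability mu on finitely many points of E with
  mu(Q) <= 2^{-ls} for all cells Q of level l in [k, k/theta]. Take
  a_{l,z} = beta_l (2^{-l(p-n)} mu(near z))^{1/p} times a random vector of a finite grid. Two points
  that are first separated at level l have images at distance less than rho with probability at most
  (C rho / |a_{l,z}|)^n, and summing over pairs bounds the expected energy of f_* mu; some choice of
  the random vectors is at least as good as the average. Only finitely many levels are involved, so
  countably many such choices, for rational parameters, fit into one series. Rational theta suffice
  because a bound on the content for theta' < theta at exponent s gives one for theta at exponent
  s theta / theta'.
*)

theory Submission
  imports Defs "HOL-Real_Asymp.Real_Asymp"
begin

section \<open>Dyadic cells\<close>

text \<open>Origin of the exponent: a cell of level k with mass 2^{-ks} may receive a coefficient of
  size about (2^{-k(p-n)} 2^{-ks})^{1/p} = 2^{-alpha k}, and 2^{ks} pieces of that size have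
  dimension s / alpha = p s / (p - n + s). Multiplication by alpha also maps the window [k, k/theta]
  of levels to the window [alpha k, alpha k/theta], which is why the formula has the same shape for
  every theta. Both bounds are proved with a gap between t and s / alpha. The gap yields a factor
  2^{-ck}, which pays for all polynomial losses: the number of levels in a window and the powers of
  1 / beta_l. So beta_l may decay, as summation over levels requires, but only polynomially. The
  obstacle in the lower bound is that the energy of the limit map depends on coefficients that are
  not chosen yet. Hence energies are truncated at a finest scale 2^{-m1}: once enough levels are
  frozen, no admissible tail moves a point by more than that. The hypothesis p > n enters twice: it
  makes the numbers of cells with large oscillation summable over the levels, and it keeps masses to
  the power 1 - n/p bounded.\<close>

definition cell :: "nat \<Rightarrow> real^'n \<Rightarrow> int^'n" where
  "cell l x = (\<chi> j. \<lfloor>2 ^ l * x $ j\<rfloor>)"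

definition near :: "int \<Rightarrow> int^'n \<Rightarrow> int^'n \<Rightarrow> bool" where
  "near r z w \<longleftrightarrow> (\<forall>j. \<bar>z $ j - w $ j\<bar> \<le> r)"

lemma near_refl: "0 \<le> r \<Longrightarrow> near r z z"
  by (simp add: near_def)

lemma near_commute: "near r z w \<longleftrightarrow> near r w z"
  by (simp add: near_def abs_minus_commute)

lemma near_mono: "near r z w \<Longrightarrow> r \<le> r' \<Longrightarrow> near r' z w"
  unfolding near_def by (meson order_trans)

lemma finite_vec_coords:
  fixes S :: "'n::finite \<Rightarrow> 'b set"
  assumes "\<And>j. finite (S j)"
  shows "finite {v :: 'b^'n. \<forall>j. v $ j \<in> S j}"
    and "card {v :: 'b^'n. \<forall>j. v $ j \<in> S j} = (\<Prod>j\<in>UNIV. card (S j))"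
proof -
  have bij: "bij_betw vec_nth {v :: 'b^'n. \<forall>j. v $ j \<in> S j} (PiE UNIV S)"
    by (rule bij_betwI[where g = vec_lambda]) (auto simp: PiE_def Pi_def)
  have fin: "finite (PiE UNIV S)"
    by (rule finite_PiE) (auto simp: assms)
  show "finite {v :: 'b^'n. \<forall>j. v $ j \<in> S j}"
    using bij fin bij_betw_finite by blast
  show "card {v :: 'b^'n. \<forall>j. v $ j \<in> S j} = (\<Prod>j\<in>UNIV. card (S j))"
    using bij_betw_same_card[OF bij] by (simp add: card_PiE)
qed

lemma near_eq_coords: "{w :: int^'n::finite. near r z w} = {w. \<forall>j. w $ j \<in> {z $ j - r .. z $ j + r}}"
  by (auto simp: near_def abs_le_iff) (smt (verit))+

lemma finite_near: "finite {w :: int^'n::finite. near r z w}"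
  unfolding near_eq_coords by (rule finite_vec_coords) simp

lemma card_near: "0 \<le> r \<Longrightarrow> card {w :: int^'n::finite. near r z w} = nat (2 * r + 1) ^ CARD('n)"
  unfolding near_eq_coords by (subst finite_vec_coords) simp_all

lemma cell_div:
  assumes "l \<le> m"
  shows "cell l x $ j = cell m x $ j div 2 ^ (m - l)"
proof -
  have "2 ^ l * x $ j = (2 ^ m * x $ j) / real_of_int (2 ^ (m - l))"
  proof -
    have "(2::real) ^ m = 2 ^ l * 2 ^ (m - l)" using assms by (simp flip: power_add)
    then show ?thesis by simp
  qed
  moreover have "\<lfloor>(2 ^ m * x $ j) / real_of_int (2 ^ (m - l))\<rfloor> = \<lfloor>2 ^ m * x $ j\<rfloor> div 2 ^ (m - l)"
    by (rule floor_divide_real_eq_div) simp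
  ultimately show ?thesis
    unfolding cell_def by simp
qed

lemma cell_mono:
  assumes "l \<le> m" "cell m x = cell m y"
  shows "cell l x = cell l y"
  using assms(2) by (simp add: vec_eq_iff cell_div[OF assms(1)])

lemma cell_bounds:
  "real_of_int (cell l x $ j) \<le> 2 ^ l * x $ j" "2 ^ l * x $ j < real_of_int (cell l x $ j) + 1"
  by (simp_all add: cell_def)

lemma cell_eq_dist:
  assumes "cell l x = cell l y"
  shows "\<bar>x $ j - y $ j\<bar> \<le> 2 powr - real l"
proof -
  have "\<bar>2 ^ l * (x $ j - y $ j)\<bar> \<le> 1"
    using cell_bounds[of l x j] cell_bounds[of l y j] assms by (simp add: algebra_simps abs_le_iff)
  then have "2 ^ l * \<bar>x $ j - y $ j\<bar> \<le> 1"
    by (simp add: abs_mult)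
  then show ?thesis
    by (simp add: powr_minus powr_realpow field_simps)
qed

lemma near_cell_dist:
  assumes "near r (cell l x) (cell l y)"
  shows "\<bar>x $ j - y $ j\<bar> \<le> (real_of_int r + 1) * 2 powr - real l"
proof -
  have "\<bar>cell l x $ j - cell l y $ j\<bar> \<le> r" using assms by (simp add: near_def)
  then have "\<bar>real_of_int (cell l x $ j) - real_of_int (cell l y $ j)\<bar> \<le> real_of_int r"
    by linarith
  then have "\<bar>2 ^ l * (x $ j - y $ j)\<bar> \<le> real_of_int r + 1"
    using cell_bounds[of l x j] cell_bounds[of l y j] by (simp add: algebra_simps abs_le_iff)
  then have "2 ^ l * \<bar>x $ j - y $ j\<bar> \<le> real_of_int r + 1"
    by (simp add: abs_mult)
  then show ?thesis
    by (simp add: powr_minus powr_realpow field_simps)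
qed

lemma dist_imp_near_cell:
  assumes "\<And>j. \<bar>x $ j - y $ j\<bar> \<le> 2 powr - real l"
  shows "near 1 (cell l x) (cell l y)"
  unfolding near_def
proof
  fix j
  have "2 ^ l * \<bar>x $ j - y $ j\<bar> \<le> 1"
    using assms[of j] by (simp add: powr_minus powr_realpow field_simps)
  then have "\<bar>2 ^ l * x $ j - 2 ^ l * y $ j\<bar> \<le> 1"
    by (simp add: abs_mult flip: right_diff_distrib)
  then show "\<bar>cell l x $ j - cell l y $ j\<bar> \<le> 1"
    unfolding cell_def vec_lambda_beta by linarith
qed

text \<open>Integers whose halves are at distance at most 1 are at distance at most 3. Two points
  that are 1-near at one level and separated at the next are thus still 3-near there, hence the
  radius in \<open>nbmass\<close>.\<close>

lemma near_cell_Suc: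
  assumes "near 1 (cell l x) (cell l y)"
  shows "near 3 (cell (Suc l) x) (cell (Suc l) y)"
  unfolding near_def
proof
  fix j
  have "\<bar>cell (Suc l) x $ j div 2 - cell (Suc l) y $ j div 2\<bar> \<le> 1"
    using assms[unfolded near_def, rule_format, of j]
    unfolding cell_div[of l "Suc l" x j, simplified] cell_div[of l "Suc l" y j, simplified]
    by (simp add: Suc_diff_le)
  then show "\<bar>cell (Suc l) x $ j - cell (Suc l) y $ j\<bar> \<le> 3"
    by linarith
qed

lemma finite_cell_image:
  fixes A :: "(real^'n::finite) set"
  assumes "bounded A"
  shows "finite (cell l ` A)"
proof -
  obtain B where B: "\<And>x. x \<in> A \<Longrightarrow> norm x \<le> B"
    using assms bounded_iff by blast
  have "cell l ` A \<subseteq> {v. \<forall>j. v $ j \<in> {\<lfloor>2 ^ l * (- B)\<rfloor> .. \<lfloor>2 ^ l * B\<rfloor>}}"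
  proof (clarsimp simp: cell_def)
    fix x j assume "x \<in> A"
    then have "\<bar>x $ j\<bar> \<le> B" using B component_le_norm_cart order_trans by blast
    then have "- B \<le> x $ j" "x $ j \<le> B" by (simp_all add: abs_le_iff)
    then have "2 ^ l * (- B) \<le> 2 ^ l * x $ j" "2 ^ l * x $ j \<le> 2 ^ l * B"
      by (intro mult_left_mono; simp)+
    then have "- (2 ^ l * B) \<le> 2 ^ l * x $ j" "2 ^ l * x $ j \<le> 2 ^ l * B" by simp_all
    then show "\<lfloor>- (2 ^ l * B)\<rfloor> \<le> \<lfloor>2 ^ l * x $ j\<rfloor> \<and> \<lfloor>2 ^ l * x $ j\<rfloor> \<le> \<lfloor>2 ^ l * B\<rfloor>"
      by (auto intro!: floor_mono)
  qed
  then show ?thesis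
    by (rule finite_subset) (rule finite_vec_coords, simp)
qed

lemma card_subcells:
  fixes A :: "(real^'n::finite) set"
  assumes "l \<le> m"
  shows "finite (cell m ` {x\<in>A. cell l x = z})"
    and "card (cell m ` {x\<in>A. cell l x = z}) \<le> (2 ^ (m - l)) ^ CARD('n)"
proof -
  let ?d = "2 ^ (m - l) :: int"
  have sub: "cell m ` {x\<in>A. cell l x = z} \<subseteq> {v. \<forall>j. v $ j \<in> {?d * z $ j ..< ?d * z $ j + ?d}}"
  proof clarsimp
    fix x j
    have *: "cell l x $ j = cell m x $ j div ?d" by (rule cell_div[OF assms])
    have "cell m x $ j = ?d * (cell m x $ j div ?d) + cell m x $ j mod ?d" by simp
    moreover have "0 \<le> cell m x $ j mod ?d" "cell m x $ j mod ?d < ?d" by simp_all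
    ultimately show "?d * cell l x $ j \<le> cell m x $ j \<and> cell m x $ j < ?d * cell l x $ j + ?d"
      unfolding * by linarith
  qed
  have fin: "finite {v::int^'n. \<forall>j. v $ j \<in> {?d * z $ j ..< ?d * z $ j + ?d}}"
    by (rule finite_vec_coords) simp
  show "finite (cell m ` {x\<in>A. cell l x = z})"
    using sub fin finite_subset by blast
  have "card (cell m ` {x\<in>A. cell l x = z}) \<le> card {v::int^'n. \<forall>j. v $ j \<in> {?d * z $ j ..< ?d * z $ j + ?d}}"
    by (rule card_mono[OF fin sub])
  also have "\<dots> = (\<Prod>j\<in>(UNIV::'n set). card {?d * z $ j ..< ?d * z $ j + ?d})"
    by (rule finite_vec_coords) simp
  also have "\<dots> = (2 ^ (m - l)) ^ CARD('n)"
    by (simp add: nat_power_eq)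
  finally show "card (cell m ` {x\<in>A. cell l x = z}) \<le> (2 ^ (m - l)) ^ CARD('n)" .
qed

lemma card_cell_image_le:
  fixes A :: "(real^'n::finite) set"
  assumes "bounded A"
  shows "real (card (cell l ` A)) \<le> real (card (cell 0 ` A)) * 2 powr (real CARD('n) * real l)"
proof -
  have "cell l ` A = (\<Union>z\<in>cell 0 ` A. cell l ` {x\<in>A. cell 0 x = z})" by auto
  then have "card (cell l ` A) \<le> (\<Sum>z\<in>cell 0 ` A. card (cell l ` {x\<in>A. cell 0 x = z}))"
    using card_UN_le[OF finite_cell_image[OF assms, of 0], of "\<lambda>z. cell l ` {x\<in>A. cell 0 x = z}"] by simp
  also have "\<dots> \<le> (\<Sum>z\<in>cell 0 ` A. (2 ^ l) ^ CARD('n))"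
    by (intro sum_mono) (use card_subcells(2)[of 0 l] in auto)
  finally have "real (card (cell l ` A)) \<le> real (card (cell 0 ` A) * (2 ^ l) ^ CARD('n))"
    unfolding of_nat_le_iff by simp
  also have "\<dots> = real (card (cell 0 ` A)) * 2 powr (real CARD('n) * real l)"
    by (simp add: powr_realpow[symmetric] powr_powr flip: power_mult) (simp add: mult.commute powr_realpow[symmetric])
  finally show ?thesis .
qed

text \<open>The level of the least admissible diameter \<delta> powr (1 / \<theta>) at \<delta> = 2
  powr - k. Rounding upwards keeps the level of every admissible diameter inside the window, at the
  price of a constant factor in some costs.\<close>

definition top_level :: "real \<Rightarrow> nat \<Rightarrow> nat" where
  "top_level \<theta> k = nat \<lceil>real k / \<theta>\<rceil>"

lemma top_level_bounds:
  assumes "0 < \<theta>"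
  shows "real k / \<theta> \<le> real (top_level \<theta> k)" "real (top_level \<theta> k) < real k / \<theta> + 1"
proof -
  have "0 \<le> real k / \<theta>" using assms by simp
  then show "real k / \<theta> \<le> real (top_level \<theta> k)" "real (top_level \<theta> k) < real k / \<theta> + 1"
    unfolding top_level_def by linarith+
qed

lemma le_top_level:
  assumes "0 < \<theta>" "\<theta> \<le> 1"
  shows "k \<le> top_level \<theta> k"
proof -
  have "real k \<le> real k / \<theta>" using assms by (simp add: field_simps mult_left_le_one_le)
  then show ?thesis using top_level_bounds[OF assms(1), of k] by linarith
qed

definition cell_cover :: "real \<Rightarrow> nat \<Rightarrow> (real^'n) set \<Rightarrow> (nat \<times> (int^'n)) set \<Rightarrow> bool" where
  "cell_cover \<theta> k A C \<longleftrightarrow> finite C \<and> (\<forall>(l, z)\<in>C. k \<le> l \<and> l \<le> top_level \<theta> k) \<and>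
     (\<forall>x\<in>A. \<exists>l. (l, cell l x) \<in> C)"

definition cover_cost :: "real \<Rightarrow> (nat \<times> (int^'n)) set \<Rightarrow> real" where
  "cover_cost s C = (\<Sum>(l, z)\<in>C. 2 powr - (real l * s))"

text \<open>
  The intermediate dimension is the threshold of boundedness of these dyadic contents; this
  covers \<open>\<theta> = 1\<close> too, where all cells have level \<open>k\<close> and the content counts them.
\<close>

definition bounded_content :: "real \<Rightarrow> (real^'n) set \<Rightarrow> real \<Rightarrow> bool" where
  "bounded_content \<theta> A s \<longleftrightarrow> (\<exists>B K. \<forall>k\<ge>K. \<exists>C. cell_cover \<theta> k A C \<and> cover_cost s C \<le> B)"

lemma cover_cost_nonneg: "0 \<le> cover_cost s C"
  unfolding cover_cost_def by (rule sum_nonneg) auto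

section \<open>A discrete Frostman lemma\<close>

text \<open>Points are inserted one at a time, each with the largest weight that the capacities
  allow, so that some class of the new point fills up. A full class stays full, because later
  weights are nonnegative and capacities are never exceeded.\<close>

lemma greedy_weights:
  fixes q :: "nat \<Rightarrow> 'a \<Rightarrow> 'c" and cap :: "nat \<Rightarrow> real"
  assumes "finite L" "L \<noteq> {}" and cap: "\<And>l. l \<in> L \<Longrightarrow> 0 \<le> cap l" and "finite F"
  shows "\<exists>\<mu>. (\<forall>x. 0 \<le> \<mu> x) \<and>
     (\<forall>l\<in>L. \<forall>c. sum \<mu> {y\<in>F. q l y = c} \<le> cap l) \<and>
     (\<forall>x\<in>F. \<exists>l\<in>L. sum \<mu> {y\<in>F. q l y = q l x} = cap l)"
  using \<open>finite F\<close>
proof (induction F)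
  case empty
  show ?case by (rule exI[of _ "\<lambda>_. 0"]) (use cap in auto)
next
  case (insert x F)
  then obtain \<mu> where \<mu>: "\<And>x. 0 \<le> \<mu> x"
    "\<And>l c. l \<in> L \<Longrightarrow> sum \<mu> {y\<in>F. q l y = c} \<le> cap l"
    "\<And>x. x \<in> F \<Longrightarrow> \<exists>l\<in>L. sum \<mu> {y\<in>F. q l y = q l x} = cap l"
    by blast
  define slack where "slack l = cap l - sum \<mu> {y\<in>F. q l y = q l x}" for l
  define m where "m = Min (slack ` L)"
  have m_le: "m \<le> slack l" if "l \<in> L" for l
    using that assms(1) by (simp add: m_def)
  have "m \<in> slack ` L" unfolding m_def using assms by (intro Min_in) auto
  then obtain l0 where l0: "l0 \<in> L" "m = slack l0" by auto
  have "0 \<le> m" using l0 \<mu>(2) by (simp add: slack_def)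
  define \<nu> where "\<nu> = \<mu>(x := m)"
  have old: "sum \<nu> {y\<in>F. P y} = sum \<mu> {y\<in>F. P y}" for P
    by (rule sum.cong) (use insert.hyps in \<open>auto simp: \<nu>_def\<close>)
  have new: "sum \<nu> {y\<in>insert x F. P y} = (if P x then m else 0) + sum \<mu> {y\<in>F. P y}" for P
  proof -
    have "{y\<in>insert x F. P y} = (if P x then insert x {y\<in>F. P y} else {y\<in>F. P y})" by auto
    then show ?thesis using insert.hyps by (simp add: old) (simp add: \<nu>_def)
  qed
  have bound: "sum \<nu> {y\<in>insert x F. q l y = c} \<le> cap l" if "l \<in> L" for l c
    unfolding new using \<mu>(2)[OF that, of c] m_le[OF that] by (auto simp: slack_def)
  show ?case
  proof (intro exI[of _ \<nu>] conjI ballI allI)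
    show "0 \<le> \<nu> y" for y using \<mu>(1) \<open>0 \<le> m\<close> by (simp add: \<nu>_def)
    show "sum \<nu> {y\<in>insert x F. q l y = c} \<le> cap l" if "l \<in> L" for l c
      by (rule bound[OF that])
    fix y assume "y \<in> insert x F"
    then consider "y = x" | "y \<in> F" by blast
    then show "\<exists>l\<in>L. sum \<nu> {z\<in>insert x F. q l z = q l y} = cap l"
    proof cases
      case 1
      have "sum \<nu> {z\<in>insert x F. q l0 z = q l0 y} = cap l0"
        unfolding new 1 using l0 by (simp add: slack_def)
      then show ?thesis using l0 by blast
    next
      case 2
      then obtain l where l: "l \<in> L" "sum \<mu> {z\<in>F. q l z = q l y} = cap l"
        using \<mu>(3) by blast
      have "cap l \<le> sum \<nu> {z\<in>insert x F. q l z = q l y}"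
        unfolding new using l \<open>0 \<le> m\<close> by simp
      with bound[OF l(1)] have "sum \<nu> {z\<in>insert x F. q l z = q l y} = cap l"
        by (intro antisym)
      then show ?thesis using l by blast
    qed
  qed
qed

text \<open>Every point lies in a cell filled to capacity. The coarsest such cells form a disjoint
  cover, so the total weight equals the cost of an admissible cover and is at least 1; dividing by
  it keeps the capacity bounds.\<close>

lemma frostman_weights:
  fixes A :: "(real^'n::finite) set"
  assumes "bounded A" "0 < \<theta>" "\<theta> \<le> 1"
    and large: "\<And>C. cell_cover \<theta> k A C \<Longrightarrow> 1 \<le> cover_cost s C"
  shows "\<exists>F \<mu>. finite F \<and> F \<subseteq> A \<and> (\<forall>x\<in>F. 0 < \<mu> x) \<and> sum \<mu> F = 1 \<and>
     (\<forall>l z. k \<le> l \<longrightarrow> l \<le> top_level \<theta> k \<longrightarrow>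
        sum \<mu> {y\<in>F. cell l y = z} \<le> 2 powr - (real l * s))"
proof -
  define K where "K = top_level \<theta> k"
  have kK: "k \<le> K" unfolding K_def by (rule le_top_level[OF assms(2,3)])
  define rep where "rep z = (SOME x. x \<in> A \<and> cell K x = z)" for z
  have rep: "rep (cell K x) \<in> A \<and> cell K (rep (cell K x)) = cell K x" if "x \<in> A" for x
    unfolding rep_def by (rule someI[of _ x]) (use that in auto)
  \<comment> \<open>One representative for each cell of the finest level: a coarser cell is
    determined by a finest one, so tight cells that cover \<open>F\<close> also cover
    \<open>A\<close>.\<close>
  define F where "F = rep ` cell K ` A"
  have fin: "finite F" unfolding F_def using finite_cell_image[OF assms(1)] by blast
  have FA: "F \<subseteq> A" unfolding F_def using rep by blast
  have "\<exists>\<mu>. (\<forall>x. 0 \<le> \<mu> x) \<and>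
     (\<forall>l\<in>{k..K}. \<forall>c. sum \<mu> {y\<in>F. cell l y = c} \<le> 2 powr - (real l * s)) \<and>
     (\<forall>x\<in>F. \<exists>l\<in>{k..K}. sum \<mu> {y\<in>F. cell l y = cell l x} = 2 powr - (real l * s))"
    by (rule greedy_weights) (use kK fin in auto)
  then obtain \<mu> where \<mu>0: "\<forall>x. 0 \<le> \<mu> x"
    "\<forall>l\<in>{k..K}. \<forall>c. sum \<mu> {y\<in>F. cell l y = c} \<le> 2 powr - (real l * s)"
    "\<forall>x\<in>F. \<exists>l\<in>{k..K}. sum \<mu> {y\<in>F. cell l y = cell l x} = 2 powr - (real l * s)"
    by (elim exE conjE)
  have \<mu>: "\<And>x. 0 \<le> \<mu> x"
    "\<And>l c. l \<in> {k..K} \<Longrightarrow> sum \<mu> {y\<in>F. cell l y = c} \<le> 2 powr - (real l * s)"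
    "\<And>x. x \<in> F \<Longrightarrow> \<exists>l\<in>{k..K}. sum \<mu> {y\<in>F. cell l y = cell l x} = 2 powr - (real l * s)"
    using \<mu>0 by blast+
  define tight where "tight l x \<longleftrightarrow> k \<le> l \<and> l \<le> K \<and> sum \<mu> {y\<in>F. cell l y = cell l x} = 2 powr - (real l * s)" for l x
  \<comment> \<open>Choosing the coarsest tight level is what makes the selected cells pairwise
    disjoint.\<close>
  define lev where "lev x = (LEAST l. tight l x)" for x
  have lev: "tight (lev x) x" if "x \<in> F" for x
    unfolding lev_def by (rule LeastI_ex) (use \<mu>(3)[OF that] in \<open>auto simp: tight_def\<close>)
  have lev_le: "lev x \<le> l" if "tight l x" for l x
    unfolding lev_def using that by (rule Least_le)
  define C where "C = (\<lambda>x. (lev x, cell (lev x) x)) ` F"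
  have cov: "cell_cover \<theta> k A C"
    unfolding cell_cover_def
  proof (intro conjI ballI)
    show "finite C" using fin by (simp add: C_def)
    show "case lz of (l, z) \<Rightarrow> k \<le> l \<and> l \<le> top_level \<theta> k" if "lz \<in> C" for lz
      using that lev by (auto simp: C_def tight_def K_def)
    fix x assume x: "x \<in> A"
    define y where "y = rep (cell K x)"
    have y: "y \<in> F" "cell K y = cell K x" using x rep by (auto simp: F_def y_def)
    have "cell (lev y) y = cell (lev y) x"
      by (rule cell_mono[of _ K]) (use y lev[OF y(1)] in \<open>auto simp: tight_def\<close>)
    moreover have "(lev y, cell (lev y) y) \<in> C"
      using y(1) by (simp add: C_def)
    ultimately show "\<exists>l. (l, cell l x) \<in> C" by auto
  qed
  define grp where "grp = (\<lambda>(l, z). {y\<in>F. cell l y = z})"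
  have disj: "grp a \<inter> grp b = {}" if ab: "a \<in> C" "b \<in> C" "a \<noteq> b" for a b
  proof (rule ccontr)
    assume "grp a \<inter> grp b \<noteq> {}"
    from ab obtain x x' where x: "x \<in> F" "a = (lev x, cell (lev x) x)" and x': "x' \<in> F" "b = (lev x', cell (lev x') x')"
      by (auto simp: C_def)
    with \<open>grp a \<inter> grp b \<noteq> {}\<close> obtain y where y: "y \<in> F" "cell (lev x) y = cell (lev x) x" "cell (lev x') y = cell (lev x') x'"
      by (auto simp: grp_def)
    \<comment> \<open>If the cell chosen for \<open>v\<close> were strictly finer than that for
      \<open>u\<close> while both contain \<open>y\<close>, then \<open>v\<close> would lie in the
      tight cell of \<open>u\<close>, against the minimality of \<open>lev v\<close>.\<close>
    have *: "lev v \<le> lev u" if "u \<in> F" "v \<in> F" "cell (lev u) y = cell (lev u) u" "cell (lev v) y = cell (lev v) v" for u v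
    proof (rule ccontr)
      assume "\<not> lev v \<le> lev u"
      then have "cell (lev u) y = cell (lev u) v"
        using that cell_mono[of "lev u" "lev v" y v] by auto
      then have "tight (lev u) v"
        using lev[OF that(1)] that by (simp add: tight_def)
      then show False using lev_le \<open>\<not> lev v \<le> lev u\<close> by blast
    qed
    have "lev x = lev x'" using *[of x x'] *[of x' x] x x' y by auto
    then show False using x x' y ab by auto
  qed
  have "cover_cost s C = (\<Sum>c\<in>C. sum \<mu> (grp c))"
    unfolding cover_cost_def
  proof (rule sum.cong[OF refl])
    fix c assume "c \<in> C"
    then obtain x where "x \<in> F" "c = (lev x, cell (lev x) x)" by (auto simp: C_def)
    then show "(case c of (l, z) \<Rightarrow> 2 powr - (real l * s)) = sum \<mu> (grp c)"
      using lev[of x] by (simp add: tight_def grp_def)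
  qed
  also have "\<dots> = sum \<mu> (\<Union>c\<in>C. grp c)"
    by (rule sum.UNION_disjoint[symmetric]) (use fin disj in \<open>auto simp: C_def grp_def\<close>)
  also have "\<dots> \<le> sum \<mu> F"
    using fin \<mu>(1) by (intro sum_mono2) (auto simp: grp_def)
  finally have total: "1 \<le> sum \<mu> F" using large[OF cov] by simp
  define W where "W = sum \<mu> F"
  \<comment> \<open>Points of weight 0 are dropped: the coefficients built from the measure have to
    be positive at every point of its support.\<close>
  define F' where "F' = {x\<in>F. \<mu> x \<noteq> 0}"
  have sumF': "sum \<mu> {y\<in>F'. P y} = sum \<mu> {y\<in>F. P y}" for P
    unfolding F'_def using fin by (intro sum.mono_neutral_left) auto
  show ?thesis
  proof (intro exI[of _ F'] exI[of _ "\<lambda>x. \<mu> x / W"] conjI ballI allI impI)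
    show "finite F'" "F' \<subseteq> A" using fin FA by (auto simp: F'_def)
    show "0 < \<mu> x / W" if "x \<in> F'" for x
      using that \<mu>(1)[of x] total by (auto simp: F'_def W_def)
    show "(\<Sum>x\<in>F'. \<mu> x / W) = 1"
      using sumF'[of "\<lambda>_. True"] total by (simp add: W_def flip: sum_divide_distrib)
    fix l z assume l: "k \<le> l" "l \<le> top_level \<theta> k"
    have "(\<Sum>x\<in>{y\<in>F'. cell l y = z}. \<mu> x / W) = sum \<mu> {y\<in>F. cell l y = z} / W"
      by (simp add: sumF' flip: sum_divide_distrib)
    also have "\<dots> \<le> sum \<mu> {y\<in>F. cell l y = z}"
    proof -
      have "sum \<mu> {y\<in>F. cell l y = z} * 1 \<le> sum \<mu> {y\<in>F. cell l y = z} * W"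
        using total \<mu>(1) by (intro mult_left_mono) (auto simp: W_def sum_nonneg)
      then show ?thesis using total by (simp add: W_def divide_le_eq)
    qed
    also have "\<dots> \<le> 2 powr - (real l * s)" using \<mu>(2) l by (simp add: K_def)
    finally show "(\<Sum>x\<in>{y\<in>F'. cell l y = z}. \<mu> x / W) \<le> 2 powr - (real l * s)" .
  qed
qed

section \<open>Choosing by averaging\<close>

lemma card_PiE_bad_le:
  assumes "finite S" "c \<in> S" "finite G"
    and bad: "\<And>g. g \<in> PiE S (\<lambda>_. G) \<Longrightarrow> real (card {v\<in>G. bad (g(c := v))}) \<le> q * real (card G)"
  shows "real (card {g \<in> PiE S (\<lambda>_. G). bad g}) \<le> q * real (card (PiE S (\<lambda>_. G)))"
proof -
  define R where "R = PiE (S - {c}) (\<lambda>_. G)"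
  define put where "put = (\<lambda>(v, h). h(c := v) :: 'a \<Rightarrow> 'b)"
  have S: "insert c (S - {c}) = S" using assms(2) by blast
  have fR: "finite R" unfolding R_def using assms by (intro finite_PiE) auto
  have bij: "bij_betw put (G \<times> R) (PiE S (\<lambda>_. G))"
    unfolding bij_betw_def
  proof
    show "inj_on put (G \<times> R)"
    proof (rule inj_onI, clarsimp simp: put_def)
      fix v h v' h' assume h: "h \<in> R" "h' \<in> R" and eq: "h(c := v) = h'(c := v')"
      have "v = v'" using fun_cong[OF eq, of c] by simp
      moreover have "h x = h' x" for x
        using fun_cong[OF eq, of x] h by (cases "x = c") (auto simp: R_def PiE_def extensional_def)
      ultimately show "v = v' \<and> h = h'" by auto
    qed
    show "put ` (G \<times> R) = PiE S (\<lambda>_. G)"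
      unfolding put_def R_def using PiE_insert_eq[of c "S - {c}" "\<lambda>_. G"] S by simp
  qed
  have "card {g \<in> PiE S (\<lambda>_. G). bad g} = card {p \<in> G \<times> R. bad (put p)}"
  proof -
    have "bij_betw put {p \<in> G \<times> R. bad (put p)} {g \<in> PiE S (\<lambda>_. G). bad g}"
      using bij unfolding bij_betw_def by (auto simp: inj_on_def)
    then show ?thesis by (simp add: bij_betw_same_card)
  qed
  also have "{p \<in> G \<times> R. bad (put p)} = (\<Union>h\<in>R. (\<lambda>v. (v, h)) ` {v\<in>G. bad (h(c := v))})"
    by (auto simp: put_def)
  also have "card \<dots> \<le> (\<Sum>h\<in>R. card ((\<lambda>v. (v, h)) ` {v\<in>G. bad (h(c := v))}))"
    by (rule card_UN_le[OF fR])
  also have "\<dots> = (\<Sum>h\<in>R. card {v\<in>G. bad (h(c := v))})"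
    by (intro sum.cong refl card_image) (simp add: inj_on_def)
  finally have "real (card {g \<in> PiE S (\<lambda>_. G). bad g}) \<le> (\<Sum>h\<in>R. real (card {v\<in>G. bad (h(c := v))}))"
    unfolding of_nat_sum[symmetric] of_nat_le_iff .
  also have "\<dots> \<le> (\<Sum>h\<in>R. q * real (card G))"
  proof (rule sum_mono)
    fix h assume h: "h \<in> R"
    show "real (card {v\<in>G. bad (h(c := v))}) \<le> q * real (card G)"
    proof (cases "G = {}")
      case False
      then obtain v0 where v0: "v0 \<in> G" by blast
      have "put (v0, h) \<in> PiE S (\<lambda>_. G)" using bij v0 h by (auto simp: bij_betw_def)
      then have "h(c := v0) \<in> PiE S (\<lambda>_. G)" by (simp add: put_def)
      from bad[OF this] show ?thesis by simp
    qed simp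
  qed
  also have "\<dots> = q * real (card G * card R)" by simp
  also have "card G * card R = card (PiE S (\<lambda>_. G))"
    using bij_betw_same_card[OF bij] by (simp add: card_cartesian_product)
  finally show ?thesis .
qed

text \<open>First moment method, with counting in place of probability. An event with
  \<open>q p\<close> at least 1 is bounded trivially; any other event has one coordinate whose
  choice alone makes it rare, whatever the remaining coordinates are.\<close>

lemma averaging_choice:
  fixes w q :: "'p \<Rightarrow> real" and coord :: "'p \<Rightarrow> 'a" and bad :: "'p \<Rightarrow> ('a \<Rightarrow> 'b) \<Rightarrow> bool"
  assumes "finite S" "finite G" "G \<noteq> {}" "finite P" and w: "\<And>p. p \<in> P \<Longrightarrow> 0 \<le> w p"
    and q: "\<And>p. p \<in> P \<Longrightarrow> 1 \<le> q p \<or>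
       coord p \<in> S \<and> (\<forall>g \<in> PiE S (\<lambda>_. G). real (card {v\<in>G. bad p (g(coord p := v))}) \<le> q p * real (card G))"
  shows "\<exists>g \<in> PiE S (\<lambda>_. G). (\<Sum>p\<in>P. w p * of_bool (bad p g)) \<le> (\<Sum>p\<in>P. w p * q p)"
proof (rule ccontr)
  let ?A = "PiE S (\<lambda>_. G)"
  assume "\<not> ?thesis"
  then have less: "(\<Sum>p\<in>P. w p * q p) < (\<Sum>p\<in>P. w p * of_bool (bad p g))" if "g \<in> ?A" for g
    using that by (simp add: not_le)
  have fin: "finite ?A" using assms by (intro finite_PiE) auto
  have ne: "?A \<noteq> {}" using assms by (simp add: PiE_eq_empty_iff)
  have "(\<Sum>g\<in>?A. \<Sum>p\<in>P. w p * q p) < (\<Sum>g\<in>?A. \<Sum>p\<in>P. w p * of_bool (bad p g))"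
    by (rule sum_strict_mono[OF fin ne less])
  also have "\<dots> = (\<Sum>p\<in>P. w p * real (card {g\<in>?A. bad p g}))"
    by (subst sum.swap) (simp add: fin Int_def flip: sum_distrib_left)
  also have "\<dots> \<le> (\<Sum>p\<in>P. w p * (q p * real (card ?A)))"
  proof (intro sum_mono mult_left_mono w)
    fix p assume p: "p \<in> P"
    show "real (card {g\<in>?A. bad p g}) \<le> q p * real (card ?A)"
    proof (cases "1 \<le> q p")
      case True
      have "card {g\<in>?A. bad p g} \<le> card ?A" by (intro card_mono fin) auto
      then have "real (card {g\<in>?A. bad p g}) \<le> 1 * real (card ?A)" by simp
      also have "\<dots> \<le> q p * real (card ?A)" by (intro mult_right_mono True) simp
      finally show ?thesis .
    next
      case False
      then show ?thesis using q[OF p] assms by (intro card_PiE_bad_le[where c = "coord p"]) auto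
    qed
  qed
  also have "\<dots> = (\<Sum>g\<in>?A. \<Sum>p\<in>P. w p * q p)"
    by (simp add: sum_distrib_left mult_ac)
  finally show False by simp
qed

section \<open>Intermediate dimensions through dyadic covers\<close>

text \<open>The cube is enlarged to an exactly prescribed diameter, because
  \<open>covering_number\<close> admits only sets of diameter equal to \<open>r\<close>.\<close>

lemma cube_of_cell:
  fixes z :: "int^'n::finite"
  assumes "sqrt (real CARD('n)) * 2 powr - real l \<le> m"
  shows "\<exists>X. bounded X \<and> diameter X = m \<and> {x. cell l x = z} \<subseteq> X"
proof -
  let ?N = "sqrt (real CARD('n))"
  have N: "?N > 0" by simp
  define h where "h = m / ?N"
  have h: "2 powr - real l \<le> h" using assms N by (simp add: h_def field_simps)
  then have "h > 0" by (smt (verit) powr_gt_zero)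
  define a :: "real^'n" where "a = (\<chi> j. real_of_int (z $ j) / 2 ^ l)"
  define b :: "real^'n" where "b = (\<chi> j. a $ j + h)"
  have le: "\<forall>i\<in>Basis. a \<bullet> i \<le> b \<bullet> i"
    using \<open>h > 0\<close> by (auto simp: Basis_vec_def inner_axis b_def)
  have "diameter (cbox a b) = dist a b"
    by (rule diameter_cbox[OF le])
  also have "\<dots> = ?N * h"
    using \<open>h > 0\<close> by (simp add: dist_norm norm_vec_def L2_set_def b_def real_sqrt_mult)
  also have "\<dots> = m" using N by (simp add: h_def)
  finally have "diameter (cbox a b) = m" .
  moreover have "{x. cell l x = z} \<subseteq> cbox a b"
  proof (rule subsetI, simp add: mem_box_cart, intro allI)
    fix x j assume "cell l x = z"
    then have "real_of_int (z $ j) \<le> 2 ^ l * x $ j" "2 ^ l * x $ j < real_of_int (z $ j) + 1"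
      using cell_bounds[of l x j] by auto
    then have "a $ j \<le> x $ j" "x $ j \<le> a $ j + 2 powr - real l"
      by (simp_all add: a_def powr_minus powr_realpow field_simps)
    then show "a $ j \<le> x $ j \<and> x $ j \<le> b $ j" using h by (simp add: b_def)
  qed
  ultimately show ?thesis using bounded_cbox by blast
qed

lemma dyadic_scale:
  assumes "0 < \<delta>" "\<delta> \<le> N * 2 powr - real K" "0 < N"
  shows "\<exists>k\<ge>K. N * 2 powr - real k \<le> \<delta> \<and> \<delta> < 2 * N * 2 powr - real k"
proof -
  define L where "L = log 2 (N / \<delta>)"
  have L: "2 powr L = N / \<delta>" using assms by (simp add: L_def)
  have "2 powr real K \<le> N / \<delta>"
    using assms by (simp add: powr_minus field_simps)
  then have KL: "real K \<le> L" using L by (metis powr_le_cancel_iff one_less_numeral_iff semiring_norm(76))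
  define k where "k = nat \<lceil>L\<rceil>"
  have k: "L \<le> real k" "real k < L + 1" using KL unfolding k_def by linarith+
  have "N / \<delta> \<le> 2 powr real k" unfolding L[symmetric] using k by simp
  moreover have "2 powr real k < 2 powr (L + 1)" using k by (intro powr_less_mono) auto
  then have "2 powr real k < 2 * (N / \<delta>)" by (simp add: powr_add L mult.commute)
  ultimately show ?thesis
    using k KL assms by (intro exI[of _ k]) (auto simp: powr_minus field_simps)
qed

text \<open>Cells that are too fine are enlarged to diameter \<delta> powr (1 / \<theta>). Their
  level exceeds k / \<theta> by less than 1, so the diameter stays comparable to the cell
  size.\<close>

lemma cubes_of_cell_cover:
  fixes A :: "(real^'n::finite) set" and \<theta> :: real
  defines "N \<equiv> sqrt (real CARD('n))"
  assumes "0 < \<theta>" "\<theta> \<le> 1" and C: "cell_cover \<theta> k A C"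
    and \<delta>: "0 < \<delta>" "\<delta> \<le> 1" "N * 2 powr - real k \<le> \<delta>" "\<delta> < 2 * N * 2 powr - real k"
  shows "\<exists>X. A \<subseteq> (\<Union>c\<in>C. X c) \<and> (\<forall>c\<in>C. bounded (X c) \<and> \<delta> powr (1 / \<theta>) \<le> diameter (X c) \<and>
            diameter (X c) \<le> \<delta> \<and>
            diameter (X c) \<le> 2 * (2 * N) powr (1 / \<theta>) * 2 powr - real (fst c))"
proof -
  have N1: "1 \<le> N" by (simp add: N_def)
  have \<theta>1: "1 \<le> 1 / \<theta>" using assms by simp
  define m where "m l = max (N * 2 powr - real l) (\<delta> powr (1 / \<theta>))" for l
  have ex: "\<forall>c :: nat \<times> (int^'n). \<exists>X. bounded X \<and> diameter X = m (fst c) \<and> {x. cell (fst c) x = snd c} \<subseteq> X"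
    by (intro allI cube_of_cell) (simp add: m_def N_def)
  then obtain X where X: "\<And>c. bounded (X c) \<and> diameter (X c) = m (fst c) \<and> {x :: real^'n. cell (fst c) x = snd c} \<subseteq> X c"
    by metis
  have \<delta>le: "\<delta> powr (1 / \<theta>) \<le> \<delta>"
    using powr_mono'[of 1 "1/\<theta>" \<delta>] \<theta>1 \<delta> by simp
  show ?thesis
  proof (intro exI[of _ X] conjI ballI)
    show "A \<subseteq> (\<Union>c\<in>C. X c)"
      using C X unfolding cell_cover_def by fastforce
    fix c assume c: "c \<in> C"
    then have l: "k \<le> fst c" "fst c \<le> top_level \<theta> k" using C by (auto simp: cell_cover_def)
    show "bounded (X c)" "\<delta> powr (1 / \<theta>) \<le> diameter (X c)" using X by (auto simp: m_def)
    have "N * 2 powr - real (fst c) \<le> N * 2 powr - real k" using l N1 by (intro mult_left_mono) auto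
    then show "diameter (X c) \<le> \<delta>" using X \<delta> \<delta>le by (simp add: m_def)
    have "N \<le> (2 * N) powr 1" using N1 by simp
    also have "\<dots> \<le> (2 * N) powr (1 / \<theta>)" using N1 \<theta>1 by (intro powr_mono) auto
    finally have N2: "N \<le> 2 * (2 * N) powr (1 / \<theta>)" using N1 by linarith
    have "\<delta> powr (1 / \<theta>) \<le> (2 * N * 2 powr - real k) powr (1 / \<theta>)"
      using \<delta> assms(2) by (intro powr_mono2) auto
    also have "\<dots> = (2 * N) powr (1 / \<theta>) * 2 powr - (real k / \<theta>)"
      using N1 by (simp add: powr_mult powr_powr)
    also have "\<dots> \<le> (2 * N) powr (1 / \<theta>) * 2 powr (1 - real (fst c))"
      using l top_level_bounds[OF assms(2), of k] by (intro mult_left_mono powr_mono) auto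
    also have "\<dots> = 2 * (2 * N) powr (1 / \<theta>) * 2 powr - real (fst c)"
      by (simp add: powr_diff powr_minus field_simps)
    finally have "\<delta> powr (1 / \<theta>) \<le> 2 * (2 * N) powr (1 / \<theta>) * 2 powr - real (fst c)" .
    then show "diameter (X c) \<le> 2 * (2 * N) powr (1 / \<theta>) * 2 powr - real (fst c)"
      using X N2 by (simp add: m_def)
  qed
qed

text \<open>A set of diameter at most 2 powr - l meets at most 3 ^ n cells of level l. Rounding the
  level down loses a factor 2 in the diameter, hence 2 powr s in the cost.\<close>

lemma cell_cover_of_cover:
  fixes A :: "(real^'n::finite) set"
  assumes "bounded A" "0 < \<theta>" "\<theta> \<le> 1" "0 < s"
    and cov: "intermediate_cover \<theta> (2 powr - real k) A I X"
    and summ: "(\<lambda>i. diameter (X i) powr s) summable_on I"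
  shows "\<exists>C. cell_cover \<theta> k A C \<and>
     cover_cost s C \<le> 3 ^ CARD('n) * 2 powr s * (\<Sum>\<^sub>\<infinity>i\<in>I. diameter (X i) powr s)"
proof -
  define d where "d i = diameter (X i)" for i
  define lev where "lev i = nat \<lfloor>- log 2 (d i)\<rfloor>" for i
  have bd: "bounded (X i)" "2 powr - (real k / \<theta>) \<le> d i" "d i \<le> 2 powr - real k" if "i \<in> I" for i
    using cov that by (auto simp: intermediate_cover_def d_def powr_powr)
  have lev: "k \<le> lev i" "lev i \<le> top_level \<theta> k" "d i \<le> 2 powr - real (lev i)"
    "2 powr - real (lev i) \<le> 2 * d i" if "i \<in> I" for i
  proof -
    have pos: "d i > 0" using bd(2)[OF that] by (smt (verit) powr_gt_zero)
    define L where "L = - log 2 (d i)"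
    have dL: "d i = 2 powr - L" using pos by (simp add: L_def)
    have L: "real k \<le> L" "L \<le> real k / \<theta>"
      using bd[OF that] unfolding dL by simp_all
    have le: "real (lev i) \<le> L" "L < real (lev i) + 1" using L(1) unfolding lev_def L_def[symmetric] by linarith+
    show "k \<le> lev i" using L(1) le by linarith
    show "lev i \<le> top_level \<theta> k" using L(2) le top_level_bounds[OF assms(2), of k] by linarith
    show "d i \<le> 2 powr - real (lev i)" unfolding dL using le by simp
    have "2 powr - real (lev i) \<le> 2 powr (1 - L)" using le by simp
    then show "2 powr - real (lev i) \<le> 2 * d i" unfolding dL by (simp add: powr_diff powr_minus field_simps)
  qed
  define P where "P c i \<longleftrightarrow> i \<in> I \<and> (\<exists>x\<in>A \<inter> X i. c = (lev i, cell (lev i) x))" for c i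
  \<comment> \<open>The covering family may be infinite, but levels are bounded and \<open>A\<close>
    is bounded, so only finitely many cells arise.\<close>
  define C where "C = {c. \<exists>i. P c i}"
  have "C \<subseteq> Sigma {k..top_level \<theta> k} (\<lambda>l. cell l ` A)"
    using lev by (auto simp: C_def P_def)
  then have finC: "finite C"
    by (rule finite_subset) (auto intro!: finite_cell_image assms)
  have cover: "cell_cover \<theta> k A C"
    unfolding cell_cover_def
  proof (intro conjI ballI finC)
    show "case c of (l, z) \<Rightarrow> k \<le> l \<and> l \<le> top_level \<theta> k" if "c \<in> C" for c
      using that lev by (auto simp: C_def P_def)
    fix x assume x: "x \<in> A"
    then obtain i where "i \<in> I" "x \<in> X i" using cov by (auto simp: intermediate_cover_def)
    then have "(lev i, cell (lev i) x) \<in> C" using x by (auto simp: C_def P_def)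
    then show "\<exists>l. (l, cell l x) \<in> C" ..
  qed
  \<comment> \<open>Each cell is charged to one covering set. The cost becomes a finite sum over the
    sets used, with multiplicity at most 3 ^ n, and is comparable to the infinite sum.\<close>
  define j where "j c = (SOME i. P c i)" for c
  have j: "P c (j c)" if "c \<in> C" for c
    unfolding j_def by (rule someI_ex) (use that in \<open>simp add: C_def\<close>)
  have fiber: "real (card {c\<in>C. j c = i}) \<le> 3 ^ CARD('n)" if i: "i \<in> j ` C" for i
  proof -
    from i obtain c0 where "c0 \<in> C" "j c0 = i" by blast
    with j[of c0] obtain x0 where x0: "i \<in> I" "x0 \<in> X i" by (auto simp: P_def)
    have "{c\<in>C. j c = i} \<subseteq> Pair (lev i) ` {w. near 1 (cell (lev i) x0) w}"
    proof
      fix c assume "c \<in> {c\<in>C. j c = i}"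
      then obtain x where x: "x \<in> X i" "c = (lev i, cell (lev i) x)" using j[of c] by (auto simp: P_def)
      have "near 1 (cell (lev i) x0) (cell (lev i) x)"
      proof (rule dist_imp_near_cell)
        fix a
        have "\<bar>x0 $ a - x $ a\<bar> \<le> norm (x0 - x)"
          using component_le_norm_cart[of "x0 - x" a] by simp
        also have "\<dots> \<le> d i"
          using diameter_bounded_bound[OF bd(1)[OF x0(1)] x0(2) x(1)] by (simp add: dist_norm d_def)
        finally show "\<bar>x0 $ a - x $ a\<bar> \<le> 2 powr - real (lev i)" using lev(3)[OF x0(1)] by linarith
      qed
      then show "c \<in> Pair (lev i) ` {w. near 1 (cell (lev i) x0) w}" using x by blast
    qed
    then have "card {c\<in>C. j c = i} \<le> card (Pair (lev i) ` {w. near 1 (cell (lev i) x0) w})"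
      by (intro card_mono) (simp_all add: finite_near)
    also have "\<dots> \<le> card {w. near 1 (cell (lev i) x0) w}" by (intro card_image_le finite_near)
    also have "\<dots> = 3 ^ CARD('n)" by (simp add: card_near)
    finally have "real (card {c\<in>C. j c = i}) \<le> real (3 ^ CARD('n))" by (rule of_nat_mono)
    then show ?thesis by simp
  qed
  have "cover_cost s C \<le> (\<Sum>c\<in>C. 2 powr s * d (j c) powr s)"
    unfolding cover_cost_def
  proof (rule sum_mono, clarify)
    fix l z assume lz: "(l, z) \<in> C"
    from j[OF this] have jl: "j (l, z) \<in> I" "l = lev (j (l, z))" by (auto simp: P_def)
    have "2 powr - (real l * s) = (2 powr - real (lev (j (l, z)))) powr s"
      by (subst jl(2)) (simp add: powr_powr)
    also have "\<dots> \<le> (2 * d (j (l, z))) powr s"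
      using lev(4)[OF jl(1)] assms(4) by (intro powr_mono2) auto
    also have "\<dots> = 2 powr s * d (j (l, z)) powr s"
      by (simp add: powr_mult)
    finally show "2 powr - (real l * s) \<le> 2 powr s * d (j (l, z)) powr s" .
  qed
  also have "\<dots> = (\<Sum>i\<in>j ` C. \<Sum>c\<in>{c\<in>C. j c = i}. 2 powr s * d (j c) powr s)"
    by (rule sum.image_gen[OF finC])
  also have "\<dots> = (\<Sum>i\<in>j ` C. real (card {c\<in>C. j c = i}) * (2 powr s * d i powr s))"
    by (intro sum.cong refl) simp
  also have "\<dots> \<le> (\<Sum>i\<in>j ` C. 3 ^ CARD('n) * (2 powr s * d i powr s))"
    by (intro sum_mono mult_right_mono fiber) auto
  also have "\<dots> = 3 ^ CARD('n) * 2 powr s * (\<Sum>i\<in>j ` C. d i powr s)"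
    by (simp add: sum_distrib_left mult_ac)
  also have "\<dots> \<le> 3 ^ CARD('n) * 2 powr s * (\<Sum>\<^sub>\<infinity>i\<in>I. d i powr s)"
    using j finC summ by (intro mult_left_mono finite_sum_le_infsum) (auto simp: P_def d_def)
  finally show ?thesis using cover by (auto simp: d_def)
qed

lemma bounded_content_CARD:
  fixes A :: "(real^'n::finite) set"
  assumes "bounded A" "0 < \<theta>" "\<theta> \<le> 1" "real CARD('n) \<le> s"
  shows "bounded_content \<theta> A s"
  unfolding bounded_content_def
proof (intro exI allI impI conjI)
  fix k :: nat
  let ?C = "Pair k ` cell k ` A"
  show "cell_cover \<theta> k A ?C"
    using le_top_level[OF assms(2,3), of k] finite_cell_image[OF assms(1)] by (auto simp: cell_cover_def)
  have "cover_cost s ?C = real (card (cell k ` A)) * 2 powr - (real k * s)"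
    unfolding cover_cost_def by (subst sum.reindex) (auto simp: inj_on_def)
  also have "\<dots> \<le> (real (card (cell 0 ` A)) * 2 powr (real CARD('n) * real k)) * 2 powr - (real k * s)"
    by (intro mult_right_mono card_cell_image_le assms) auto
  also have "\<dots> = real (card (cell 0 ` A)) * 2 powr - (real k * (s - real CARD('n)))"
    by (simp add: algebra_simps flip: powr_add)
  also have "\<dots> \<le> real (card (cell 0 ` A)) * 1"
  proof (rule mult_left_mono)
    have "2 powr - (real k * (s - real CARD('n))) \<le> 2 powr 0"
      using assms by (intro powr_mono) auto
    then show "2 powr - (real k * (s - real CARD('n))) \<le> 1" by simp
  qed simp
  finally show "cover_cost s ?C \<le> real (card (cell 0 ` A))" by simp
qed

lemma powr_decay:
  fixes c :: real
  assumes "0 < c"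
  shows "(\<lambda>k::nat. 2 powr - (real k * c)) \<longlonglongrightarrow> 0"
  using assms by real_asymp

text \<open>Raising the exponent from \<open>s\<close> to \<open>s'\<close> multiplies each term by
  at most a constant times 2 powr - (k * (s' - s)), which turns a bounded cost into an arbitrarily
  small one.\<close>

lemma bounded_content_imp_cheap_covers:
  fixes A :: "(real^'n::finite) set"
  assumes "0 < \<theta>" "\<theta> \<le> 1" and bc: "bounded_content \<theta> A s" and "0 < s" "s < s'" and "0 < \<epsilon>"
  shows "\<exists>\<delta>\<^sub>0>0. \<forall>\<delta>. 0 < \<delta> \<and> \<delta> \<le> \<delta>\<^sub>0 \<longrightarrow>
     (\<exists>I C. intermediate_cover \<theta> \<delta> A I C \<and> (\<lambda>i. diameter (C i) powr s') summable_on I \<and>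
        (\<Sum>\<^sub>\<infinity>i\<in>I. diameter (C i) powr s') < \<epsilon>)"
proof -
  define N where "N = sqrt (real CARD('n))"
  have N: "0 < N" "1 \<le> N" by (simp_all add: N_def)
  obtain B K where BK: "\<And>k. k \<ge> K \<Longrightarrow> \<exists>C. cell_cover \<theta> k A C \<and> cover_cost s C \<le> B"
    using bc unfolding bounded_content_def by blast
  define D where "D = (2 * (2 * N) powr (1 / \<theta>)) powr s'"
  have "(\<lambda>k. D * B * 2 powr - (real k * (s' - s))) \<longlonglongrightarrow> D * B * 0"
  proof (rule tendsto_mult_left)
    have "s' - s > 0" using assms by simp
    then show "(\<lambda>k. 2 powr - (real k * (s' - s))) \<longlonglongrightarrow> 0" by (rule powr_decay)
  qed
  then have "eventually (\<lambda>k. D * B * 2 powr - (real k * (s' - s)) < \<epsilon>) sequentially"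
    using \<open>0 < \<epsilon>\<close> by (simp add: order_tendstoD(2))
  then obtain K' where K': "\<And>k. k \<ge> K' \<Longrightarrow> D * B * 2 powr - (real k * (s' - s)) < \<epsilon>"
    by (auto simp: eventually_sequentially)
  define \<delta>\<^sub>0 where "\<delta>\<^sub>0 = min 1 (N * 2 powr - real (max K K'))"
  show ?thesis
  proof (intro exI[of _ \<delta>\<^sub>0] conjI allI impI)
    show "0 < \<delta>\<^sub>0" using N by (simp add: \<delta>\<^sub>0_def)
    fix \<delta> assume \<delta>: "0 < \<delta> \<and> \<delta> \<le> \<delta>\<^sub>0"
    then obtain k where k: "k \<ge> max K K'" "N * 2 powr - real k \<le> \<delta>" "\<delta> < 2 * N * 2 powr - real k"
      using dyadic_scale[of \<delta> N "max K K'"] N by (auto simp: \<delta>\<^sub>0_def)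
    obtain C where C: "cell_cover \<theta> k A C" "cover_cost s C \<le> B" using BK k by auto
    have "\<delta> \<le> 1" using \<delta> by (simp add: \<delta>\<^sub>0_def)
    obtain X where X: "A \<subseteq> (\<Union>c\<in>C. X c)" "\<And>c. c \<in> C \<Longrightarrow> bounded (X c) \<and> \<delta> powr (1 / \<theta>) \<le> diameter (X c) \<and>
            diameter (X c) \<le> \<delta> \<and> diameter (X c) \<le> 2 * (2 * N) powr (1 / \<theta>) * 2 powr - real (fst c)"
      using cubes_of_cell_cover[OF assms(1,2) C(1), of \<delta>] \<delta> \<open>\<delta> \<le> 1\<close> k unfolding N_def by blast
    have finC: "finite C" using C by (simp add: cell_cover_def)
    then obtain h where h: "bij_betw h {0..<card C} C" using ex_bij_betw_nat_finite by blast
    have hC: "h i \<in> C" if "i \<in> {0..<card C}" for i using h that by (auto simp: bij_betw_def)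
    have "(\<Sum>\<^sub>\<infinity>i\<in>{0..<card C}. diameter (X (h i)) powr s') = (\<Sum>i\<in>{0..<card C}. diameter (X (h i)) powr s')"
      by simp
    also have "\<dots> = (\<Sum>c\<in>C. diameter (X c) powr s')"
      by (rule sum.reindex_bij_betw[OF h])
    also have "\<dots> \<le> (\<Sum>c\<in>C. D * 2 powr - (real k * (s' - s)) * (case c of (l, z) \<Rightarrow> 2 powr - (real l * s)))"
    proof (rule sum_mono, clarify)
      fix l z assume lz: "(l, z) \<in> C"
      then have kl: "k \<le> l" using C by (auto simp: cell_cover_def)
      have "diameter (X (l, z)) powr s' \<le> (2 * (2 * N) powr (1 / \<theta>) * 2 powr - real l) powr s'"
        using X(2)[OF lz] assms diameter_ge_0 by (intro powr_mono2) auto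
      also have "\<dots> = D * 2 powr - (real l * s')"
        by (simp add: powr_mult powr_powr D_def)
      also have split: "2 powr - (real l * s') = 2 powr - (real l * (s' - s)) * 2 powr - (real l * s)"
        by (simp add: algebra_simps flip: powr_add)
      also have "D * (2 powr - (real l * (s' - s)) * 2 powr - (real l * s))
          \<le> D * (2 powr - (real k * (s' - s)) * 2 powr - (real l * s))"
        using kl assms by (intro mult_left_mono mult_right_mono powr_mono) (auto simp: D_def intro: mult_right_mono)
      finally show "diameter (X (l, z)) powr s' \<le> D * 2 powr - (real k * (s' - s)) * 2 powr - (real l * s)"
        by (simp only: mult.assoc)
    qed
    also have "\<dots> = D * 2 powr - (real k * (s' - s)) * cover_cost s C"
      by (simp add: cover_cost_def sum_distrib_left)
    also have "\<dots> \<le> D * 2 powr - (real k * (s' - s)) * B"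
      using C by (intro mult_left_mono) (auto simp: D_def)
    also have "\<dots> < \<epsilon>" using K'[of k] k by (simp add: mult_ac)
    finally have lt: "(\<Sum>\<^sub>\<infinity>i\<in>{0..<card C}. diameter (X (h i)) powr s') < \<epsilon>" .
    have "A \<subseteq> (\<Union>i\<in>{0..<card C}. X (h i))"
      using X(1) h by (simp add: bij_betw_def image_image[symmetric])
    then have "intermediate_cover \<theta> \<delta> A {0..<card C} (\<lambda>i. X (h i))"
      using X(2) hC by (auto simp: intermediate_cover_def)
    then show "\<exists>I C. intermediate_cover \<theta> \<delta> A I C \<and> (\<lambda>i. diameter (C i) powr s') summable_on I \<and>
        (\<Sum>\<^sub>\<infinity>i\<in>I. diameter (C i) powr s') < \<epsilon>"
      using lt by (intro exI[of _ "{0..<card C}"] exI[of _ "\<lambda>i. X (h i)"]) auto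
  qed
qed

text \<open>Nothing is asked at \<open>L\<close> itself: two conditions that disagree only at the
  critical exponent define the same dimension.\<close>

lemma Inf_threshold:
  fixes L :: real
  assumes "0 \<le> L" "\<And>s. 0 < s \<Longrightarrow> L < s \<Longrightarrow> P s" "\<And>s. 0 < s \<Longrightarrow> P s \<Longrightarrow> L \<le> s"
  shows "Inf {s. 0 < s \<and> P s} = L"
proof (rule cInf_eq_non_empty)
  show "{s. 0 < s \<and> P s} \<noteq> {}"
    using assms(1) assms(2)[of "L + 1"] by (auto intro!: exI[of _ "L + 1"])
  show "L \<le> x" if "x \<in> {s. 0 < s \<and> P s}" for x using assms(3) that by blast
  show "y \<le> L" if "\<And>x. x \<in> {s. 0 < s \<and> P s} \<Longrightarrow> y \<le> x" for y
  proof (rule dense_ge)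
    fix x assume "L < x"
    then show "y \<le> x" using that[of x] assms(1) assms(2)[of x] by simp
  qed
qed

lemma Inf_threshold_props:
  fixes P :: "real \<Rightarrow> bool" and d s :: real
  defines "d \<equiv> Inf {s. 0 < s \<and> P s}"
  assumes "0 < s"
  shows "P s \<Longrightarrow> d \<le> s" and "s < d \<Longrightarrow> \<not> P s"
proof -
  have bdd: "bdd_below {s. 0 < s \<and> P s}" by (rule bdd_belowI[of _ 0]) auto
  show *: "P s \<Longrightarrow> d \<le> s" unfolding d_def using assms(2) by (intro cInf_lower bdd) auto
  show "s < d \<Longrightarrow> \<not> P s" using * by linarith
qed

section \<open>Box-counting numbers and the identification of the dimensions\<close>

lemma covering_number_le:
  assumes "finite \<C>" "A \<subseteq> \<Union>\<C>" "\<And>X. X \<in> \<C> \<Longrightarrow> bounded X \<and> diameter X = r"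
  shows "covering_number A r \<le> card \<C>"
  unfolding covering_number_def by (rule Least_le) (use assms in blast)

lemma covering_number_attained:
  assumes "finite \<C>0" "A \<subseteq> \<Union>\<C>0" "\<And>X. X \<in> \<C>0 \<Longrightarrow> bounded X \<and> diameter X = r"
  shows "\<exists>\<C>. finite \<C> \<and> card \<C> = covering_number A r \<and> A \<subseteq> \<Union>\<C> \<and> (\<forall>X\<in>\<C>. bounded X \<and> diameter X = r)"
  unfolding covering_number_def by (rule LeastI_ex) (use assms in blast)

lemma top_level_1: "top_level 1 k = k"
  by (simp add: top_level_def)

lemma covering_number_le_card:
  fixes A :: "(real^'n::finite) set"
  assumes "cell_cover 1 k A C" "0 < r" "r \<le> 1"
    "sqrt (real CARD('n)) * 2 powr - real k \<le> r" "r < 2 * sqrt (real CARD('n)) * 2 powr - real k"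
  shows "covering_number A r \<le> card C"
    and "\<exists>\<C>. finite \<C> \<and> card \<C> = covering_number A r \<and> A \<subseteq> \<Union>\<C> \<and> (\<forall>X\<in>\<C>. bounded X \<and> diameter X = r)"
proof -
  obtain X where X: "A \<subseteq> (\<Union>c\<in>C. X c)" "\<And>c. c \<in> C \<Longrightarrow> bounded (X c) \<and> r powr (1 / 1) \<le> diameter (X c) \<and>
            diameter (X c) \<le> r"
    using cubes_of_cell_cover[OF _ _ assms(1,2,3,4,5)] by auto
  have fin: "finite (X ` C)" using assms(1) by (simp add: cell_cover_def)
  have X': "bounded Y \<and> diameter Y = r" if "Y \<in> X ` C" for Y
    using that X(2) assms(2) by fastforce
  have "covering_number A r \<le> card (X ` C)"
    by (rule covering_number_le[OF fin]) (use X(1) X' in auto)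
  also have "\<dots> \<le> card C" using assms(1) by (intro card_image_le) (simp add: cell_cover_def)
  finally show "covering_number A r \<le> card C" .
  show "\<exists>\<C>. finite \<C> \<and> card \<C> = covering_number A r \<and> A \<subseteq> \<Union>\<C> \<and> (\<forall>X\<in>\<C>. bounded X \<and> diameter X = r)"
    by (rule covering_number_attained[OF fin]) (use X(1) X' in auto)
qed

lemma card_cell_cover_1:
  assumes "cell_cover 1 k A C"
  shows "real (card C) = cover_cost s C * 2 powr (real k * s)"
proof -
  have "cover_cost s C = (\<Sum>c\<in>C. 2 powr - (real k * s))"
    unfolding cover_cost_def using assms by (intro sum.cong refl) (auto simp: cell_cover_def top_level_1)
  then show ?thesis by (simp add: powr_minus)
qed

lemma bounded_content_imp_Limsup:
  fixes A :: "(real^'n::finite) set"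
  assumes bc: "bounded_content 1 A s" and "0 < s"
  shows "Limsup (at_right 0) (\<lambda>r. ereal (ln (real (covering_number A r)) / (- ln r))) \<le> ereal s"
proof (rule ccontr)
  let ?f = "\<lambda>r. ereal (ln (real (covering_number A r)) / (- ln r))"
  assume "\<not> ?thesis"
  \<comment> \<open>The gap between \<open>s\<close> and \<sigma> absorbs the constant
    \<open>ln B'\<close>, which is outgrown by a multiple of \<open>- ln r\<close>.\<close>
  then obtain \<sigma> where \<sigma>: "ereal s < ereal \<sigma>" "ereal \<sigma> < Limsup (at_right 0) ?f"
    using ereal_dense2[of "ereal s"] by (auto simp: not_le)
  define N where "N = sqrt (real CARD('n))"
  have N: "0 < N" "1 \<le> N" by (simp_all add: N_def)
  obtain B K where BK: "\<And>k. k \<ge> K \<Longrightarrow> \<exists>C. cell_cover 1 k A C \<and> cover_cost s C \<le> B"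
    using bc unfolding bounded_content_def by blast
  have B0: "0 \<le> B" using BK[of K] cover_cost_nonneg order_trans by blast
  define B' where "B' = (B + 1) * (2 * N) powr s"
  have B': "0 < B'" using B0 N by (simp add: B'_def)
  have "eventually (\<lambda>r. ln B' \<le> (\<sigma> - s) * (- ln r)) (at_right 0)"
    using \<sigma> by real_asymp
  moreover have "eventually (\<lambda>r::real. 0 < r \<and> r < min 1 (N * 2 powr - real K)) (at_right 0)"
    using N by (intro eventually_conj eventually_at_right_less eventually_at_right_real[of 0 "min 1 (N * 2 powr - real K)", THEN eventually_mono]) auto
  ultimately have "eventually (\<lambda>r. ?f r \<le> ereal \<sigma>) (at_right 0)"
  proof eventually_elim
    case (elim r)
    then have r: "0 < r" "r < 1" "r \<le> N * 2 powr - real K" by auto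
    obtain k where k: "k \<ge> K" "N * 2 powr - real k \<le> r" "r < 2 * N * 2 powr - real k"
      using dyadic_scale[of r N K] r N by auto
    obtain C where C: "cell_cover 1 k A C" "cover_cost s C \<le> B" using BK k by auto
    let ?c = "real (covering_number A r)"
    have lnr: "- ln r > 0" using r by simp
    have "?c \<le> real (card C)"
      using covering_number_le_card(1)[OF C(1), of r] r k by (simp add: N_def)
    also have "\<dots> = cover_cost s C * 2 powr (real k * s)" by (rule card_cell_cover_1[OF C(1)])
    also have "\<dots> \<le> (B + 1) * 2 powr (real k * s)" using C by (intro mult_right_mono) auto
    also have "2 powr (real k * s) = (2 powr real k) powr s" by (simp add: powr_powr)
    also have "\<dots> \<le> (2 * N / r) powr s"
      using k r \<open>0 < s\<close> by (intro powr_mono2) (auto simp: powr_minus field_simps)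
    also have "(B + 1) * (2 * N / r) powr s = B' * r powr - s"
      using r N by (simp add: B'_def powr_divide powr_minus field_simps)
    finally have le: "?c \<le> B' * r powr - s" using B0 by simp
    have "ln ?c \<le> \<sigma> * (- ln r)"
    proof (cases "?c = 0")
      \<comment> \<open>A covering number 0 occurs for the empty set; its logarithm is 0 by
        convention.\<close>
      case True
      have "0 \<le> \<sigma> * (- ln r)" using lnr \<sigma> \<open>0 < s\<close> by (intro mult_nonneg_nonneg) auto
      then show ?thesis using True by simp
    next
      case False
      then have "ln ?c \<le> ln (B' * r powr - s)" using le by (subst ln_le_cancel_iff) (use B' r in auto)
      also have "\<dots> = ln B' + s * (- ln r)" using B' r by (simp add: ln_mult ln_powr)
      also have "\<dots> \<le> \<sigma> * (- ln r)" using elim by (simp add: algebra_simps)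
      finally show ?thesis .
    qed
    then have "ln ?c / (- ln r) \<le> \<sigma>" using lnr by (subst pos_divide_le_eq) auto
    then show ?case by simp
  qed
  then have "Limsup (at_right 0) ?f \<le> ereal \<sigma>" by (rule Limsup_bounded)
  then show False using \<sigma> by simp
qed

lemma Limsup_imp_bounded_content:
  fixes A :: "(real^'n::finite) set"
  assumes "bounded A" "0 < s"
    and lim: "Limsup (at_right 0) (\<lambda>r. ereal (ln (real (covering_number A r)) / (- ln r))) < ereal s"
  shows "bounded_content 1 A s"
proof -
  have "eventually (\<lambda>r. ereal (ln (real (covering_number A r)) / (- ln r)) < ereal s) (at_right 0)"
    by (rule Limsup_lessD[OF lim])
  then obtain b where b: "b > 0" "\<And>r. 0 < r \<Longrightarrow> r < b \<Longrightarrow> ln (real (covering_number A r)) / (- ln r) < s"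
    unfolding eventually_at_right[OF zero_less_one] by auto
  have "(\<lambda>k. 2 powr - real k) \<longlonglongrightarrow> 0" by real_asymp
  then have "eventually (\<lambda>k. 2 powr - real k < b) sequentially"
    using b(1) by (rule order_tendstoD(2))
  then obtain K where K: "\<And>k. k \<ge> K \<Longrightarrow> 2 powr - real k < b" by (auto simp: eventually_sequentially)
  show ?thesis
    unfolding bounded_content_def
  proof (rule exI, rule exI, intro allI impI)
    \<comment> \<open>\<open>Suc K\<close> instead of \<open>K\<close> excludes k = 0, where
      \<open>ln r\<close> would vanish.\<close>
    fix k assume k: "k \<ge> Suc K"
    define r where "r = 2 powr - real k"
    have r: "0 < r" "r < 1" "r < b" using K[of k] k by (auto simp: r_def powr_less_one)
    have lnr: "- ln r = real k * ln 2" by (simp add: r_def ln_powr)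
    let ?N = "sqrt (real CARD('n))"
    have "r \<le> ?N * 2 powr - real 0"
    proof -
      have "1 \<le> ?N" by simp
      with r(2) have "r \<le> ?N" by linarith
      then show ?thesis by simp
    qed
    then obtain k' where k': "?N * 2 powr - real k' \<le> r" "r < 2 * ?N * 2 powr - real k'"
      using dyadic_scale[of r ?N 0] r by auto
    have "cell_cover 1 k' A (Pair k' ` cell k' ` A)"
      using finite_cell_image[OF assms(1)] by (auto simp: cell_cover_def top_level_1)
    from covering_number_le_card(2)[OF this, of r] k' r obtain \<C> where \<C>:
      "finite \<C>" "card \<C> = covering_number A r" "A \<subseteq> \<Union>\<C>" "\<And>X. X \<in> \<C> \<Longrightarrow> bounded X \<and> diameter X = r"
      by auto
    obtain h where h: "bij_betw h {0..<card \<C>} \<C>" using ex_bij_betw_nat_finite[OF \<C>(1)] by blast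
    have hC: "h i \<in> \<C>" if "i \<in> {0..<card \<C>}" for i using h that by (auto simp: bij_betw_def)
    have "A \<subseteq> (\<Union>i\<in>{0..<card \<C>}. h i)" using \<C>(3) h by (simp add: bij_betw_def)
    then have ic: "intermediate_cover 1 (2 powr - real k) A {0..<card \<C>} h"
      unfolding intermediate_cover_def r_def[symmetric] using \<C>(4) hC r by auto
    have le: "real (card \<C>) \<le> 2 powr (real k * s)"
    proof (cases "card \<C> = 0")
      case False
      have "ln (real (card \<C>)) / (real k * ln 2) < s" using b(2)[OF r(1,3)] by (simp add: \<C>(2) lnr)
      then have "ln (real (card \<C>)) \<le> s * (real k * ln 2)" using k by (simp add: divide_less_eq)
      also have "\<dots> = ln (2 powr (real k * s))" by (simp add: ln_powr)
      finally show ?thesis using False by (subst (asm) ln_le_cancel_iff) auto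
    qed simp
    obtain C where C: "cell_cover 1 k A C"
      "cover_cost s C \<le> 3 ^ CARD('n) * 2 powr s * (\<Sum>\<^sub>\<infinity>i\<in>{0..<card \<C>}. diameter (h i) powr s)"
      using cell_cover_of_cover[OF assms(1) _ _ assms(2) ic] by auto
    have "(\<Sum>\<^sub>\<infinity>i\<in>{0..<card \<C>}. diameter (h i) powr s) = (\<Sum>i\<in>{0..<card \<C>}. r powr s)"
      using \<C>(4) hC by simp
    also have "\<dots> = real (card \<C>) * 2 powr - (real k * s)" by (simp add: r_def powr_powr)
    also have "\<dots> \<le> 2 powr (real k * s) * 2 powr - (real k * s)" using le by (intro mult_right_mono) auto
    also have "\<dots> = 1" by (simp flip: powr_add)
    finally have "cover_cost s C \<le> 3 ^ CARD('n) * 2 powr s * 1"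
      by (intro order_trans[OF C(2)] mult_left_mono) auto
    then show "\<exists>C. cell_cover 1 k A C \<and> cover_cost s C \<le> 3 ^ CARD('n) * 2 powr s" using C(1) by auto
  qed
qed

lemma upper_box_dim_eq:
  fixes A :: "(real^'n::finite) set"
  assumes "bounded A"
  shows "upper_box_dim A = Inf {s. 0 < s \<and> bounded_content 1 A s}"
proof -
  let ?f = "\<lambda>r. ereal (ln (real (covering_number A r)) / (- ln r))"
  define b where "b = Limsup (at_right 0) ?f"
  have "eventually (\<lambda>r::real. 0 < r \<and> r < 1) (at_right 0)"
    using eventually_at_right_real[of 0 1] by (auto elim: eventually_mono)
  then have "eventually (\<lambda>r. 0 \<le> ?f r) (at_right 0)"
  proof eventually_elim
    case (elim r)
    have "0 \<le> ln (real (covering_number A r))" by (cases "covering_number A r = 0") auto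
    moreover have "- ln r > 0" using elim by simp
    ultimately show ?case by (simp only: ereal_less_eq zero_ereal_def divide_nonneg_pos)
  qed
  then have "0 \<le> Liminf (at_right 0) ?f" by (rule Liminf_bounded)
  also have "\<dots> \<le> b" unfolding b_def by (intro Liminf_le_Limsup) (simp add: trivial_limit_at_right_real)
  finally have b0: "0 \<le> b" .
  have up: "b \<le> ereal s" if "0 < s" "bounded_content 1 A s" for s
    unfolding b_def by (rule bounded_content_imp_Limsup) (use that in auto)
  \<comment> \<open>Finiteness of the upper limit, so that \<open>real_of_ereal\<close> does not
    return its default value.\<close>
  have "b \<le> ereal (real CARD('n))" by (rule up) (auto intro!: bounded_content_CARD assms)
  then have "\<bar>b\<bar> \<noteq> \<infinity>" using b0 by auto
  then obtain L where L: "b = ereal L" by auto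
  have "Inf {s. 0 < s \<and> bounded_content 1 A s} = L"
  proof (rule Inf_threshold)
    show "0 \<le> L" using b0 L by simp
    show "bounded_content 1 A s" if "0 < s" "L < s" for s
      by (rule Limsup_imp_bounded_content[OF assms that(1)]) (use that L b_def in auto)
    show "L \<le> s" if "0 < s" "bounded_content 1 A s" for s using up[OF that] L by simp
  qed
  then show ?thesis unfolding upper_box_dim_def b_def[symmetric] L by simp
qed

text \<open>The definition asks for arbitrarily small sums, \<open>bounded_content\<close> only for
  bounded ones. Smallness gives boundedness at the same exponent, and boundedness gives smallness at
  every larger exponent, so the infima agree.\<close>

theorem upper_intermediate_dim_eq:
  fixes A :: "(real^'n::finite) set"
  assumes "bounded A" "0 < \<theta>" "\<theta> \<le> 1"
  shows "upper_intermediate_dim \<theta> A = Inf {s. 0 < s \<and> bounded_content \<theta> A s}"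
proof (cases "\<theta> = 1")
  case True
  then show ?thesis using upper_box_dim_eq[OF assms(1)] by (simp add: upper_intermediate_dim_def)
next
  case False
  define Q where "Q s \<longleftrightarrow> (\<forall>\<epsilon>>0. \<exists>\<delta>\<^sub>0>0. \<forall>\<delta>. 0 < \<delta> \<and> \<delta> \<le> \<delta>\<^sub>0 \<longrightarrow>
               (\<exists>I C. intermediate_cover \<theta> \<delta> A I C \<and>
                  (\<lambda>i. diameter (C i) powr s) summable_on I \<and>
                  (\<Sum>\<^sub>\<infinity>i\<in>I. diameter (C i) powr s) < \<epsilon>))" for s
  have QI: "Q s'" if "0 < s" "s < s'" "bounded_content \<theta> A s" for s s'
    unfolding Q_def using bounded_content_imp_cheap_covers[OF assms(2,3) that(3,1,2)] by blast
  have QD: "bounded_content \<theta> A s" if s: "0 < s" "Q s" for s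
  proof -
    from s(2) obtain \<delta>\<^sub>0 where \<delta>\<^sub>0: "\<delta>\<^sub>0 > 0" "\<And>\<delta>. 0 < \<delta> \<Longrightarrow> \<delta> \<le> \<delta>\<^sub>0 \<Longrightarrow> 
        (\<exists>I C. intermediate_cover \<theta> \<delta> A I C \<and>
                  (\<lambda>i. diameter (C i) powr s) summable_on I \<and>
                  (\<Sum>\<^sub>\<infinity>i\<in>I. diameter (C i) powr s) < 1)"
      unfolding Q_def by (metis zero_less_one)
    have "(\<lambda>k. 2 powr - real k) \<longlonglongrightarrow> 0" by real_asymp
    then have "eventually (\<lambda>k. 2 powr - real k < \<delta>\<^sub>0) sequentially"
      using \<delta>\<^sub>0(1) by (rule order_tendstoD(2))
    then obtain K where K: "\<And>k. k \<ge> K \<Longrightarrow> 2 powr - real k < \<delta>\<^sub>0" by (auto simp: eventually_sequentially)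
    show ?thesis
      unfolding bounded_content_def
    proof (rule exI, rule exI, intro allI impI)
      fix k assume "k \<ge> K"
      then obtain I X where IX: "intermediate_cover \<theta> (2 powr - real k) A I X"
         "(\<lambda>i. diameter (X i) powr s) summable_on I" "(\<Sum>\<^sub>\<infinity>i\<in>I. diameter (X i) powr s) < 1"
        using \<delta>\<^sub>0(2)[of "2 powr - real k"] K[of k] by auto
      obtain C where C: "cell_cover \<theta> k A C"
        "cover_cost s C \<le> 3 ^ CARD('n) * 2 powr s * (\<Sum>\<^sub>\<infinity>i\<in>I. diameter (X i) powr s)"
        using cell_cover_of_cover[OF assms(1-3) s(1) IX(1,2)] by blast
      have "cover_cost s C \<le> 3 ^ CARD('n) * 2 powr s * 1"
        using IX(3) by (intro order_trans[OF C(2)] mult_left_mono) auto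
      then show "\<exists>C. cell_cover \<theta> k A C \<and> cover_cost s C \<le> 3 ^ CARD('n) * 2 powr s" using C(1) by auto
    qed
  qed
  define d where "d = Inf {s. 0 < s \<and> bounded_content \<theta> A s}"
  have ne: "bounded_content \<theta> A (real CARD('n))" by (rule bounded_content_CARD) (use assms in auto)
  then have d0: "0 \<le> d" unfolding d_def by (intro cInf_greatest) (auto intro!: exI[of _ "real CARD('n)"])
  have "Inf {s. 0 < s \<and> Q s} = d"
  proof (rule Inf_threshold[OF d0])
    show "d \<le> s" if "0 < s" "Q s" for s
      unfolding d_def using Inf_threshold_props(1)[OF that(1)] QD[OF that] by blast
    show "Q s" if "0 < s" "d < s" for s
    proof -
      have "\<exists>u\<in>{s. 0 < s \<and> bounded_content \<theta> A s}. u < s"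
        by (rule cInf_lessD) (use that ne in \<open>auto simp: d_def intro!: exI[of _ "real CARD('n)"]\<close>)
      then show ?thesis using QI by blast
    qed
  qed
  then show ?thesis using False by (simp add: upper_intermediate_dim_def Q_def d_def)
qed

section \<open>Random series of bumps\<close>

text \<open>A parabola centred at 1/2 and cut off at its zeros -1 and 2; squaring makes the
  derivative continuous there. On [0,1] the value is at least 1/2, so a bump is not small on its own
  cell.\<close>

definition bump1 :: "real \<Rightarrow> real" where
  "bump1 t = (max 0 (1 - ((2 * t - 1) / 3)\<^sup>2))\<^sup>2"

lemma bump1_bounds: "0 \<le> bump1 t" "bump1 t \<le> 1"
proof -
  have "max 0 (1 - ((2 * t - 1) / 3)\<^sup>2) \<le> 1" by simp
  then have "(max 0 (1 - ((2 * t - 1) / 3)\<^sup>2))\<^sup>2 \<le> 1\<^sup>2" by (intro power_mono) simp_all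
  then show "bump1 t \<le> 1" unfolding bump1_def by simp
qed (simp add: bump1_def)

lemma bump1_eq_0: "t \<le> -1 \<or> 2 \<le> t \<Longrightarrow> bump1 t = 0"
proof -
  assume "t \<le> -1 \<or> 2 \<le> t"
  then have "1 \<le> \<bar>(2 * t - 1) / 3\<bar>" by auto
  then have "1\<^sup>2 \<le> \<bar>(2 * t - 1) / 3\<bar>\<^sup>2" by (intro power_mono) auto
  then show ?thesis by (simp add: bump1_def del: abs_divide)
qed

lemma bump1_ge: "0 \<le> t \<Longrightarrow> t \<le> 1 \<Longrightarrow> 1 / 2 \<le> bump1 t"
proof -
  assume t: "0 \<le> t" "t \<le> 1"
  then have "\<bar>(2 * t - 1) / 3\<bar> \<le> 1 / 3" by (auto simp: abs_le_iff)
  then have "\<bar>(2 * t - 1) / 3\<bar>\<^sup>2 \<le> (1 / 3)\<^sup>2" by (intro power_mono) auto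
  moreover have "(1 / 3 :: real)\<^sup>2 = 1 / 9" by (simp add: power2_eq_square)
  ultimately have "((2 * t - 1) / 3)\<^sup>2 \<le> 1 / 9" unfolding power2_abs by simp
  then have h: "8 / 9 \<le> max 0 (1 - ((2 * t - 1) / 3)\<^sup>2)" unfolding le_max_iff_disj by linarith
  have "(8 / 9)\<^sup>2 \<le> bump1 t" unfolding bump1_def by (rule power_mono[OF h]) simp
  then show ?thesis by (simp add: power2_eq_square)
qed

definition bump1_deriv :: "real \<Rightarrow> real" where
  "bump1_deriv t = - (8 / 9) * max 0 (1 - ((2 * t - 1) / 3)\<^sup>2) * (2 * t - 1)"

lemma DERIV_pos_part_square: "((\<lambda>q. (max 0 q)\<^sup>2) has_real_derivative 2 * max 0 q) (at q)"
proof (cases q "0::real" rule: linorder_cases)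
  case equal
  have "((\<lambda>h. ((max 0 (0 + h))\<^sup>2 - (max 0 0)\<^sup>2) / h) \<longlongrightarrow> 0) (at (0::real))"
  proof (rule Lim_null_comparison)
    show "eventually (\<lambda>h. norm (((max 0 (0 + h))\<^sup>2 - (max 0 0)\<^sup>2) / h) \<le> \<bar>h\<bar>) (at (0::real))"
      by (intro always_eventually allI) (auto simp: max_def power2_eq_square)
    show "((\<lambda>h. \<bar>h\<bar>) \<longlongrightarrow> 0) (at (0::real))"
      using tendsto_rabs_zero[OF tendsto_ident_at] by simp
  qed
  then show ?thesis unfolding equal DERIV_def by simp
next
  case greater
  have "((\<lambda>q. q\<^sup>2) has_real_derivative 2 * max 0 q) (at q)"
    using greater by (auto intro!: derivative_eq_intros)
  moreover have "eventually (\<lambda>x. (max 0 x)\<^sup>2 = x\<^sup>2) (nhds q)"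
    using eventually_nhds_in_open[of "{0<..}" q] greater by (auto elim: eventually_mono)
  ultimately show ?thesis by (subst DERIV_cong_ev[OF refl _ refl]) auto
next
  case less
  have "((\<lambda>q. 0) has_real_derivative 2 * max 0 q) (at q)"
    using less by (auto intro!: derivative_eq_intros)
  moreover have "eventually (\<lambda>x. (max 0 x)\<^sup>2 = 0) (nhds q)"
    using eventually_nhds_in_open[of "{..<0}" q] less by (auto elim: eventually_mono)
  ultimately show ?thesis by (subst DERIV_cong_ev[OF refl _ refl]) auto
qed

lemma DERIV_bump1: "(bump1 has_real_derivative bump1_deriv t) (at t)"
proof -
  have "((\<lambda>t. 1 - ((2 * t - 1) / 3)\<^sup>2) has_real_derivative - (4 / 9) * (2 * t - 1)) (at t)"
    by (auto intro!: derivative_eq_intros simp: field_simps)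
  from DERIV_chain2[OF DERIV_pos_part_square this] show ?thesis
    unfolding bump1_def[abs_def] bump1_deriv_def by (rule DERIV_cong) simp
qed

lemma bump1_deriv_bound: "\<bar>bump1_deriv t\<bar> \<le> 3"
proof (cases "\<bar>2 * t - 1\<bar> \<le> 3")
  case True
  have "\<bar>bump1_deriv t\<bar> = 8 / 9 * max 0 (1 - ((2 * t - 1) / 3)\<^sup>2) * \<bar>2 * t - 1\<bar>"
    by (simp add: bump1_deriv_def abs_mult)
  also have "\<dots> \<le> 8 / 9 * 1 * 3" using True by (intro mult_mono) auto
  finally show ?thesis by simp
next
  case False
  then have "1 \<le> \<bar>(2 * t - 1) / 3\<bar>" by auto
  then have "1\<^sup>2 \<le> \<bar>(2 * t - 1) / 3\<bar>\<^sup>2" by (intro power_mono) auto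
  then show ?thesis by (simp add: bump1_deriv_def del: abs_divide)
qed

lemma bump1_deriv_eq_0: "t \<le> -1 \<or> 2 \<le> t \<Longrightarrow> bump1_deriv t = 0"
proof -
  assume "t \<le> -1 \<or> 2 \<le> t"
  then have "1 \<le> \<bar>(2 * t - 1) / 3\<bar>" by auto
  then have "1\<^sup>2 \<le> \<bar>(2 * t - 1) / 3\<bar>\<^sup>2" by (intro power_mono) auto
  then show ?thesis by (simp add: bump1_deriv_def del: abs_divide)
qed

lemma continuous_bump1: "continuous_on A bump1" "continuous_on A bump1_deriv"
  unfolding bump1_def[abs_def] bump1_deriv_def[abs_def] by (intro continuous_intros; simp)+

lemma bump1_Lipschitz: "\<bar>bump1 s - bump1 t\<bar> \<le> 3 * \<bar>s - t\<bar>"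
  using field_differentiable_bound[of UNIV bump1 bump1_deriv 3 s t] DERIV_bump1 bump1_deriv_bound by auto

definition bump :: "nat \<Rightarrow> int^'n \<Rightarrow> real^'n::finite \<Rightarrow> real" where
  "bump l z x = (\<Prod>j\<in>UNIV. bump1 (2 ^ l * x $ j - real_of_int (z $ j)))"

lemma bump_bounds: "0 \<le> bump l z x" "bump l z x \<le> 1"
  unfolding bump_def by (auto intro!: prod_nonneg prod_le_1 simp: bump1_bounds)

lemma bump_eq_0: "\<not> near 1 z (cell l x) \<Longrightarrow> bump l z x = 0"
proof -
  assume "\<not> near 1 z (cell l x)"
  then obtain j where "\<not> \<bar>z $ j - cell l x $ j\<bar> \<le> 1" by (auto simp: near_def)
  then have "z $ j + 2 \<le> cell l x $ j \<or> cell l x $ j + 2 \<le> z $ j" by linarith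
  then have "real_of_int (z $ j) + 2 \<le> real_of_int (cell l x $ j) \<or> real_of_int (cell l x $ j) + 2 \<le> real_of_int (z $ j)"
    by linarith
  then have "bump1 (2 ^ l * x $ j - real_of_int (z $ j)) = 0"
    using cell_bounds[of l x j] by (intro bump1_eq_0) linarith
  then show ?thesis unfolding bump_def by (auto intro!: prod_zero)
qed

lemma bump_cell_ge:
  fixes x :: "real^'n::finite"
  shows "(1 / 2) ^ CARD('n) \<le> bump l (cell l x) x"
proof -
  have "(\<Prod>j\<in>(UNIV::'n set). 1 / 2) \<le> bump l (cell l x) x"
    unfolding bump_def by (intro prod_mono conjI bump1_ge) (use cell_bounds[of l x] in \<open>auto simp: less_imp_le algebra_simps intro: less_imp_le\<close>)
  then show ?thesis by simp
qed

lemma bump_Lipschitz: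
  fixes x y :: "real^'n::finite"
  shows "\<bar>bump l z x - bump l z y\<bar> \<le> 3 * 2 ^ l * (\<Sum>j\<in>UNIV. \<bar>x $ j - y $ j\<bar>)"
proof -
  have "norm (bump l z x - bump l z y) \<le> (\<Sum>j\<in>UNIV. norm (bump1 (2 ^ l * x $ j - real_of_int (z $ j)) - bump1 (2 ^ l * y $ j - real_of_int (z $ j))))"
    unfolding bump_def by (intro norm_prod_diff) (simp_all add: bump1_bounds)
  also have "\<dots> \<le> (\<Sum>j\<in>UNIV. 3 * 2 ^ l * \<bar>x $ j - y $ j\<bar>)"
  proof (rule sum_mono)
    fix j
    show "norm (bump1 (2 ^ l * x $ j - real_of_int (z $ j)) - bump1 (2 ^ l * y $ j - real_of_int (z $ j))) \<le> 3 * 2 ^ l * \<bar>x $ j - y $ j\<bar>"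
      using bump1_Lipschitz[of "2 ^ l * x $ j - real_of_int (z $ j)" "2 ^ l * y $ j - real_of_int (z $ j)"]
      by (simp add: abs_mult flip: right_diff_distrib)
  qed
  finally show ?thesis by (simp add: sum_distrib_left)
qed

text \<open>\<open>beta\<close> is the square of \<open>gam\<close> for a reason: one factor
  \<open>gam l\<close> is spent as the weight in \<open>suminf_powr_le\<close>, and the p-th power
  of the other still makes the sum over the levels converge.\<close>

definition beta :: "nat \<Rightarrow> real" where "beta l = 1 / (real l + 1) ^ 4"
definition gam :: "nat \<Rightarrow> real" where "gam l = 1 / (real l + 1) ^ 2"

lemma gam_pos: "0 < gam l" "gam l \<le> 1" by (simp_all add: gam_def)
lemma beta_pos: "0 < beta l" "beta l \<le> 1" by (simp_all add: beta_def)
lemma beta_eq: "beta l = gam l * gam l" by (simp add: beta_def gam_def flip: power_add)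
lemma beta_le_gam: "beta l \<le> gam l" using gam_pos[of l] by (simp add: beta_eq mult_left_le)

lemma summable_gam: "summable gam"
proof -
  have "summable (\<lambda>l. 1 / real (Suc l) ^ 2)"
    using inverse_power_summable[of 2, where ?'a = real] by (subst summable_Suc_iff) (simp add: inverse_eq_divide)
  then show ?thesis by (simp add: gam_def[abs_def] add.commute)
qed

text \<open>A substitute for Hoelder's inequality across the levels: each \<open>a l\<close> is at
  most V powr (1 / p) times its weight, and the weights are summable.\<close>

lemma suminf_powr_le:
  fixes a c :: "nat \<Rightarrow> real"
  assumes p: "0 < p" and c: "\<And>l. 0 < c l" "summable c" and a: "\<And>l. 0 \<le> a l"
    and s: "summable (\<lambda>l. (a l / c l) powr p)"
  shows "summable a" and "suminf a powr p \<le> suminf c powr p * (\<Sum>l. (a l / c l) powr p)"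
proof -
  define V where "V = (\<Sum>l. (a l / c l) powr p)"
  have V0: "0 \<le> V" unfolding V_def by (intro suminf_nonneg s) auto
  have le: "a l \<le> V powr (1 / p) * c l" for l
  proof -
    have "(a l / c l) powr p \<le> V"
      unfolding V_def using sum_le_suminf[OF s, of "{l}"] by auto
    then have "((a l / c l) powr p) powr (1 / p) \<le> V powr (1 / p)"
      using p by (intro powr_mono2) auto
    then have "a l / c l \<le> V powr (1 / p)" using p a[of l] c(1)[of l] by (simp add: powr_powr)
    then show ?thesis using c(1)[of l] by (simp add: pos_divide_le_eq)
  qed
  show sa: "summable a"
    by (rule summable_comparison_test'[OF summable_mult[OF c(2), of "V powr (1 / p)"], of 0]) (use le a in auto)
  have "suminf a \<le> (\<Sum>l. V powr (1 / p) * c l)"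
    by (intro suminf_le le sa summable_mult c)
  also have "\<dots> = V powr (1 / p) * suminf c" by (rule suminf_mult[OF c(2)])
  finally have "suminf a powr p \<le> (V powr (1 / p) * suminf c) powr p"
    using p by (intro powr_mono2 suminf_nonneg sa a) auto
  also have "\<dots> = suminf c powr p * V"
    using p V0 c by (subst powr_mult) (auto simp: powr_powr less_imp_le intro!: suminf_nonneg)
  finally show "suminf a powr p \<le> suminf c powr p * (\<Sum>l. (a l / c l) powr p)" unfolding V_def .
qed

section \<open>The bump series and its uniform convergence\<close>

definition layer :: "(real^'n::finite) set \<Rightarrow> (nat \<Rightarrow> int^'n \<Rightarrow> real^'n) \<Rightarrow> nat \<Rightarrow> real^'n \<Rightarrow> real^'n" where
  "layer E a l x = (\<Sum>z\<in>cell l ` E. bump l z x *\<^sub>R a l z)"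

definition bump_series :: "(real^'n::finite) set \<Rightarrow> (nat \<Rightarrow> int^'n \<Rightarrow> real^'n) \<Rightarrow> real^'n \<Rightarrow> real^'n" where
  "bump_series E a x = (\<Sum>l. layer E a l x)"

text \<open>The gradient of a bump of level l is at most about 2^l on a cube of volume about
  2^{-ln}. The condition thus says that the gradient of layer l has an L^p norm of at most a
  constant times \<open>beta l\<close>.\<close>

definition admissible :: "(real^'n::finite) set \<Rightarrow> real \<Rightarrow> real \<Rightarrow> (nat \<Rightarrow> int^'n \<Rightarrow> real^'n) \<Rightarrow> bool" where
  "admissible E p M a \<longleftrightarrow> (\<forall>l. (\<Sum>z\<in>cell l ` E. norm (a l z) powr p)
      \<le> M * beta l powr p * 2 powr - (real l * (p - real CARD('n))))"

lemma card_near_bump: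
  "card {z::int^'n::finite. near 1 z (cell l x)} = 3 ^ CARD('n)" "finite {z::int^'n. near 1 z (cell l x)}"
  using card_near[of 1 "cell l x"] finite_near[of 1 "cell l x"] by (simp_all add: near_commute[of 1 "cell l x"])

lemma admissible_coeff:
  fixes a :: "nat \<Rightarrow> int^'n::finite \<Rightarrow> real^'n"
  assumes "bounded E" "real CARD('n) < p" "0 \<le> M" "admissible E p M a" "z \<in> cell l ` E"
  shows "norm (a l z) \<le> M powr (1 / p) * beta l * 2 powr - (real l * ((p - real CARD('n)) / p))"
proof -
  have p: "0 < p" using assms(2) by (smt (verit) of_nat_0_le_iff)
  have "norm (a l z) powr p \<le> (\<Sum>z\<in>cell l ` E. norm (a l z) powr p)"
    by (intro member_le_sum assms finite_cell_image) auto
  also have "\<dots> \<le> M * beta l powr p * 2 powr - (real l * (p - real CARD('n)))"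
    using assms by (auto simp: admissible_def)
  finally have "(norm (a l z) powr p) powr (1 / p) \<le> (M * beta l powr p * 2 powr - (real l * (p - real CARD('n)))) powr (1 / p)"
    using p by (intro powr_mono2) auto
  then show ?thesis using p assms(3) beta_pos(1)[of l]
    by (simp add: powr_powr powr_mult)
qed

lemma norm_layer_le:
  fixes a :: "nat \<Rightarrow> int^'n::finite \<Rightarrow> real^'n"
  assumes "bounded E" and b: "\<And>z. z \<in> cell l ` E \<Longrightarrow> near 1 z (cell l x) \<Longrightarrow> norm (a l z) \<le> b" and "0 \<le> b"
  shows "norm (layer E a l x) \<le> 3 ^ CARD('n) * b"
proof -
  have fin: "finite (cell l ` E)" by (rule finite_cell_image[OF assms(1)])
  have "layer E a l x = (\<Sum>z\<in>cell l ` E \<inter> {z. near 1 z (cell l x)}. bump l z x *\<^sub>R a l z)"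
    unfolding layer_def by (intro sum.mono_neutral_right fin) (auto simp: bump_eq_0)
  also have "norm \<dots> \<le> (\<Sum>z\<in>cell l ` E \<inter> {z. near 1 z (cell l x)}. b)"
  proof (rule sum_norm_le)
    fix z assume z: "z \<in> cell l ` E \<inter> {z. near 1 z (cell l x)}"
    have "norm (bump l z x *\<^sub>R a l z) \<le> 1 * b"
      unfolding norm_scaleR using z b by (intro mult_mono) (auto simp: bump_bounds)
    then show "norm (bump l z x *\<^sub>R a l z) \<le> b" by simp
  qed
  also have "\<dots> = real (card (cell l ` E \<inter> {z. near 1 z (cell l x)})) * b" by simp
  also have "\<dots> \<le> real (card {z. near 1 z (cell l x)}) * b"
    by (intro mult_right_mono of_nat_mono card_mono card_near_bump assms) auto
  finally show ?thesis by (simp add: card_near_bump)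
qed

lemma norm_layer_admissible:
  fixes a :: "nat \<Rightarrow> int^'n::finite \<Rightarrow> real^'n"
  assumes "bounded E" "real CARD('n) < p" "0 \<le> M" "admissible E p M a"
  shows "norm (layer E a l x) \<le> 3 ^ CARD('n) * M powr (1 / p) * gam l"
    and "norm (layer E a l x) \<le> 3 ^ CARD('n) * M powr (1 / p) * 2 powr - (real l * ((p - real CARD('n)) / p))"
proof -
  let ?b = "M powr (1 / p) * beta l * 2 powr - (real l * ((p - real CARD('n)) / p))"
  have p: "0 < p" using assms(2) by (smt (verit) of_nat_0_le_iff)
  have le: "norm (layer E a l x) \<le> 3 ^ CARD('n) * ?b"
    by (rule norm_layer_le) (use assms admissible_coeff[OF assms] beta_pos[of l] in auto)
  have "2 powr - (real l * ((p - real CARD('n)) / p)) \<le> 2 powr 0"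
    using assms p by (intro powr_mono) auto
  then have "?b \<le> M powr (1 / p) * gam l * 1"
    using beta_le_gam[of l] beta_pos[of l] gam_pos[of l] by (intro mult_mono) auto
  then have "3 ^ CARD('n) * ?b \<le> 3 ^ CARD('n) * (M powr (1 / p) * gam l * 1)" by (intro mult_left_mono) auto
  from order_trans[OF le this] show "norm (layer E a l x) \<le> 3 ^ CARD('n) * M powr (1 / p) * gam l"
    by (simp only: mult.assoc mult_1_right)
  have "?b \<le> M powr (1 / p) * 1 * 2 powr - (real l * ((p - real CARD('n)) / p))"
    using beta_pos[of l] by (intro mult_mono) auto
  then have "3 ^ CARD('n) * ?b \<le> 3 ^ CARD('n) * (M powr (1 / p) * 1 * 2 powr - (real l * ((p - real CARD('n)) / p)))" by (intro mult_left_mono) auto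
  from order_trans[OF le this] show "norm (layer E a l x) \<le> 3 ^ CARD('n) * M powr (1 / p) * 2 powr - (real l * ((p - real CARD('n)) / p))"
    by (simp only: mult.assoc mult_1_left)
qed

lemma summable_layer:
  fixes a :: "nat \<Rightarrow> int^'n::finite \<Rightarrow> real^'n"
  assumes "bounded E" "real CARD('n) < p" "0 \<le> M" "admissible E p M a"
  shows "summable (\<lambda>l. layer E a l x)"
  by (rule summable_comparison_test'[OF summable_mult[OF summable_gam, of "3 ^ CARD('n) * M powr (1 / p)"], of 0])
     (use norm_layer_admissible(1)[OF assms] in auto)

lemma continuous_bump: "continuous_on A (bump l z)"
  unfolding bump_def[abs_def]
  by (intro continuous_intros continuous_on_compose2[OF continuous_bump1(1)[of UNIV]]) auto

lemma continuous_layer: "continuous_on A (layer E a l)"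
  unfolding layer_def[abs_def] by (intro continuous_intros continuous_bump)

lemma uniform_limit_bump_series:
  fixes a :: "nat \<Rightarrow> int^'n::finite \<Rightarrow> real^'n"
  assumes "bounded E" "real CARD('n) < p" "0 \<le> M" "admissible E p M a"
  shows "uniform_limit UNIV (\<lambda>N x. \<Sum>l<N. layer E a l x) (bump_series E a) sequentially"
  unfolding bump_series_def[abs_def]
  by (rule Weierstrass_m_test[OF _ summable_mult[OF summable_gam, of "3 ^ CARD('n) * M powr (1 / p)"]])
     (use norm_layer_admissible(1)[OF assms] in auto)

lemma continuous_bump_series:
  fixes a :: "nat \<Rightarrow> int^'n::finite \<Rightarrow> real^'n"
  assumes "bounded E" "real CARD('n) < p" "0 \<le> M" "admissible E p M a"
  shows "continuous_on A (bump_series E a)"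
proof (rule continuous_on_subset)
  show "continuous_on UNIV (bump_series E a)"
    by (rule uniform_limit_theorem[OF _ uniform_limit_bump_series[OF assms]])
       (auto intro!: always_eventually continuous_intros continuous_layer)
qed simp

section \<open>Oscillation on dyadic cells\<close>

text \<open>The pairs for which the bump at \<open>z\<close> can act on the part of \<open>E\<close>
  inside \<open>Q\<close>, since \<open>bump l z\<close> vanishes where nearness fails.\<close>

definition touch :: "(real^'n) set \<Rightarrow> nat \<Rightarrow> nat \<Rightarrow> int^'n \<Rightarrow> int^'n \<Rightarrow> bool" where
  "touch E l k z Q \<longleftrightarrow> (\<exists>x\<in>E. cell k x = Q \<and> near 1 z (cell l x))"

text \<open>Truncated subtraction covers two regimes at once: a coarse bump meets about 2^{n(k-l)}
  cells of level k, while for a bump finer than the cells \<open>k - l\<close> is 0 and the bound is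
  3 ^ n.\<close>

lemma card_touch:
  fixes E :: "(real^'n::finite) set"
  assumes "bounded E"
  shows "real (card {Q\<in>cell k ` E. touch E l k z Q}) \<le> 3 ^ CARD('n) * 2 powr (real CARD('n) * real (k - l))"
proof (cases "l \<le> k")
  case True
  let ?W = "{w. near 1 z w}"
  have fin: "finite ?W" by (rule finite_near)
  have "{Q\<in>cell k ` E. touch E l k z Q} \<subseteq> (\<Union>w\<in>?W. cell k ` {x\<in>E. cell l x = w})"
  proof
    fix Q assume "Q \<in> {Q\<in>cell k ` E. touch E l k z Q}"
    then obtain x where x: "x \<in> E" "cell k x = Q" "near 1 z (cell l x)" by (auto simp: touch_def)
    then have "Q \<in> cell k ` {x'\<in>E. cell l x' = cell l x}" by blast
    then show "Q \<in> (\<Union>w\<in>?W. cell k ` {x\<in>E. cell l x = w})" using x(3) by blast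
  qed
  then have "card {Q\<in>cell k ` E. touch E l k z Q} \<le> card (\<Union>w\<in>?W. cell k ` {x\<in>E. cell l x = w})"
    by (intro card_mono finite_UN_I fin card_subcells(1)[OF True])
  also have "\<dots> \<le> (\<Sum>w\<in>?W. card (cell k ` {x\<in>E. cell l x = w}))" by (rule card_UN_le[OF fin])
  also have "\<dots> \<le> (\<Sum>w\<in>?W. (2 ^ (k - l)) ^ CARD('n))" by (intro sum_mono card_subcells(2)[OF True])
  also have "\<dots> = 3 ^ CARD('n) * (2 ^ (k - l)) ^ CARD('n)" by (simp add: card_near)
  finally have "real (card {Q\<in>cell k ` E. touch E l k z Q}) \<le> real (3 ^ CARD('n) * (2 ^ (k - l)) ^ CARD('n))"
    by (rule of_nat_mono)
  also have "\<dots> = 3 ^ CARD('n) * 2 powr (real (k - l) * real CARD('n))"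
    by (simp add: powr_powr[symmetric] powr_realpow)
  finally show ?thesis by (simp add: mult.commute)
next
  case False
  let ?W = "{w. near 1 z w}"
  \<comment> \<open>For a bump finer than the cells, the cell of level \<open>l\<close> determines
    the cell of level \<open>k\<close>, so there are at most as many of these as there are
    neighbours of \<open>z\<close>.\<close>
  define rep where "rep w = (SOME x. x \<in> E \<and> cell l x = w)" for w
  have rep: "cell l (rep (cell l x)) = cell l x" if "x \<in> E" for x
    unfolding rep_def by (rule someI2[of _ x]) (use that in auto)
  have "{Q\<in>cell k ` E. touch E l k z Q} \<subseteq> (\<lambda>w. cell k (rep w)) ` ?W"
  proof
    fix Q assume "Q \<in> {Q\<in>cell k ` E. touch E l k z Q}"
    then obtain x where x: "x \<in> E" "cell k x = Q" "near 1 z (cell l x)" by (auto simp: touch_def)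
    have "cell k (rep (cell l x)) = cell k x"
      by (rule cell_mono[of _ l]) (use False rep x in auto)
    then show "Q \<in> (\<lambda>w. cell k (rep w)) ` ?W" using x by auto
  qed
  then have "card {Q\<in>cell k ` E. touch E l k z Q} \<le> card ((\<lambda>w. cell k (rep w)) ` ?W)"
    by (intro card_mono finite_imageI finite_near)
  also have "\<dots> \<le> card ?W" by (intro card_image_le finite_near)
  also have "\<dots> = 3 ^ CARD('n)" by (simp add: card_near)
  finally have "real (card {Q\<in>cell k ` E. touch E l k z Q}) \<le> real (3 ^ CARD('n))" by (rule of_nat_mono)
  then show ?thesis using False by simp
qed

definition cell_norm :: "(real^'n::finite) set \<Rightarrow> real \<Rightarrow> (nat \<Rightarrow> int^'n \<Rightarrow> real^'n) \<Rightarrow> nat \<Rightarrow> nat \<Rightarrow> int^'n \<Rightarrow> real" where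
  "cell_norm E p a l k Q = (\<Sum>z\<in>{z\<in>cell l ` E. touch E l k z Q}. norm (a l z) powr p) powr (1 / p)"

lemma coeff_le_cell_norm:
  assumes "bounded E" "0 < p" "x \<in> E" "z \<in> cell l ` E" "near 1 z (cell l x)"
  shows "norm (a l z) \<le> cell_norm E p a l k (cell k x)"
proof -
  have "norm (a l z) powr p \<le> (\<Sum>z\<in>{z\<in>cell l ` E. touch E l k z (cell k x)}. norm (a l z) powr p)"
    by (rule member_le_sum) (use assms finite_cell_image[OF assms(1)] in \<open>auto simp: touch_def\<close>)
  then have "(norm (a l z) powr p) powr (1 / p) \<le> cell_norm E p a l k (cell k x)"
    unfolding cell_norm_def using assms by (intro powr_mono2) auto
  then show ?thesis using assms by (simp add: powr_powr)
qed

text \<open>A coarse layer has Lipschitz constant about 2^l on a cell of side 2^{-k}, which gives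
  2^{-(k-l)}. For a layer finer than the cell the supremum bound is used, and the truncated
  \<open>k - l\<close> makes that factor 1.\<close>

lemma layer_osc:
  fixes a :: "nat \<Rightarrow> int^'n::finite \<Rightarrow> real^'n"
  assumes "bounded E" "0 < p" "x \<in> E" "y \<in> E" "cell k x = cell k y"
  shows "norm (layer E a l x - layer E a l y)
    \<le> 6 * real CARD('n) * 3 ^ CARD('n) * 2 powr - real (k - l) * cell_norm E p a l k (cell k x)"
proof (cases "l \<le> k")
  case True
  let ?T = "cell_norm E p a l k (cell k x)"
  have T0: "0 \<le> ?T" by (simp add: cell_norm_def)
  have cl: "cell l x = cell l y" by (rule cell_mono[OF True assms(5)])
  have fin: "finite (cell l ` E)" by (rule finite_cell_image[OF assms(1)])
  let ?Z = "cell l ` E \<inter> {z. near 1 z (cell l x)}"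
  have "layer E a l x - layer E a l y = (\<Sum>z\<in>cell l ` E. (bump l z x - bump l z y) *\<^sub>R a l z)"
    by (simp add: layer_def sum_subtractf scaleR_diff_left)
  also have "\<dots> = (\<Sum>z\<in>?Z. (bump l z x - bump l z y) *\<^sub>R a l z)"
    by (intro sum.mono_neutral_right fin) (auto simp: bump_eq_0 cl)
  also have "norm \<dots> \<le> (\<Sum>z\<in>?Z. 3 * 2 ^ l * (real CARD('n) * 2 powr - real k) * ?T)"
  proof (rule sum_norm_le)
    fix z assume z: "z \<in> ?Z"
    have "(\<Sum>j\<in>UNIV. \<bar>x $ j - y $ j\<bar>) \<le> (\<Sum>j\<in>(UNIV::'n set). 2 powr - real k)"
      by (intro sum_mono cell_eq_dist assms)
    then have "\<bar>bump l z x - bump l z y\<bar> \<le> 3 * 2 ^ l * (real CARD('n) * 2 powr - real k)"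
      by (intro order_trans[OF bump_Lipschitz] mult_left_mono) auto
    then show "norm ((bump l z x - bump l z y) *\<^sub>R a l z) \<le> 3 * 2 ^ l * (real CARD('n) * 2 powr - real k) * ?T"
      unfolding norm_scaleR using z assms by (intro mult_mono coeff_le_cell_norm) auto
  qed
  also have "\<dots> = real (card ?Z) * (3 * 2 ^ l * (real CARD('n) * 2 powr - real k) * ?T)" by simp
  also have "\<dots> \<le> real (card {z::int^'n. near 1 z (cell l x)}) * (3 * 2 ^ l * (real CARD('n) * 2 powr - real k) * ?T)"
    by (intro mult_right_mono of_nat_mono card_mono card_near_bump mult_nonneg_nonneg T0) auto
  also have "\<dots> = 3 * real CARD('n) * 3 ^ CARD('n) * (2 ^ l * 2 powr - real k) * ?T"
    by (simp add: card_near_bump)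
  also have "2 ^ l * 2 powr - real k = 2 powr - real (k - l)"
    using True by (simp add: powr_realpow[symmetric] of_nat_diff flip: powr_add)
  also have "3 * real CARD('n) * 3 ^ CARD('n) * 2 powr - real (k - l) * ?T \<le> 6 * real CARD('n) * 3 ^ CARD('n) * 2 powr - real (k - l) * ?T"
    using T0 by (intro mult_right_mono) auto
  finally show ?thesis .
next
  case False
  let ?T = "cell_norm E p a l k (cell k x)"
  have T0: "0 \<le> ?T" by (simp add: cell_norm_def)
  have "norm (layer E a l x) \<le> 3 ^ CARD('n) * ?T"
    using assms T0 by (intro norm_layer_le coeff_le_cell_norm) auto
  moreover have "norm (layer E a l y) \<le> 3 ^ CARD('n) * ?T"
    unfolding assms(5) using assms by (intro norm_layer_le coeff_le_cell_norm) (auto simp: cell_norm_def)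
  ultimately have "norm (layer E a l x - layer E a l y) \<le> 2 * (3 ^ CARD('n) * ?T)"
    using norm_triangle_ineq4[of "layer E a l x" "layer E a l y"] by linarith
  also have "\<dots> \<le> 6 * real CARD('n) * (3 ^ CARD('n) * ?T)"
  proof (rule mult_right_mono)
    have "1 \<le> real CARD('n)" by simp
    then show "2 \<le> 6 * real CARD('n)" by linarith
  qed (use T0 in auto)
  finally show ?thesis using False by simp
qed

text \<open>Double counting of pairs of bumps and cells. For l \<le> k the exponents add up to
  n(k-l) - p(k-l) - l(p-n) = -k(p-n), so every layer obeys the same bound up to its factor in
  \<open>beta l\<close>.\<close>

lemma sum_cell_norm:
  fixes a :: "nat \<Rightarrow> int^'n::finite \<Rightarrow> real^'n"
  assumes "bounded E" "real CARD('n) < p" "0 \<le> M" "admissible E p M a"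
  shows "(\<Sum>Q\<in>cell k ` E. (2 powr - real (k - l) * cell_norm E p a l k Q) powr p)
     \<le> 3 ^ CARD('n) * M * beta l powr p * 2 powr - (real k * (p - real CARD('n)))"
proof -
  have p: "0 < p" using assms(2) by (smt (verit) of_nat_0_le_iff)
  have fin: "finite (cell l ` E)" for l by (rule finite_cell_image[OF assms(1)])
  let ?n = "real CARD('n)"
  have "(\<Sum>Q\<in>cell k ` E. (2 powr - real (k - l) * cell_norm E p a l k Q) powr p)
     = (\<Sum>Q\<in>cell k ` E. \<Sum>z\<in>{z\<in>cell l ` E. touch E l k z Q}. 2 powr - (real (k - l) * p) * norm (a l z) powr p)"
    using p by (intro sum.cong refl) (simp add: cell_norm_def powr_mult powr_powr sum_nonneg flip: sum_distrib_left)
  also have "\<dots> = (\<Sum>z\<in>cell l ` E. \<Sum>Q\<in>{Q\<in>cell k ` E. touch E l k z Q}. 2 powr - (real (k - l) * p) * norm (a l z) powr p)"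
    by (rule sum.swap_restrict[OF fin fin])
  also have "\<dots> = (\<Sum>z\<in>cell l ` E. real (card {Q\<in>cell k ` E. touch E l k z Q}) * (2 powr - (real (k - l) * p) * norm (a l z) powr p))"
    by simp
  also have "\<dots> \<le> (\<Sum>z\<in>cell l ` E. (3 ^ CARD('n) * 2 powr (?n * real (k - l))) * (2 powr - (real (k - l) * p) * norm (a l z) powr p))"
    by (intro sum_mono mult_right_mono card_touch assms) auto
  also have "\<dots> = 3 ^ CARD('n) * (2 powr (?n * real (k - l)) * 2 powr - (real (k - l) * p)) * (\<Sum>z\<in>cell l ` E. norm (a l z) powr p)"
    unfolding sum_distrib_left by (intro sum.cong refl) (simp add: mult_ac)
  also have "2 powr (?n * real (k - l)) * 2 powr - (real (k - l) * p) = 2 powr - (real (k - l) * (p - ?n))"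
    by (simp add: algebra_simps flip: powr_add)
  also have "3 ^ CARD('n) * 2 powr - (real (k - l) * (p - ?n)) * (\<Sum>z\<in>cell l ` E. norm (a l z) powr p)
     \<le> 3 ^ CARD('n) * 2 powr - (real (k - l) * (p - ?n)) * (M * beta l powr p * 2 powr - (real l * (p - ?n)))"
    using assms(4) by (intro mult_left_mono) (auto simp: admissible_def)
  also have "\<dots> = 3 ^ CARD('n) * M * beta l powr p * 2 powr - ((real (k - l) + real l) * (p - ?n))"
    by (simp add: powr_add[symmetric] algebra_simps)
  \<comment> \<open>By truncation, (k - l) + l is the maximum of \<open>k\<close> and
    \<open>l\<close>, hence at least \<open>k\<close>.\<close>
  also have "\<dots> \<le> 3 ^ CARD('n) * M * beta l powr p * 2 powr - (real k * (p - ?n))"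
    using assms(2,3) by (intro mult_left_mono powr_mono) (auto intro!: mult_right_mono)
  finally show ?thesis .
qed

text \<open>The layers are added with weights \<open>gam\<close>. Of the two factors in
  \<open>beta l\<close>, one cancels the division by \<open>gam l\<close> and the other makes the
  sum over \<open>l\<close> converge.\<close>

lemma bump_series_osc:
  fixes a :: "nat \<Rightarrow> int^'n::finite \<Rightarrow> real^'n"
  assumes "bounded E" "real CARD('n) < p" "0 \<le> M" "admissible E p M a"
  shows "\<exists>D V. (\<forall>k Q. 0 \<le> D k Q) \<and> 0 \<le> V \<and>
     (\<forall>k x y j. x \<in> E \<longrightarrow> y \<in> E \<longrightarrow> cell k x = cell k y \<longrightarrow>
        \<bar>bump_series E a x $ j - bump_series E a y $ j\<bar> \<le> D k (cell k x)) \<and>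
     (\<forall>k. (\<Sum>Q\<in>cell k ` E. D k Q powr p) \<le> V * 2 powr - (real k * (p - real CARD('n))))"
proof -
  have p: "0 < p" using assms(2) by (smt (verit) of_nat_0_le_iff)
  have p1: "1 \<le> p"
  proof -
    have "1 \<le> real CARD('n)" by simp
    then show ?thesis using assms(2) by linarith
  qed
  define c0 where "c0 = 6 * real CARD('n) * 3 ^ CARD('n)"
  have c0: "0 < c0" by (simp add: c0_def)
  define t where "t l k Q = 2 powr - real (k - l) * cell_norm E p a l k Q" for l k Q
  have t0: "0 \<le> t l k Q" for l k Q by (simp add: t_def cell_norm_def)
  define u where "u l k Q = (t l k Q / gam l) powr p" for l k Q
  \<comment> \<open>The value 0 is prescribed off the cells of \<open>E\<close>, because summability
    over the levels is shown only for those cells.\<close>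
  define D where "D k Q = (if Q \<in> cell k ` E then c0 * (\<Sum>l. t l k Q) else 0)" for k Q
  define W where "W k = 3 ^ CARD('n) * M * 2 powr - (real k * (p - real CARD('n)))" for k
  have W0: "0 \<le> W k" for k using assms(3) by (simp add: W_def)
  have fin: "finite (cell k ` E)" for k by (rule finite_cell_image[OF assms(1)])
  have usum: "(\<Sum>Q\<in>cell k ` E. u l k Q) \<le> W k * gam l" for l k
  proof -
    have "(\<Sum>Q\<in>cell k ` E. u l k Q) = (\<Sum>Q\<in>cell k ` E. t l k Q powr p) / gam l powr p"
      using gam_pos[of l] t0 by (simp add: u_def powr_divide sum_divide_distrib less_imp_le)
    also have "\<dots> \<le> (3 ^ CARD('n) * M * beta l powr p * 2 powr - (real k * (p - real CARD('n)))) / gam l powr p"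
      unfolding t_def by (intro divide_right_mono sum_cell_norm assms) auto
    also have "\<dots> = W k * gam l powr p"
      using gam_pos[of l] by (simp add: W_def beta_eq powr_mult)
    also have "\<dots> \<le> W k * gam l"
      using gam_pos[of l] p1 W0 by (intro mult_left_mono) (use powr_mono'[of 1 p "gam l"] in auto)
    finally show ?thesis .
  qed
  have u0: "0 \<le> u l k Q" for l k Q by (simp add: u_def)
  have u_le: "u l k Q \<le> W k * gam l" if "Q \<in> cell k ` E" for l k Q
    using member_le_sum[of Q "cell k ` E" "u l k"] usum[where l=l and k=k] that u0 fin by force
  have su: "summable (\<lambda>l. u l k Q)" if "Q \<in> cell k ` E" for k Q
    by (rule summable_comparison_test'[OF summable_mult[OF summable_gam, of "W k"], of 0]) (use u_le[OF that] u0 in auto)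
  have st: "summable (\<lambda>l. t l k Q)" and ut: "(\<Sum>l. t l k Q) powr p \<le> suminf gam powr p * (\<Sum>l. u l k Q)" if "Q \<in> cell k ` E" for k Q
    using suminf_powr_le[of p gam "\<lambda>l. t l k Q"] su[OF that] p gam_pos summable_gam t0 by (auto simp: u_def)
  define V where "V = c0 powr p * (suminf gam powr p * (3 ^ CARD('n) * M * suminf gam))"
  have sg0: "0 \<le> suminf gam" by (intro suminf_nonneg summable_gam) (simp add: gam_pos less_imp_le)
  show ?thesis
  proof (intro exI[of _ D] exI[of _ V] conjI allI impI)
    show "0 \<le> D k Q" for k Q
      using c0 t0 by (auto simp: D_def intro!: mult_nonneg_nonneg suminf_nonneg st)
    show "0 \<le> V" using assms(3) sg0 by (simp add: V_def)
    fix k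
    show "\<bar>bump_series E a x $ j - bump_series E a y $ j\<bar> \<le> D k (cell k x)"
      if xy: "x \<in> E" "y \<in> E" "cell k x = cell k y" for x y j
    proof -
      have Q: "cell k x \<in> cell k ` E" using xy by simp
      note sl = summable_layer[OF assms]
      have le: "norm (layer E a l x - layer E a l y) \<le> c0 * t l k (cell k x)" for l
        using layer_osc[OF assms(1) p xy, of a l] by (simp add: c0_def t_def mult_ac)
      have "bump_series E a x - bump_series E a y = (\<Sum>l. layer E a l x - layer E a l y)"
        unfolding bump_series_def by (rule suminf_diff[OF sl sl])
      also have "norm \<dots> \<le> (\<Sum>l. c0 * t l k (cell k x))"
        by (rule norm_suminf_le[OF le summable_mult[OF st[OF Q]]])
      also have "\<dots> = D k (cell k x)" using Q by (simp add: D_def suminf_mult[OF st[OF Q]])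
      finally show ?thesis
        using component_le_norm_cart[of "bump_series E a x - bump_series E a y" j] by simp
    qed
    have "(\<Sum>Q\<in>cell k ` E. D k Q powr p) \<le> (\<Sum>Q\<in>cell k ` E. c0 powr p * (suminf gam powr p * (\<Sum>l. u l k Q)))"
    proof (rule sum_mono)
      fix Q assume Q: "Q \<in> cell k ` E"
      have "D k Q powr p = c0 powr p * (\<Sum>l. t l k Q) powr p"
        using Q c0 t0 st by (simp add: D_def powr_mult suminf_nonneg less_imp_le)
      also have "\<dots> \<le> c0 powr p * (suminf gam powr p * (\<Sum>l. u l k Q))"
        by (intro mult_left_mono ut Q) auto
      finally show "D k Q powr p \<le> c0 powr p * (suminf gam powr p * (\<Sum>l. u l k Q))" .
    qed
    also have "\<dots> = c0 powr p * (suminf gam powr p * (\<Sum>Q\<in>cell k ` E. \<Sum>l. u l k Q))"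
      by (simp add: sum_distrib_left)
    also have "(\<Sum>Q\<in>cell k ` E. \<Sum>l. u l k Q) = (\<Sum>l. \<Sum>Q\<in>cell k ` E. u l k Q)"
      by (rule suminf_sum[symmetric]) (rule su)
    also have "(\<Sum>l. \<Sum>Q\<in>cell k ` E. u l k Q) \<le> (\<Sum>l. W k * gam l)"
      by (intro suminf_le usum summable_sum su summable_mult summable_gam)
    also have "\<dots> = W k * suminf gam" by (rule suminf_mult[OF summable_gam])
    also have "c0 powr p * (suminf gam powr p * (W k * suminf gam)) = V * 2 powr - (real k * (p - real CARD('n)))"
      by (simp add: V_def W_def)
    finally show "(\<Sum>Q\<in>cell k ` E. D k Q powr p) \<le> V * 2 powr - (real k * (p - real CARD('n)))"
      by (simp add: mult_left_mono)
  qed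
qed

section \<open>The upper bound for the image\<close>

lemma card_image_cells:
  fixes f :: "'a \<Rightarrow> real^'n::finite"
  assumes "\<And>x y j. x \<in> S \<Longrightarrow> y \<in> S \<Longrightarrow> \<bar>f x $ j - f y $ j\<bar> \<le> 2 powr - real i"
  shows "finite (cell i ` f ` S)" "card (cell i ` f ` S) \<le> 3 ^ CARD('n)"
proof -
  have "finite (cell i ` f ` S) \<and> card (cell i ` f ` S) \<le> 3 ^ CARD('n)"
  proof (cases "S = {}")
    case False
    then obtain x0 where x0: "x0 \<in> S" by blast
    have sub: "cell i ` f ` S \<subseteq> {w. near 1 (cell i (f x0)) w}"
      using assms[OF x0] by (auto intro!: dist_imp_near_cell)
    show ?thesis
      using card_mono[OF finite_near sub] finite_subset[OF sub finite_near] by (simp add: card_near)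
  qed simp
  then show "finite (cell i ` f ` S)" "card (cell i ` f ` S) \<le> 3 ^ CARD('n)" by auto
qed

text \<open>Young's inequality as a case distinction at D^p = 2^{-l(p-n+s)}, where the two terms on
  the right coincide. Over the cells of one level the first terms sum to at most \<open>V\<close> by
  the oscillation bound; the second is the cost of the cell itself.\<close>

lemma young_split:
  fixes p n s D :: real
  assumes "0 < s" "n < p" "0 \<le> D" "0 < n"
  shows "D powr (p * s / (p - n + s)) \<le> D powr p * 2 powr (real l * (p - n)) + 2 powr - (real l * s)"
proof -
  define u where "u = s / (p - n + s)"
  define e where "e = s + p - n"
  have e: "e > 0" using assms by (simp add: e_def)
  have u: "0 < u" "u < 1" using assms by (auto simp: u_def field_simps)
  have eu: "e * u = s" "e * (1 - u) = p - n" using e by (auto simp: u_def e_def field_simps)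
  have eq: "D powr (p * s / (p - n + s)) = (D powr p) powr u" by (simp add: powr_powr u_def)
  show ?thesis
  proof (cases "D powr p \<le> 2 powr - (real l * e)")
    case True
    then have "(D powr p) powr u \<le> (2 powr - (real l * e)) powr u" using u by (intro powr_mono2) auto
    also have "\<dots> = 2 powr - (real l * s)" by (simp add: powr_powr mult.assoc eu)
    finally show ?thesis unfolding eq by (simp add: add_increasing)
  next
    case False
    define X where "X = D powr p"
    have X: "2 powr - (real l * e) < X" using False by (simp add: X_def)
    then have X0: "0 < X" by (smt (verit) powr_gt_zero)
    have "X powr u = X * X powr (- (1 - u))" using X0 powr_add[of X 1 "- (1 - u)"] by simp
    also have "X powr (- (1 - u)) \<le> (2 powr - (real l * e)) powr (- (1 - u))"
      using X u by (intro powr_mono2') auto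
    also have "\<dots> = 2 powr (real l * (e * (1 - u)))" by (simp add: powr_powr algebra_simps)
    finally have "X powr u \<le> X * 2 powr (real l * (p - n))" using X0 by (simp add: eu)
    then show ?thesis unfolding eq X_def[symmetric] by (simp add: add_increasing2)
  qed
qed

lemma geometric_powr_sum:
  fixes c :: real
  assumes "0 < c"
  shows "(\<Sum>j\<in>{k..<J}. 2 powr - (real j * c)) \<le> 2 powr - (real k * c) / (1 - 2 powr - c)"
proof -
  define r where "r = 2 powr - c"
  have "2 powr - c < 2 powr 0" using assms by (intro powr_less_mono) auto
  then have r: "0 < r" "r < 1" by (simp_all add: r_def)
  have pw: "2 powr - (real j * c) = r ^ j" for j
    using r(1) by (simp add: r_def powr_realpow[symmetric] powr_powr mult.commute)
  have "(\<Sum>j\<in>{k..<J}. r ^ j) * (1 - r) \<le> r ^ k"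
  proof (cases "k \<le> J")
    case True
    have "(\<Sum>j\<in>{k..<J}. r ^ j) * (1 - r) = r ^ k - r ^ J"
      using True
    proof (induction J rule: dec_induct)
      case (step m)
      have "(\<Sum>j\<in>{k..<Suc m}. r ^ j) * (1 - r) = (\<Sum>j\<in>{k..<m}. r ^ j) * (1 - r) + r ^ m * (1 - r)"
        using step.hyps by (simp add: distrib_right)
      also have "\<dots> = r ^ k - r ^ Suc m" unfolding step.IH by (simp add: algebra_simps)
      finally show ?case .
    qed simp
    then show ?thesis using r by simp
  qed (use r in auto)
  then have "(\<Sum>j\<in>{k..<J}. r ^ j) \<le> r ^ k / (1 - r)" using r by (simp add: pos_le_divide_eq)
  then show ?thesis by (simp only: pw r_def)
qed

text \<open>The scale for covering an image of size \<open>D\<close>: its own dyadic size, or the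
  finest allowed level if \<open>D\<close> is smaller still. The first term of the bound pays for
  the latter case.\<close>

lemma split_level:
  fixes D :: real
  assumes "0 \<le> D" "D \<le> 2 powr - real m" "m \<le> M" "0 < t"
  shows "\<exists>i. m \<le> i \<and> i \<le> M \<and> D \<le> 2 powr - real i \<and> 2 powr - (real i * t) \<le> 2 powr - (real M * t) + (2 * D) powr t"
proof (cases "D \<le> 2 powr - real M")
  case True
  then show ?thesis using assms by (intro exI[of _ M]) auto
next
  case False
  then have D: "2 powr - real M < D" by simp
  then have "D > 0" by (smt (verit) powr_gt_zero)
  define L where "L = - log 2 D"
  have dL: "D = 2 powr - L" using \<open>D > 0\<close> by (simp add: L_def)
  have L: "real m \<le> L" "L < real M" using assms(2) D unfolding dL by simp_all
  define i where "i = nat \<lfloor>L\<rfloor>"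
  have i: "real i \<le> L" "L < real i + 1" using L(1) unfolding i_def by linarith+
  have "2 powr - (real i * t) = (2 powr - real i) powr t" by (simp add: powr_powr)
  also have "\<dots> \<le> (2 * D) powr t"
  proof (rule powr_mono2)
    have "2 powr - real i \<le> 2 powr (1 - L)" using i by simp
    then show "2 powr - real i \<le> 2 * D" by (simp add: dL powr_diff powr_minus field_simps)
  qed (use assms in auto)
  finally have "2 powr - (real i * t) \<le> 2 powr - (real M * t) + (2 * D) powr t" by (simp add: add_increasing)
  moreover have "D \<le> 2 powr - real i" unfolding dL using i by simp
  ultimately show ?thesis using i L by (intro exI[of _ i]) linarith
qed

text \<open>Chebyshev's inequality for the oscillations on one level.\<close>

lemma card_large_osc:
  assumes "finite Z" "0 < p" and D: "\<And>Q. Q \<in> Z \<Longrightarrow> 0 \<le> D Q" and S: "(\<Sum>Q\<in>Z. D Q powr p) \<le> W"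
  shows "real (card {Q\<in>Z. 2 powr - real m < D Q}) \<le> W * 2 powr (real m * p)"
proof -
  have "real (card {Q\<in>Z. 2 powr - real m < D Q}) * 2 powr - (real m * p) = (\<Sum>Q\<in>{Q\<in>Z. 2 powr - real m < D Q}. (2 powr - real m) powr p)"
    by (simp add: powr_powr)
  also have "\<dots> \<le> (\<Sum>Q\<in>{Q\<in>Z. 2 powr - real m < D Q}. D Q powr p)"
    using assms by (intro sum_mono powr_mono2) auto
  also have "\<dots> \<le> (\<Sum>Q\<in>Z. D Q powr p)" using assms by (intro sum_mono2) auto
  finally have "real (card {Q\<in>Z. 2 powr - real m < D Q}) * 2 powr - (real m * p) \<le> W" using S by linarith
  then show ?thesis by (simp add: powr_minus field_simps)
qed

text \<open>A point is followed down to the last level at which the oscillation of its cell exceeds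
  2 powr - m; the image of the next cell fits into 3 ^ n cells. The number of bad cells of level j
  is at most a multiple of 2^{-j(p-n)}, so p > n makes the sum over j \<ge> k converge. The constant
  6 ^ n counts 2 ^ n children times 3 ^ n image cells.\<close>

lemma card_refined_cells:
  fixes E :: "(real^'n::finite) set" and f :: "real^'n \<Rightarrow> real^'n"
  assumes "bounded E" "real CARD('n) < p"
    and D0: "\<And>k Q. 0 \<le> D k Q" and V0: "0 \<le> V"
    and osc: "\<And>k x y j. x \<in> E \<Longrightarrow> y \<in> E \<Longrightarrow> cell k x = cell k y \<Longrightarrow> \<bar>f x $ j - f y $ j\<bar> \<le> D k (cell k x)"
    and sumD: "\<And>k. (\<Sum>Q\<in>cell k ` E. D k Q powr p) \<le> V * 2 powr - (real k * (p - real CARD('n)))"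
    and E': "E' \<subseteq> E" "\<And>x. x \<in> E' \<Longrightarrow> \<exists>l\<ge>k. 2 powr - real m < D l (cell l x)"
  shows "finite (cell m ` f ` E')"
    and "real (card (cell m ` f ` E')) \<le> 6 ^ CARD('n) * V * 2 powr (real m * p) *
           (2 powr - (real k * (p - real CARD('n))) / (1 - 2 powr - (p - real CARD('n))))"
proof -
  let ?n = "real CARD('n)" and ?N = "CARD('n)"
  have p: "0 < p" using assms(2) by (smt (verit) of_nat_0_le_iff)
  have fin: "finite (cell l ` E)" for l by (rule finite_cell_image[OF assms(1)])
  define B where "B j = {Q\<in>cell j ` E. 2 powr - real m < D j Q}" for j
  have cardB: "real (card (B j)) \<le> V * 2 powr - (real j * (p - ?n)) * 2 powr (real m * p)" for j
    unfolding B_def by (rule card_large_osc[OF fin p D0 sumD])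
  \<comment> \<open>From some level on the bound for the number of bad cells is below 1. There are
    none left, so a last bad level exists.\<close>
  have "(\<lambda>j. V * 2 powr (real m * p) * 2 powr - (real j * (p - ?n))) \<longlonglongrightarrow> V * 2 powr (real m * p) * 0"
    by (intro tendsto_mult_left powr_decay) (use assms in simp)
  then have "eventually (\<lambda>j. V * 2 powr (real m * p) * 2 powr - (real j * (p - ?n)) < 1) sequentially"
    by (rule order_tendstoD) simp
  then obtain J where J: "\<And>j. j \<ge> J \<Longrightarrow> V * 2 powr (real m * p) * 2 powr - (real j * (p - ?n)) < 1"
    by (auto simp: eventually_sequentially)
  have smallJ: "D j (cell j x) \<le> 2 powr - real m" if "j \<ge> J" "x \<in> E" for j x
  proof (rule ccontr)
    assume "\<not> ?thesis"
    then have "cell j x \<in> B j" using that by (auto simp: B_def)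
    moreover have "finite (B j)" using fin by (simp add: B_def)
    ultimately have "1 \<le> card (B j)" by (metis One_nat_def Suc_leI card_gt_0_iff empty_iff)
    then have "1 \<le> real (card (B j))" by simp
    then show False using cardB[of j] J[OF that(1)] by (simp add: mult_ac)
  qed
  define R where "R j = {Q \<in> cell (Suc j) ` {x\<in>E. cell j x \<in> B j}. D (Suc j) Q \<le> 2 powr - real m}" for j
  define P where "P j Q = {x\<in>E. cell (Suc j) x = Q}" for j Q
  have Rsub: "R j \<subseteq> (\<Union>Q\<in>B j. cell (Suc j) ` {x\<in>E. cell j x = Q})" for j by (auto simp: R_def)
  have finB: "finite (B j)" for j using fin by (simp add: B_def)
  have finR: "finite (R j)" for j
    by (rule finite_subset[OF Rsub]) (intro finite_UN_I finB card_subcells(1), simp)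
  have cardR: "real (card (R j)) \<le> 2 ^ ?N * (V * 2 powr - (real j * (p - ?n)) * 2 powr (real m * p))" for j
  proof -
    have "card (R j) \<le> card (\<Union>Q\<in>B j. cell (Suc j) ` {x\<in>E. cell j x = Q})"
      by (intro card_mono Rsub finite_UN_I finB card_subcells(1)) simp
    also have "\<dots> \<le> (\<Sum>Q\<in>B j. card (cell (Suc j) ` {x\<in>E. cell j x = Q}))" by (rule card_UN_le[OF finB])
    also have "\<dots> \<le> (\<Sum>Q\<in>B j. (2 ^ (Suc j - j)) ^ ?N)" by (intro sum_mono card_subcells(2)) simp
    also have "\<dots> = 2 ^ ?N * card (B j)" by (simp add: Suc_diff_le)
    finally have "real (card (R j)) \<le> real (2 ^ ?N * card (B j))" by (rule of_nat_mono)
    also have "\<dots> = 2 ^ ?N * real (card (B j))" by simp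
    finally show ?thesis using cardB[of j] by (meson mult_left_mono order_trans zero_le_numeral zero_le_power)
  qed
  have E'sub: "E' \<subseteq> (\<Union>j\<in>{k..<J}. \<Union>Q\<in>R j. P j Q)"
  proof
    fix x assume x: "x \<in> E'"
    then have xE: "x \<in> E" using E' by blast
    obtain l where l: "l \<ge> k" "2 powr - real m < D l (cell l x)" using E'(2)[OF x] by blast
    define j where "j = (GREATEST j. j < J \<and> 2 powr - real m < D j (cell j x))"
    have lJ: "l < J \<and> 2 powr - real m < D l (cell l x)" using l smallJ[of l x] xE by (meson leD not_le_imp_less)
    have j: "j < J \<and> 2 powr - real m < D j (cell j x)"
      unfolding j_def by (rule GreatestI_nat[of _ l J]) (use lJ in auto)
    have "l \<le> j" unfolding j_def by (rule Greatest_le_nat[of _ l J]) (use lJ in auto)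
    have "D (Suc j) (cell (Suc j) x) \<le> 2 powr - real m"
    proof (rule ccontr)
      assume c: "\<not> ?thesis"
      then have "Suc j < J" using smallJ[of "Suc j" x] xE by (meson not_le_imp_less)
      then have "Suc j \<le> j" using c unfolding j_def by (intro Greatest_le_nat[of _ _ J]) auto
      then show False by simp
    qed
    then have "cell (Suc j) x \<in> R j" using j xE by (auto simp: R_def B_def)
    moreover have "x \<in> P j (cell (Suc j) x)" using xE by (simp add: P_def)
    ultimately show "x \<in> (\<Union>j\<in>{k..<J}. \<Union>Q\<in>R j. P j Q)" using j \<open>l \<le> j\<close> l by auto
  qed
  have P: "finite (cell m ` f ` P j Q)" "card (cell m ` f ` P j Q) \<le> 3 ^ ?N" if "Q \<in> R j" for j Q
  proof -
    have "\<bar>f x $ i - f y $ i\<bar> \<le> 2 powr - real m" if "x \<in> P j Q" "y \<in> P j Q" for x y i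
      using osc[of x y "Suc j" i] that \<open>Q \<in> R j\<close> by (auto simp: P_def R_def)
    from card_image_cells[OF this] show "finite (cell m ` f ` P j Q)" "card (cell m ` f ` P j Q) \<le> 3 ^ ?N" by auto
  qed
  let ?U = "\<Union>j\<in>{k..<J}. \<Union>Q\<in>R j. cell m ` f ` P j Q"
  have finU: "finite ?U" by (intro finite_UN_I finR P) auto
  have sub: "cell m ` f ` E' \<subseteq> ?U"
  proof -
    have "cell m ` f ` E' \<subseteq> cell m ` f ` (\<Union>j\<in>{k..<J}. \<Union>Q\<in>R j. P j Q)" by (intro image_mono E'sub)
    also have "\<dots> = ?U" by (simp add: image_UN)
    finally show ?thesis .
  qed
  show "finite (cell m ` f ` E')" using sub finU finite_subset by blast
  have "card (cell m ` f ` E') \<le> card ?U" by (rule card_mono[OF finU sub])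
  also have "\<dots> \<le> (\<Sum>j\<in>{k..<J}. card (\<Union>Q\<in>R j. cell m ` f ` P j Q))" by (rule card_UN_le) simp
  also have "\<dots> \<le> (\<Sum>j\<in>{k..<J}. \<Sum>Q\<in>R j. card (cell m ` f ` P j Q))" by (intro sum_mono card_UN_le finR)
  also have "\<dots> \<le> (\<Sum>j\<in>{k..<J}. \<Sum>Q\<in>R j. 3 ^ ?N)" by (intro sum_mono P)
  also have "\<dots> = (\<Sum>j\<in>{k..<J}. card (R j) * 3 ^ ?N)" by simp
  finally have "real (card (cell m ` f ` E')) \<le> real (\<Sum>j\<in>{k..<J}. card (R j) * 3 ^ ?N)" by (rule of_nat_mono)
  also have "\<dots> = (\<Sum>j\<in>{k..<J}. real (card (R j)) * 3 ^ ?N)" by simp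
  also have "\<dots> \<le> (\<Sum>j\<in>{k..<J}. (2 ^ ?N * (V * 2 powr - (real j * (p - ?n)) * 2 powr (real m * p))) * 3 ^ ?N)"
    by (intro sum_mono mult_right_mono cardR) auto
  also have "\<dots> = 6 ^ ?N * V * 2 powr (real m * p) * (\<Sum>j\<in>{k..<J}. 2 powr - (real j * (p - ?n)))"
    unfolding sum_distrib_left by (intro sum.cong refl) (simp add: mult_ac flip: power_mult_distrib)
  also have "\<dots> \<le> 6 ^ ?N * V * 2 powr (real m * p) * (2 powr - (real k * (p - ?n)) / (1 - 2 powr - (p - ?n)))"
    using V0 assms(2) by (intro mult_left_mono geometric_powr_sum) auto
  finally show "real (card (cell m ` f ` E')) \<le> 6 ^ ?N * V * 2 powr (real m * p) * (2 powr - (real k * (p - ?n)) / (1 - 2 powr - (p - ?n)))" .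
qed

lemma cover_cost_Un_le:
  assumes "finite A" "finite B"
  shows "cover_cost s (A \<union> B) \<le> cover_cost s A + cover_cost s B"
proof -
  have "cover_cost s (A \<union> B) + cover_cost s (A \<inter> B) = cover_cost s A + cover_cost s B"
    unfolding cover_cost_def by (rule sum.union_inter[OF assms])
  then show ?thesis using cover_cost_nonneg[of s "A \<inter> B"] by linarith
qed

lemma cover_cost_UN_le:
  assumes "finite I" "\<And>i. i \<in> I \<Longrightarrow> finite (A i)"
  shows "cover_cost s (\<Union>i\<in>I. A i) \<le> (\<Sum>i\<in>I. cover_cost s (A i))"
  using assms
proof (induction I)
  case empty
  then show ?case by (simp add: cover_cost_def)
next
  case (insert i I)
  have "cover_cost s (\<Union>i\<in>insert i I. A i) \<le> cover_cost s (A i) + cover_cost s (\<Union>i\<in>I. A i)"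
    using insert cover_cost_Un_le[of "A i" "\<Union>i\<in>I. A i" s] by simp
  also have "\<dots> \<le> cover_cost s (A i) + (\<Sum>i\<in>I. cover_cost s (A i))" using insert by simp
  finally show ?case using insert by simp
qed

lemma cover_cost_Pair: "cover_cost s (Pair l ` Z) = real (card Z) * 2 powr - (real l * s)"
  unfolding cover_cost_def by (subst sum.reindex) (auto simp: inj_on_def)

lemma card_cell_cover_le:
  assumes C: "cell_cover \<theta> k A C" and "0 \<le> s"
  shows "real (card C) * 2 powr - (real (top_level \<theta> k) * s) \<le> cover_cost s C"
proof -
  have "real (card C) * 2 powr - (real (top_level \<theta> k) * s) = (\<Sum>c\<in>C. 2 powr - (real (top_level \<theta> k) * s))" by simp
  also have "\<dots> \<le> cover_cost s C"
    unfolding cover_cost_def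
  proof (rule sum_mono, clarify)
    fix l z assume "(l, z) \<in> C"
    then have "l \<le> top_level \<theta> k" using C by (auto simp: cell_cover_def)
    then show "2 powr - (real (top_level \<theta> k) * s) \<le> 2 powr - (real l * s)"
      using assms(2) by (intro powr_mono) (auto intro: mult_right_mono)
  qed
  finally show ?thesis .
qed

text \<open>Level m in the image is paired with level m / \<alpha> in the domain. The refined cells
  then number about 2^{m(p - (p-n)/\<alpha>)} = 2^{mg}, and the finest levels of the two windows fit
  together because (m / \<alpha>) s = m g. The gap between \<open>g\<close> and \<open>t\<close>
  pays for a factor linear in m.\<close>

lemma bounded_content_image:
  fixes E :: "(real^'n::finite) set" and f :: "real^'n \<Rightarrow> real^'n"
  assumes "bounded E" "bounded (f ` E)" "real CARD('n) < p" "0 < \<theta>" "\<theta> \<le> 1" "0 < s"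
    and D0: "\<And>k Q. 0 \<le> D k Q" and V0: "0 \<le> V"
    and osc: "\<And>k x y j. x \<in> E \<Longrightarrow> y \<in> E \<Longrightarrow> cell k x = cell k y \<Longrightarrow> \<bar>f x $ j - f y $ j\<bar> \<le> D k (cell k x)"
    and sumD: "\<And>k. (\<Sum>Q\<in>cell k ` E. D k Q powr p) \<le> V * 2 powr - (real k * (p - real CARD('n)))"
    and bc: "bounded_content \<theta> E s" and t: "p * s / (p - real CARD('n) + s) < t"
  shows "bounded_content \<theta> (f ` E) t"
proof -
  let ?n = "real CARD('n)" and ?N = "CARD('n)"
  have n: "0 < ?n" by simp
  have p: "0 < p" using assms(3) n by linarith
  define \<alpha> where "\<alpha> = (p - ?n + s) / p"
  define g where "g = p * s / (p - ?n + s)"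
  have \<alpha>: "0 < \<alpha>" using assms p by (simp add: \<alpha>_def)
  have g: "0 < g" "g < t" using t assms p by (auto simp: g_def)
  have g\<alpha>: "s / \<alpha> = g" using p by (simp add: g_def \<alpha>_def mult.commute)
  have pg: "p - (p - ?n) / \<alpha> = g" 
  proof -
    have "p * (p - ?n + s) - p * (p - ?n) = p * s" by (simp add: algebra_simps)
    then show ?thesis using p assms by (simp add: g_def \<alpha>_def field_simps)
  qed
  obtain B K where BK: "\<And>k. k \<ge> K \<Longrightarrow> \<exists>C. cell_cover \<theta> k E C \<and> cover_cost s C \<le> B"
    using bc unfolding bounded_content_def by blast
  have B0: "0 \<le> B" using BK[of K] cover_cost_nonneg order_trans by blast
  define c1 where "c1 = 1 / (\<alpha> * \<theta>)"
  have c1: "0 < c1" using \<alpha> assms by (simp add: c1_def)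
  define \<tau> where "\<tau> = t - g"
  have \<tau>: "0 < \<tau>" using g by (simp add: \<tau>_def)
  have "(\<lambda>m::nat. (c1 * real m + 2) * 2 powr - (real m * \<tau>)) \<longlonglongrightarrow> 0"
    using c1 \<tau> by real_asymp
  then have "eventually (\<lambda>m::nat. (c1 * real m + 2) * 2 powr - (real m * \<tau>) < 1) sequentially"
    by (rule order_tendstoD) simp
  \<comment> \<open>From \<open>K1\<close> on the gain from the gap \<tau> outweighs the linear
    number of levels in the window.\<close>
  then obtain K1 where K1: "\<And>m. m \<ge> K1 \<Longrightarrow> (c1 * real m + 2) * 2 powr - (real m * \<tau>) < 1"
    by (auto simp: eventually_sequentially)
  define K2 where "K2 = nat \<lceil>\<alpha> * (real K + 1)\<rceil>"
  define c2 where "c2 = 6 ^ ?N * V * (2 powr (p - ?n) / (1 - 2 powr - (p - ?n)))"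
  have c20: "0 \<le> c2"
  proof -
    have "2 powr - (p - ?n) \<le> 2 powr 0" using assms by (intro powr_mono) auto
    then show ?thesis using V0 by (simp add: c2_def)
  qed
  define c3 where "c3 = 3 ^ ?N * (B * 2 powr s + 2 powr t * (V + B))"
  show ?thesis
    unfolding bounded_content_def
  proof (rule exI[of _ "c3 + c2"], rule exI[of _ "max K1 K2"], intro allI impI)
    fix m assume m: "m \<ge> max K1 K2"
    define k where "k = nat \<lfloor>real m / \<alpha>\<rfloor>"
    have m0: "0 \<le> real m / \<alpha>" using \<alpha> by simp
    have k: "real k \<le> real m / \<alpha>" "real m / \<alpha> < real k + 1" using m0 unfolding k_def by linarith+
    have "\<alpha> * (real K + 1) \<le> real m" using m unfolding K2_def by linarith
    then have "real K + 1 \<le> real m / \<alpha>" using \<alpha> by (simp add: pos_le_divide_eq mult.commute)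
    then have "k \<ge> K" using k by linarith
    then obtain C where C: "cell_cover \<theta> k E C" "cover_cost s C \<le> B" using BK by blast
    have finC: "finite C" using C by (simp add: cell_cover_def)
    define k1 where "k1 = top_level \<theta> k"
    define m1 where "m1 = top_level \<theta> m"
    have mm1: "m \<le> m1" unfolding m1_def by (rule le_top_level) (use assms in auto)
    have k1: "real k1 \<le> c1 * real m + 1"
    proof -
      have "real k1 \<le> real k / \<theta> + 1" using top_level_bounds[OF assms(4), of k] by (simp add: k1_def)
      also have "\<dots> \<le> (real m / \<alpha>) / \<theta> + 1" using k assms by (intro add_right_mono divide_right_mono) auto
      finally show ?thesis by (simp add: c1_def)
    qed
    \<comment> \<open>An image cell at the finest scale costs at most 2 powr s times as much as a
      cell of the finest level in the domain. Cells clamped to \<open>m1\<close> are therefore paid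
      for by the cost of \<open>C\<close>.\<close>
    have k1m1: "real k1 * s \<le> real m1 * t + s"
    proof -
      have "real k1 * s \<le> (c1 * real m + 1) * s" using k1 assms by (intro mult_right_mono) auto
      also have "\<dots> = (real m / \<theta>) * g + s" using \<alpha> assms by (simp add: c1_def g\<alpha>[symmetric] field_simps)
      also have "\<dots> \<le> real m1 * t + s"
        using top_level_bounds[OF assms(4), of m] g assms by (intro add_right_mono mult_mono) (auto simp: m1_def)
      finally show ?thesis .
    qed
    define G where "G = {c\<in>C. snd c \<in> cell (fst c) ` E \<and> D (fst c) (snd c) \<le> 2 powr - real m}"
    have finG: "finite G" using finC by (simp add: G_def)
    have "\<exists>i. m \<le> i \<and> i \<le> m1 \<and> D (fst c) (snd c) \<le> 2 powr - real i \<and>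
        2 powr - (real i * t) \<le> 2 powr - (real m1 * t) + (2 * D (fst c) (snd c)) powr t" if "c \<in> G" for c
      by (rule split_level) (use that D0 mm1 g in \<open>auto simp: G_def\<close>)
    then obtain i where i: "\<And>c. c \<in> G \<Longrightarrow> m \<le> i c \<and> i c \<le> m1 \<and> D (fst c) (snd c) \<le> 2 powr - real (i c) \<and>
        2 powr - (real (i c) * t) \<le> 2 powr - (real m1 * t) + (2 * D (fst c) (snd c)) powr t"
      by metis
    define S where "S c = {x\<in>E. cell (fst c) x = snd c}" for c
    have Sc: "finite (cell (i c) ` f ` S c)" "card (cell (i c) ` f ` S c) \<le> 3 ^ ?N" if "c \<in> G" for c
    proof -
      have "\<bar>f x $ j - f y $ j\<bar> \<le> 2 powr - real (i c)" if "x \<in> S c" "y \<in> S c" for x y j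
        using osc[of x y "fst c" j] that i[OF \<open>c \<in> G\<close>] by (auto simp: S_def)
      from card_image_cells[OF this] show "finite (cell (i c) ` f ` S c)" "card (cell (i c) ` f ` S c) \<le> 3 ^ ?N" by auto
    qed
    define C1 where "C1 = (\<Union>c\<in>G. Pair (i c) ` cell (i c) ` f ` S c)"
    define E' where "E' = {x\<in>E. \<exists>l. (l, cell l x) \<in> C \<and> 2 powr - real m < D l (cell l x)}"
    define C2 where "C2 = Pair m ` cell m ` f ` E'"
    have E'1: "E' \<subseteq> E" by (auto simp: E'_def)
    have E'2: "\<exists>l\<ge>k. 2 powr - real m < D l (cell l x)" if "x \<in> E'" for x
      using that C(1) by (fastforce simp: E'_def cell_cover_def)
    note E'c = card_refined_cells[OF assms(1,3) D0 V0 osc sumD E'1 E'2]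
    have fin1: "finite C1" unfolding C1_def by (intro finite_UN_I finG finite_imageI[OF Sc(1)])
    have fin2: "finite C2" unfolding C2_def by (intro finite_imageI[OF E'c(1)])
    have cov: "cell_cover \<theta> m (f ` E) (C1 \<union> C2)"
      unfolding cell_cover_def
    proof (intro conjI ballI)
      show "finite (C1 \<union> C2)" using fin1 fin2 by simp
      show "case c of (l, z) \<Rightarrow> m \<le> l \<and> l \<le> top_level \<theta> m" if "c \<in> C1 \<union> C2" for c
        using that i mm1 by (auto simp: C1_def C2_def m1_def)
      fix y assume "y \<in> f ` E"
      then obtain x where x: "x \<in> E" "y = f x" by blast
      obtain l where l: "(l, cell l x) \<in> C" using C(1) x by (auto simp: cell_cover_def)
      show "\<exists>l. (l, cell l y) \<in> C1 \<union> C2"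
      proof (cases "D l (cell l x) \<le> 2 powr - real m")
        case True
        define c where "c = (l, cell l x)"
        have "c \<in> G" using True l x by (auto simp: G_def c_def)
        moreover have "x \<in> S c" using x by (simp add: S_def c_def)
        ultimately have "(i c, cell (i c) y) \<in> C1" unfolding C1_def x(2) by blast
        then show ?thesis by blast
      next
        case False
        then have "x \<in> E'" using l x by (auto simp: E'_def)
        then have "(m, cell m y) \<in> C2" by (auto simp: C2_def x(2))
        then show ?thesis by blast
      qed
    qed
    have cost2: "cover_cost t C2 \<le> c2"
    proof -
      have "cover_cost t C2 = real (card (cell m ` f ` E')) * 2 powr - (real m * t)"
        unfolding C2_def by (rule cover_cost_Pair)
      also have "\<dots> \<le> (6 ^ ?N * V * 2 powr (real m * p) * (2 powr - (real k * (p - ?n)) / (1 - 2 powr - (p - ?n)))) * 2 powr - (real m * t)"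
        by (intro mult_right_mono E'c(2)) auto
      also have "\<dots> = 6 ^ ?N * V / (1 - 2 powr - (p - ?n)) * 2 powr (real m * p + - (real k * (p - ?n)) + - (real m * t))"
        by (simp only: powr_add) (simp add: mult_ac)
      also have "\<dots> \<le> 6 ^ ?N * V / (1 - 2 powr - (p - ?n)) * 2 powr (p - ?n)"
      proof (rule mult_left_mono)
        have "real m / \<alpha> * (p - ?n) \<le> (real k + 1) * (p - ?n)" using k assms by (intro mult_right_mono) auto
        then have "real m * p + - (real k * (p - ?n)) + - (real m * t) \<le> real m * (p - (p - ?n) / \<alpha>) - real m * t + (p - ?n)"
          by (simp add: algebra_simps diff_divide_distrib)
        also have "\<dots> = - (real m * \<tau>) + (p - ?n)" by (simp add: pg \<tau>_def algebra_simps)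
        also have "\<dots> \<le> p - ?n" using \<tau> by simp
        finally show "2 powr (real m * p + - (real k * (p - ?n)) + - (real m * t)) \<le> 2 powr (p - ?n)" by simp
        have "2 powr - (p - ?n) \<le> 2 powr 0" using assms by (intro powr_mono) auto
        then show "0 \<le> 6 ^ ?N * V / (1 - 2 powr - (p - ?n))" using V0 by simp
      qed
      also have "\<dots> = c2" by (simp add: c2_def)
      finally show ?thesis .
    qed
    \<comment> \<open>Each level up to \<open>k1\<close> contributes at most \<open>V\<close>, and
      the cost of the given cover contributes \<open>B\<close>.\<close>
    have sumG: "(\<Sum>c\<in>G. D (fst c) (snd c) powr g) \<le> (real k1 + 1) * V + B"
    proof -
      have "(\<Sum>c\<in>G. D (fst c) (snd c) powr g) \<le> (\<Sum>c\<in>G. D (fst c) (snd c) powr p * 2 powr (real (fst c) * (p - ?n)) + 2 powr - (real (fst c) * s))"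
        unfolding g_def by (intro sum_mono young_split assms D0 n)
      also have "\<dots> = (\<Sum>c\<in>G. D (fst c) (snd c) powr p * 2 powr (real (fst c) * (p - ?n))) + (\<Sum>c\<in>G. 2 powr - (real (fst c) * s))"
        by (rule sum.distrib)
      also have "(\<Sum>c\<in>G. 2 powr - (real (fst c) * s)) \<le> (\<Sum>c\<in>C. 2 powr - (real (fst c) * s))"
        using finC by (intro sum_mono2) (auto simp: G_def)
      also have "\<dots> = cover_cost s C" by (simp add: cover_cost_def case_prod_beta)
      also have "\<dots> \<le> B" by (rule C(2))
      also have "(\<Sum>c\<in>G. D (fst c) (snd c) powr p * 2 powr (real (fst c) * (p - ?n)))
          \<le> (\<Sum>c\<in>Sigma {..k1} (\<lambda>l. cell l ` E). D (fst c) (snd c) powr p * 2 powr (real (fst c) * (p - ?n)))"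
        using C(1) by (intro sum_mono2 finite_SigmaI finite_cell_image assms) (auto simp: G_def cell_cover_def k1_def)
      also have "\<dots> = (\<Sum>l\<le>k1. \<Sum>Q\<in>cell l ` E. D l Q powr p * 2 powr (real l * (p - ?n)))"
        by (subst sum.Sigma) (auto intro!: finite_cell_image assms simp: case_prod_beta)
      also have "\<dots> \<le> (\<Sum>l\<le>k1. V)"
      proof (rule sum_mono)
        fix l
        have "(\<Sum>Q\<in>cell l ` E. D l Q powr p * 2 powr (real l * (p - ?n))) = (\<Sum>Q\<in>cell l ` E. D l Q powr p) * 2 powr (real l * (p - ?n))"
          by (rule sum_distrib_right[symmetric])
        also have "\<dots> \<le> V * 2 powr - (real l * (p - ?n)) * 2 powr (real l * (p - ?n))"
          by (intro mult_right_mono sumD) auto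
        also have "\<dots> = V" by (simp add: powr_minus)
        finally show "(\<Sum>Q\<in>cell l ` E. D l Q powr p * 2 powr (real l * (p - ?n))) \<le> V" .
      qed
      also have "\<dots> = (real k1 + 1) * V" by simp
      finally show ?thesis by simp
    qed
    \<comment> \<open>Images of cells in \<open>G\<close> have size at most 2 powr - m, so passing
      from exponent \<open>g\<close> to \<open>t\<close> gains 2 powr - (m * \<tau>).\<close>
    have sumt: "(\<Sum>c\<in>G. D (fst c) (snd c) powr t) \<le> V + B"
    proof -
      have "(\<Sum>c\<in>G. D (fst c) (snd c) powr t) \<le> (\<Sum>c\<in>G. 2 powr - (real m * \<tau>) * D (fst c) (snd c) powr g)"
      proof (rule sum_mono)
        fix c assume "c \<in> G"
        then have "D (fst c) (snd c) powr \<tau> \<le> (2 powr - real m) powr \<tau>"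
          using D0 \<tau> by (intro powr_mono2) (auto simp: G_def)
        then have "D (fst c) (snd c) powr \<tau> * D (fst c) (snd c) powr g \<le> 2 powr - (real m * \<tau>) * D (fst c) (snd c) powr g"
          by (intro mult_right_mono) (auto simp: powr_powr)
        then show "D (fst c) (snd c) powr t \<le> 2 powr - (real m * \<tau>) * D (fst c) (snd c) powr g"
          by (simp add: \<tau>_def flip: powr_add)
      qed
      also have "\<dots> = 2 powr - (real m * \<tau>) * (\<Sum>c\<in>G. D (fst c) (snd c) powr g)" by (rule sum_distrib_left[symmetric])
      also have "\<dots> \<le> 2 powr - (real m * \<tau>) * ((c1 * real m + 2) * V + B)"
        using k1 V0 by (intro mult_left_mono order_trans[OF sumG] add_right_mono mult_right_mono) auto
      also have "\<dots> = ((c1 * real m + 2) * 2 powr - (real m * \<tau>)) * V + 2 powr - (real m * \<tau>) * B"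
        by (simp add: algebra_simps)
      also have "\<dots> \<le> 1 * V + 1 * B"
      proof (intro add_mono mult_right_mono)
        show "(c1 * real m + 2) * 2 powr - (real m * \<tau>) \<le> 1" using K1[of m] m by simp
        have "2 powr - (real m * \<tau>) \<le> 2 powr 0" using \<tau> by (intro powr_mono) auto
        then show "2 powr - (real m * \<tau>) \<le> 1" by simp
      qed (use V0 B0 in auto)
      finally show ?thesis by simp
    qed
    have cost1: "cover_cost t C1 \<le> c3"
    proof -
      have "cover_cost t C1 \<le> (\<Sum>c\<in>G. cover_cost t (Pair (i c) ` cell (i c) ` f ` S c))"
        unfolding C1_def by (intro cover_cost_UN_le finG finite_imageI[OF Sc(1)])
      also have "\<dots> = (\<Sum>c\<in>G. real (card (cell (i c) ` f ` S c)) * 2 powr - (real (i c) * t))"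
        by (simp add: cover_cost_Pair)
      also have "\<dots> \<le> (\<Sum>c\<in>G. 3 ^ ?N * (2 powr - (real m1 * t) + (2 * D (fst c) (snd c)) powr t))"
      proof (intro sum_mono mult_mono)
        fix c assume c: "c \<in> G"
        have "real (card (cell (i c) ` f ` S c)) \<le> real (3 ^ ?N)" by (rule of_nat_mono[OF Sc(2)[OF c]])
        then show "real (card (cell (i c) ` f ` S c)) \<le> 3 ^ ?N" by simp
      qed (use i in auto)
      also have "\<dots> = 3 ^ ?N * (real (card G) * 2 powr - (real m1 * t) + 2 powr t * (\<Sum>c\<in>G. D (fst c) (snd c) powr t))"
        using D0 by (simp add: sum_distrib_left[symmetric] sum.distrib powr_mult)
      also have "\<dots> \<le> 3 ^ ?N * (B * 2 powr s + 2 powr t * (V + B))"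
      proof (intro mult_left_mono add_mono sumt)
        have "real (card G) * 2 powr - (real m1 * t) \<le> real (card C) * 2 powr (s - real k1 * s)"
          using k1m1 finC by (intro mult_mono of_nat_mono card_mono powr_mono) (auto simp: G_def)
        also have "\<dots> = (real (card C) * 2 powr - (real k1 * s)) * 2 powr s"
          by (simp add: powr_diff powr_minus field_simps)
        also have "\<dots> \<le> B * 2 powr s"
          using card_cell_cover_le[OF C(1), of s] C(2) assms by (intro mult_right_mono) (auto simp: k1_def)
        finally show "real (card G) * 2 powr - (real m1 * t) \<le> B * 2 powr s" .
      qed auto
      finally show ?thesis by (simp add: c3_def)
    qed
    have "cover_cost t (C1 \<union> C2) \<le> c3 + c2"
      using cover_cost_Un_le[OF fin1 fin2, of t] cost1 cost2 by linarith
    then show "\<exists>C. cell_cover \<theta> m (f ` E) C \<and> cover_cost t C \<le> c3 + c2" using cov by blast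
  qed
qed

section \<open>Sobolev regularity of the bump series\<close>

lemma integrable_continuous_support:
  fixes f :: "'a::euclidean_space \<Rightarrow> real"
  assumes "continuous_on UNIV f" "\<And>x. R < norm x \<Longrightarrow> f x = 0"
  shows "integrable lborel f"
proof -
  have "integrable lborel (\<lambda>x. indicator (cball 0 R) x *\<^sub>R f x)"
    by (rule borel_integrable_compact) (auto intro: continuous_on_subset[OF assms(1)])
  also have "(\<lambda>x. indicator (cball 0 R) x *\<^sub>R f x) = f"
    using assms(2) by (auto simp: indicator_def fun_eq_iff not_le)
  finally show ?thesis .
qed

lemma bounded_continuous_support:
  fixes f :: "'a::euclidean_space \<Rightarrow> real"
  assumes "continuous_on UNIV f" "\<And>x. R < norm x \<Longrightarrow> f x = 0"
  shows "\<exists>B\<ge>0. \<forall>x. \<bar>f x\<bar> \<le> B"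
proof -
  have "compact (f ` cball 0 R)"
    by (intro compact_continuous_image continuous_on_subset[OF assms(1)]) auto
  then obtain B where B: "\<And>y. y \<in> f ` cball 0 R \<Longrightarrow> norm y \<le> B"
    using compact_imp_bounded bounded_iff by metis
  have "\<bar>f x\<bar> \<le> max B 0" for x
  proof (cases "norm x \<le> R")
    case True
    then show ?thesis using B[of "f x"] by auto
  next
    case False
    then show ?thesis using assms(2)[of x] by simp
  qed
  then show ?thesis by (intro exI[of _ "max B 0"]) auto
qed

lemma lborel_integral_translate:
  fixes f :: "'a::euclidean_space \<Rightarrow> real"
  assumes "f \<in> borel_measurable borel"
  shows "(LINT x|lborel. f (c + x)) = (LINT x|lborel. f x)"
proof -
  have "(LINT x|lborel. f x) = (LINT x|distr lborel borel ((+) c). f x)"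
    by (simp add: lborel_distr_plus)
  also have "\<dots> = (LINT x|lborel. f (c + x))"
    by (rule integral_distr) (use assms in auto)
  finally show ?thesis by simp
qed

text \<open>Derivative along one direction: this is all that difference quotients and integration by
  parts use, and it passes easily to products and finite sums.\<close>

definition line_deriv :: "'a::euclidean_space \<Rightarrow> ('a \<Rightarrow> real) \<Rightarrow> ('a \<Rightarrow> real) \<Rightarrow> bool" where
  "line_deriv e v w \<longleftrightarrow> (\<forall>x. ((\<lambda>t. v (x + t *\<^sub>R e)) has_real_derivative w x) (at 0))"

lemma line_deriv_at:
  assumes "line_deriv e v w"
  shows "((\<lambda>t. v (x + t *\<^sub>R e)) has_real_derivative w (x + s *\<^sub>R e)) (at s)"
proof -
  have "((\<lambda>t. v ((x + s *\<^sub>R e) + t *\<^sub>R e)) has_real_derivative w (x + s *\<^sub>R e)) (at 0)"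
    using assms unfolding line_deriv_def by blast
  then have "((\<lambda>t. v ((x + s *\<^sub>R e) + (t - s) *\<^sub>R e)) has_real_derivative w (x + s *\<^sub>R e)) (at s)"
    using DERIV_shift[of "\<lambda>t. v ((x + s *\<^sub>R e) + (t - s) *\<^sub>R e)" "w (x + s *\<^sub>R e)" 0 s] by simp
  then show ?thesis by (simp add: algebra_simps)
qed

lemma line_deriv_has_derivative:
  assumes "\<And>x. (v has_derivative v' x) (at x)"
  shows "line_deriv e v (\<lambda>x. v' x e)"
  unfolding line_deriv_def
proof
  fix x
  have 1: "((\<lambda>t. x + t *\<^sub>R e) has_derivative (\<lambda>t. t *\<^sub>R e)) (at 0)"
    by (auto intro!: derivative_eq_intros)
  have "(v has_derivative v' x) (at (x + 0 *\<^sub>R e))" using assms[of x] by simp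
  from has_derivative_compose[OF 1 this]
  have 2: "((\<lambda>t. v (x + t *\<^sub>R e)) has_derivative (\<lambda>t. v' x (t *\<^sub>R e))) (at 0)" .
  have "linear (v' x)" using assms has_derivative_linear by blast
  then have "(\<lambda>t. v' x (t *\<^sub>R e)) = (*) (v' x e)" by (auto simp: linear_scale fun_eq_iff)
  then show "((\<lambda>t. v (x + t *\<^sub>R e)) has_real_derivative v' x e) (at 0)"
    using 2 by (simp add: has_field_derivative_def)
qed

lemma line_deriv_mult:
  assumes "line_deriv e u u'" "line_deriv e v v'"
  shows "line_deriv e (\<lambda>x. u x * v x) (\<lambda>x. u' x * v x + u x * v' x)"
  unfolding line_deriv_def
proof
  fix x
  show "((\<lambda>t. u (x + t *\<^sub>R e) * v (x + t *\<^sub>R e)) has_real_derivative u' x * v x + u x * v' x) (at 0)"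
    using DERIV_mult[OF assms[unfolded line_deriv_def, rule_format, of x]] by (simp add: mult.commute add.commute)
qed

lemma line_deriv_sum:
  assumes "\<And>i. i \<in> I \<Longrightarrow> line_deriv e (u i) (u' i)"
  shows "line_deriv e (\<lambda>x. \<Sum>i\<in>I. u i x) (\<lambda>x. \<Sum>i\<in>I. u' i x)"
  using assms unfolding line_deriv_def by (auto intro!: DERIV_sum)

lemma line_deriv_cmult:
  assumes "line_deriv e u u'"
  shows "line_deriv e (\<lambda>x. u x * c) (\<lambda>x. u' x * c)"
  using assms unfolding line_deriv_def by (auto intro!: DERIV_cmult_right)

text \<open>
  Translation invariance makes every difference quotient have integral zero; dominated
  convergence does the rest, so no Fubini argument is needed.
\<close>

lemma integral_line_deriv_eq_0:
  fixes v w :: "'a::euclidean_space \<Rightarrow> real"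
  assumes vw: "line_deriv e v w" and "norm e = 1" and v: "continuous_on UNIV v" and w: "continuous_on UNIV w"
    and supp: "\<And>x. R < norm x \<Longrightarrow> v x = 0" "\<And>x. R < norm x \<Longrightarrow> w x = 0"
  shows "(LINT x|lborel. w x) = 0"
proof -
  obtain B where B: "0 \<le> B" "\<And>x. \<bar>w x\<bar> \<le> B"
    using bounded_continuous_support[OF w supp(2)] by blast
  define h where "h k = 1 / (real k + 1)" for k :: nat
  have h: "0 < h k" "h k \<le> 1" for k by (simp_all add: h_def)
  define q where "q k x = (v (x + h k *\<^sub>R e) - v x) / h k" for k x
  have vm: "v \<in> borel_measurable borel" "w \<in> borel_measurable borel"
    using v w by (auto intro: borel_measurable_continuous_onI)
  have vi: "integrable lborel v" by (rule integrable_continuous_support[OF v supp(1)])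
  have vsi: "integrable lborel (\<lambda>x. v (x + c))" for c
  proof (rule integrable_continuous_support)
    show "continuous_on UNIV (\<lambda>x. v (x + c))"
      by (intro continuous_on_compose2[OF v] continuous_intros) auto
    show "v (x + c) = 0" if "R + norm c < norm x" for x
      using that norm_triangle_ineq4[of "x + c" c] by (intro supp(1)) simp
  qed
  have q0: "(LINT x|lborel. q k x) = 0" for k
  proof -
    have "(LINT x|lborel. q k x) = ((LINT x|lborel. v (x + h k *\<^sub>R e)) - (LINT x|lborel. v x)) / h k"
      unfolding q_def using vi vsi by simp
    also have "(LINT x|lborel. v (x + h k *\<^sub>R e)) = (LINT x|lborel. v x)"
      using lborel_integral_translate[OF vm(1), of "h k *\<^sub>R e"] by (simp add: add.commute)
    finally show ?thesis by simp
  qed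
  have lim: "(\<lambda>k. q k x) \<longlonglongrightarrow> w x" for x
  proof -
    have "((\<lambda>t. (v (x + (0 + t) *\<^sub>R e) - v (x + 0 *\<^sub>R e)) / t) \<longlongrightarrow> w x) (at 0)"
      using vw unfolding line_deriv_def DERIV_def by blast
    moreover have "filterlim h (at 0) sequentially"
      unfolding filterlim_at
    proof
      show "h \<longlonglongrightarrow> 0" unfolding h_def[abs_def] by real_asymp
      show "\<forall>\<^sub>F k in sequentially. h k \<in> UNIV \<and> h k \<noteq> 0" using h by (auto intro!: always_eventually simp: less_imp_neq[symmetric])
    qed
    ultimately show ?thesis unfolding q_def using filterlim_compose[of _ "nhds (w x)" "at 0" h sequentially] by fastforce
  qed
  have bound: "norm (q k x) \<le> B * indicator (cball 0 (R + 1)) x" for k x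
  proof (cases "norm x \<le> R + 1")
    case True
    obtain z where z: "v (x + h k *\<^sub>R e) - v (x + 0 *\<^sub>R e) = (h k - 0) * w (x + z *\<^sub>R e)"
      using MVT2[OF h(1)[of k], of "\<lambda>t. v (x + t *\<^sub>R e)" "\<lambda>s. w (x + s *\<^sub>R e)"] line_deriv_at[OF vw, of x] by auto
    then have "q k x = w (x + z *\<^sub>R e)" using h(1)[of k] by (simp add: q_def)
    then show ?thesis using B True by simp
  next
    case False
    have "norm x - h k \<le> norm (x + h k *\<^sub>R e)"
      using norm_triangle_ineq4[of "x + h k *\<^sub>R e" "h k *\<^sub>R e"] h(1)[of k] assms(2) by simp
    then have "R < norm (x + h k *\<^sub>R e)" "R < norm x" using False h(2)[of k] by linarith+
    then have "q k x = 0" using supp(1) by (simp add: q_def)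
    then show ?thesis using False by simp
  qed
  have "(\<lambda>k. LINT x|lborel. q k x) \<longlonglongrightarrow> (LINT x|lborel. w x)"
  proof (rule integral_dominated_convergence)
    show "w \<in> borel_measurable lborel" using vm by simp
    show "q k \<in> borel_measurable lborel" for k
      unfolding q_def[abs_def] using vi vsi[of "h k *\<^sub>R e"] by (auto dest!: borel_measurable_integrable)
    show "integrable lborel (\<lambda>x. B * indicator (cball (0::'a) (R + 1)) x)"
      using emeasure_bounded_finite[of "cball (0::'a) (R + 1)"]
      by (intro integrable_mult_right integrable_real_indicator) auto
  qed (use lim bound in auto)
  then show ?thesis using LIMSEQ_unique tendsto_const by (auto simp: q0)
qed

lemma test_function_props:
  fixes \<phi> :: "real^'n::finite \<Rightarrow> real"
  assumes "test_function \<phi>"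
  shows "continuous_on UNIV \<phi>" "continuous_on UNIV (partial_deriv i \<phi>)"
    "line_deriv (axis i 1) \<phi> (partial_deriv i \<phi>)"
    "\<exists>R. \<forall>x. R < norm x \<longrightarrow> \<phi> x = 0 \<and> partial_deriv i \<phi> x = 0"
proof -
  have C: "C_k k \<phi>" for k using assms by (simp add: test_function_def)
  show "continuous_on UNIV \<phi>" using C[of 0] by simp
  show "continuous_on UNIV (partial_deriv i \<phi>)" using C[of "Suc 0"] by simp
  have d: "(\<phi> has_derivative frechet_derivative \<phi> (at x)) (at x)" for x
    using C[of "Suc 0"] by (simp add: frechet_derivative_works[symmetric])
  show "line_deriv (axis i 1) \<phi> (partial_deriv i \<phi>)"
    using line_deriv_has_derivative[OF d, of "axis i 1"] by (simp add: partial_deriv_def[abs_def])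
  have "bounded (closure {x. \<phi> x \<noteq> 0})" using assms by (simp add: test_function_def compact_imp_bounded)
  then have "bounded {x. \<phi> x \<noteq> 0}" using bounded_subset closure_subset by blast
  then obtain R where R: "\<And>x. \<phi> x \<noteq> 0 \<Longrightarrow> norm x \<le> R" by (auto simp: bounded_iff)
  show "\<exists>R. \<forall>x. R < norm x \<longrightarrow> \<phi> x = 0 \<and> partial_deriv i \<phi> x = 0"
  proof (intro exI[of _ R] allI impI)
    fix x :: "real^'n" assume x: "R < norm x"
    have z: "\<phi> y = 0" if "y \<in> - cball 0 R" for y using R[of y] that by force
    have "((\<lambda>_. 0) has_derivative (\<lambda>_. 0)) (at x)" by simp
    then have "(\<phi> has_derivative (\<lambda>_. 0)) (at x)"
      by (rule has_derivative_transform_within_open[of _ _ _ _ "- cball 0 R"]) (use x z in auto)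
    then have "frechet_derivative \<phi> (at x) = (\<lambda>_. 0)" by (rule frechet_derivative_at[symmetric])
    then show "\<phi> x = 0 \<and> partial_deriv i \<phi> x = 0" using R[of x] x by (auto simp: partial_deriv_def)
  qed
qed

text \<open>The product with a test function has bounded support, so
  \<open>integral_line_deriv_eq_0\<close> applies to it.\<close>

lemma integration_by_parts:
  fixes \<phi> :: "real^'n::finite \<Rightarrow> real"
  assumes \<phi>: "test_function \<phi>" and u: "line_deriv (axis i 1) u u'" "continuous_on UNIV u" "continuous_on UNIV u'"
  shows "(LINT x|lborel. u x * partial_deriv i \<phi> x) = - (LINT x|lborel. u' x * \<phi> x)"
proof -
  note t = test_function_props[OF \<phi>]
  obtain R where R: "\<And>x. R < norm x \<Longrightarrow> \<phi> x = 0 \<and> partial_deriv i \<phi> x = 0" using t(4)[of i] by blast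
  have i1: "integrable lborel (\<lambda>x. u' x * \<phi> x)"
    by (rule integrable_continuous_support[of _ R]) (use R in \<open>auto intro!: continuous_intros u t\<close>)
  have i2: "integrable lborel (\<lambda>x. u x * partial_deriv i \<phi> x)"
    by (rule integrable_continuous_support[of _ R]) (use R in \<open>auto intro!: continuous_intros u t\<close>)
  have "(LINT x|lborel. u' x * \<phi> x + u x * partial_deriv i \<phi> x) = 0"
    by (rule integral_line_deriv_eq_0[OF line_deriv_mult[OF u(1) t(3)], of R])
       (use R in \<open>auto intro!: continuous_intros u t\<close>)
  then show ?thesis using i1 i2 by simp
qed

section \<open>Partial derivatives of the layers in L^p\<close>

definition dbump :: "nat \<Rightarrow> int^'n \<Rightarrow> 'n \<Rightarrow> real^'n::finite \<Rightarrow> real" where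
  "dbump l z i x = 2 ^ l * bump1_deriv (2 ^ l * x $ i - real_of_int (z $ i)) *
     (\<Prod>j\<in>UNIV - {i}. bump1 (2 ^ l * x $ j - real_of_int (z $ j)))"

lemma has_derivative_bump1_coord:
  "((\<lambda>x. bump1 (2 ^ l * x $ j - real_of_int m)) has_derivative
     (\<lambda>h. 2 ^ l * bump1_deriv (2 ^ l * x $ j - real_of_int m) * h $ j)) (at (x :: real^'n::finite))"
proof -
  have 1: "((\<lambda>x :: real^'n. 2 ^ l * x $ j - real_of_int m) has_derivative (\<lambda>h. 2 ^ l * h $ j)) (at x)"
    by (auto intro!: derivative_eq_intros bounded_linear.has_derivative[OF bounded_linear_vec_nth])
  have 2: "(bump1 has_derivative (*) (bump1_deriv (2 ^ l * x $ j - real_of_int m))) (at (2 ^ l * x $ j - real_of_int m))"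
    using DERIV_bump1 by (simp add: has_field_derivative_def)
  from has_derivative_compose[OF 1 2] show ?thesis by (simp add: mult_ac)
qed

lemma line_deriv_bump:
  fixes z :: "int^'n::finite"
  shows "line_deriv (axis i 1) (bump l z) (dbump l z i)"
proof -
  have "(bump l z has_derivative (\<lambda>h. \<Sum>k\<in>UNIV. 2 ^ l * bump1_deriv (2 ^ l * x $ k - real_of_int (z $ k)) * h $ k *
      (\<Prod>j\<in>UNIV - {k}. bump1 (2 ^ l * x $ j - real_of_int (z $ j))))) (at x)" for x :: "real^'n"
    unfolding bump_def[abs_def] by (rule has_derivative_prod) (rule has_derivative_bump1_coord)
  from line_deriv_has_derivative[OF this, of "axis i 1"] show ?thesis
    by (simp add: dbump_def[abs_def] axis_def if_distrib if_distribR cong: if_cong)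
qed

lemma continuous_dbump: "continuous_on A (dbump l z i)"
  unfolding dbump_def[abs_def]
  by (intro continuous_intros continuous_on_compose2[OF continuous_bump1(1)[of UNIV]]
      continuous_on_compose2[OF continuous_bump1(2)[of UNIV]]) auto

lemma dbump_le: "\<bar>dbump l z i x\<bar> \<le> 3 * 2 ^ l"
proof -
  have "\<bar>dbump l z i x\<bar> = 2 ^ l * \<bar>bump1_deriv (2 ^ l * x $ i - real_of_int (z $ i))\<bar> *
     (\<Prod>j\<in>UNIV - {i}. bump1 (2 ^ l * x $ j - real_of_int (z $ j)))"
    by (simp add: dbump_def abs_mult abs_prod bump1_bounds)
  also have "\<dots> \<le> (2 ^ l * 3) * 1"
    by (intro mult_mono mult_left_mono bump1_deriv_bound prod_le_1 prod_nonneg) (auto simp: bump1_bounds)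
  finally show ?thesis by simp
qed

lemma dbump_eq_0: "\<not> near 1 z (cell l x) \<Longrightarrow> dbump l z i x = 0"
proof -
  assume "\<not> near 1 z (cell l x)"
  then obtain j where "\<not> \<bar>z $ j - cell l x $ j\<bar> \<le> 1" by (auto simp: near_def)
  then have "z $ j + 2 \<le> cell l x $ j \<or> cell l x $ j + 2 \<le> z $ j" by linarith
  then have "real_of_int (z $ j) + 2 \<le> real_of_int (cell l x $ j) \<or> real_of_int (cell l x $ j) + 2 \<le> real_of_int (z $ j)"
    by linarith
  then have *: "2 ^ l * x $ j - real_of_int (z $ j) \<le> -1 \<or> 2 \<le> 2 ^ l * x $ j - real_of_int (z $ j)"
    using cell_bounds[of l x j] by linarith
  show ?thesis
  proof (cases "j = i")
    case True
    then show ?thesis using bump1_deriv_eq_0[OF *] by (simp add: dbump_def)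
  next
    case False
    then have "(\<Prod>j\<in>UNIV - {i}. bump1 (2 ^ l * x $ j - real_of_int (z $ j))) = 0"
      using bump1_eq_0[OF *] by (intro prod_zero) auto
    then show ?thesis by (simp add: dbump_def)
  qed
qed

definition dlayer :: "(real^'n::finite) set \<Rightarrow> (nat \<Rightarrow> int^'n \<Rightarrow> real^'n) \<Rightarrow> 'n \<Rightarrow> 'n \<Rightarrow> nat \<Rightarrow> real^'n \<Rightarrow> real" where
  "dlayer E a c i l x = (\<Sum>z\<in>cell l ` E. dbump l z i x * a l z $ c)"

lemma line_deriv_layer: "line_deriv (axis i 1) (\<lambda>x. layer E a l x $ c) (dlayer E a c i l)"
  unfolding layer_def dlayer_def[abs_def] by (simp add: sum_component) (intro line_deriv_sum line_deriv_cmult line_deriv_bump)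

lemma continuous_dlayer: "continuous_on A (dlayer E a c i l)"
  unfolding dlayer_def[abs_def] by (intro continuous_intros continuous_dbump)

text \<open>At most 3 ^ n bumps are active at \<open>x\<close>, and each of their coefficients is at
  most the p-th root of the sum of the p-th powers.\<close>

lemma dlayer_powr_le:
  fixes a :: "nat \<Rightarrow> int^'n::finite \<Rightarrow> real^'n"
  assumes "bounded E" "0 < p"
  shows "\<bar>dlayer E a c i l x\<bar> powr p \<le> (3 * 3 ^ CARD('n) * 2 ^ l) powr p *
     (\<Sum>z\<in>cell l ` E. norm (a l z) powr p * indicator {x. near 1 z (cell l x)} x)"
proof -
  have fin: "finite (cell l ` E)" by (rule finite_cell_image[OF assms(1)])
  let ?Z = "cell l ` E \<inter> {z. near 1 z (cell l x)}"
  define S where "S = (\<Sum>z\<in>?Z. norm (a l z) powr p)"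
  have S0: "0 \<le> S" by (simp add: S_def sum_nonneg)
  have le: "norm (a l z) \<le> S powr (1 / p)" if "z \<in> ?Z" for z
  proof -
    have "norm (a l z) powr p \<le> S" unfolding S_def by (rule member_le_sum) (use that fin in auto)
    then have "(norm (a l z) powr p) powr (1 / p) \<le> S powr (1 / p)" using assms by (intro powr_mono2) auto
    then show ?thesis using assms by (simp add: powr_powr)
  qed
  have "dlayer E a c i l x = (\<Sum>z\<in>?Z. dbump l z i x * a l z $ c)"
    unfolding dlayer_def by (intro sum.mono_neutral_right fin) (auto simp: dbump_eq_0)
  also have "\<bar>\<dots>\<bar> \<le> (\<Sum>z\<in>?Z. \<bar>dbump l z i x * a l z $ c\<bar>)" by (rule sum_abs)
  also have "\<dots> \<le> (\<Sum>z\<in>?Z. (3 * 2 ^ l) * S powr (1 / p))"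
  proof (rule sum_mono)
    fix z assume z: "z \<in> ?Z"
    show "\<bar>dbump l z i x * a l z $ c\<bar> \<le> (3 * 2 ^ l) * S powr (1 / p)"
      unfolding abs_mult using component_le_norm_cart[of "a l z" c] le[OF z] by (intro mult_mono dbump_le) auto
  qed
  also have "\<dots> = real (card ?Z) * ((3 * 2 ^ l) * S powr (1 / p))" by simp
  also have "\<dots> \<le> real (card {z::int^'n. near 1 z (cell l x)}) * ((3 * 2 ^ l) * S powr (1 / p))"
    by (intro mult_right_mono of_nat_mono card_mono card_near_bump) auto
  also have "\<dots> = (3 * 3 ^ CARD('n) * 2 ^ l) * S powr (1 / p)" by (simp add: card_near_bump)
  finally have "\<bar>dlayer E a c i l x\<bar> powr p \<le> ((3 * 3 ^ CARD('n) * 2 ^ l) * S powr (1 / p)) powr p"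
    using assms by (intro powr_mono2) auto
  also have "\<dots> = (3 * 3 ^ CARD('n) * 2 ^ l) powr p * S" using assms S0 by (simp add: powr_mult powr_powr)
  also have "S = (\<Sum>z\<in>cell l ` E. norm (a l z) powr p * indicator {x. near 1 z (cell l x)} x)"
    unfolding S_def using fin by (simp add: sum.inter_restrict indicator_def if_distrib cong: if_cong)
  finally show ?thesis .
qed

lemma near_cell_eq_box:
  "{x :: real^'n::finite. near 1 z (cell l x)} \<subseteq> cbox (\<chi> j. (real_of_int (z $ j) - 1) / 2 ^ l) (\<chi> j. (real_of_int (z $ j) + 2) / 2 ^ l)"
proof
  fix x :: "real^'n" assume "x \<in> {x. near 1 z (cell l x)}"
  then have *: "\<bar>z $ j - cell l x $ j\<bar> \<le> 1" for j by (auto simp: near_def)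
  have "(real_of_int (z $ j) - 1) / 2 ^ l \<le> x $ j \<and> x $ j \<le> (real_of_int (z $ j) + 2) / 2 ^ l" for j
  proof -
    have "\<bar>real_of_int (z $ j) - real_of_int (cell l x $ j)\<bar> \<le> 1"
      using *[of j] by linarith
    then have "real_of_int (z $ j) - 1 \<le> 2 ^ l * x $ j" "2 ^ l * x $ j \<le> real_of_int (z $ j) + 2"
      using cell_bounds[of l x j] by linarith+
    then show ?thesis by (simp add: field_simps)
  qed
  then show "x \<in> cbox (\<chi> j. (real_of_int (z $ j) - 1) / 2 ^ l) (\<chi> j. (real_of_int (z $ j) + 2) / 2 ^ l)"
    by (simp add: mem_box_cart)
qed

text \<open>The factor 2^{lp} from the derivative, the volume (3 / 2^l)^n of a box and the factor
  2^{-l(p-n)} from \<open>admissible\<close> multiply to 3 ^ n. Only \<open>beta l\<close> still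
  depends on the level.\<close>

lemma nn_integral_dlayer:
  fixes a :: "nat \<Rightarrow> int^'n::finite \<Rightarrow> real^'n"
  assumes "bounded E" "real CARD('n) < p" "0 \<le> M" "admissible E p M a"
  shows "(\<integral>\<^sup>+x. ennreal (\<bar>dlayer E a c i l x\<bar> powr p) \<partial>lborel)
    \<le> ennreal ((3 * 3 ^ CARD('n)) powr p * 3 ^ CARD('n) * M * beta l powr p)"
proof -
  let ?n = "real CARD('n)" and ?N = "CARD('n)"
  have p: "0 < p" using assms(2) by (smt (verit) of_nat_0_le_iff)
  have fin: "finite (cell l ` E)" by (rule finite_cell_image[OF assms(1)])
  define K where "K = (3 * 3 ^ ?N * 2 ^ l) powr p"
  define Bx where "Bx z = cbox (\<chi> j. (real_of_int (z $ j) - 1) / 2 ^ l) (\<chi> j. (real_of_int (z $ j) + 2) / 2 ^ l)" for z :: "int^'n"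
  have vol: "emeasure lborel (Bx z) = ennreal ((3 / 2 ^ l) ^ ?N)" for z
  proof -
    have "emeasure lborel (Bx z) = ennreal (measure lborel (Bx z))"
      unfolding Bx_def by (intro emeasure_eq_ennreal_measure) (metis emeasure_bounded_finite bounded_cbox less_irrefl infinity_ennreal_def)
    also have "measure lborel (Bx z) = (\<Prod>j\<in>(UNIV::'n set). (real_of_int (z $ j) + 2) / 2 ^ l - (real_of_int (z $ j) - 1) / 2 ^ l)"
      unfolding Bx_def by (subst content_cbox_cart) (auto simp: divide_right_mono interval_ne_empty_cart)
    also have "\<dots> = (3 / 2 ^ l) ^ ?N" by (simp flip: diff_divide_distrib)
    finally show ?thesis .
  qed
  have "(\<integral>\<^sup>+x. ennreal (\<bar>dlayer E a c i l x\<bar> powr p) \<partial>lborel)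
     \<le> (\<integral>\<^sup>+x. (\<Sum>z\<in>cell l ` E. ennreal (K * norm (a l z) powr p) * indicator (Bx z) x) \<partial>lborel)"
  proof (rule nn_integral_mono)
    fix x
    have "\<bar>dlayer E a c i l x\<bar> powr p \<le> K * (\<Sum>z\<in>cell l ` E. norm (a l z) powr p * indicator {x. near 1 z (cell l x)} x)"
      unfolding K_def by (rule dlayer_powr_le[OF assms(1) p])
    also have "\<dots> \<le> K * (\<Sum>z\<in>cell l ` E. norm (a l z) powr p * indicator (Bx z) x)"
      using near_cell_eq_box[where 'n='n] by (intro mult_left_mono sum_mono) (auto simp: K_def Bx_def indicator_def)
    also have "\<dots> = (\<Sum>z\<in>cell l ` E. (K * norm (a l z) powr p) * indicator (Bx z) x)"
      by (simp add: sum_distrib_left mult.assoc)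
    finally have "ennreal (\<bar>dlayer E a c i l x\<bar> powr p) \<le> ennreal (\<Sum>z\<in>cell l ` E. (K * norm (a l z) powr p) * indicator (Bx z) x)"
      by (rule ennreal_leI)
    also have "\<dots> = (\<Sum>z\<in>cell l ` E. ennreal ((K * norm (a l z) powr p) * indicator (Bx z) x))"
      by (rule sum_ennreal[symmetric]) (simp add: K_def)
    also have "\<dots> = (\<Sum>z\<in>cell l ` E. ennreal (K * norm (a l z) powr p) * indicator (Bx z) x)"
      by (intro sum.cong refl) (auto simp: indicator_def)
    finally show "ennreal (\<bar>dlayer E a c i l x\<bar> powr p) \<le> (\<Sum>z\<in>cell l ` E. ennreal (K * norm (a l z) powr p) * indicator (Bx z) x)" .
  qed
  also have "\<dots> = (\<Sum>z\<in>cell l ` E. \<integral>\<^sup>+x. ennreal (K * norm (a l z) powr p) * indicator (Bx z) x \<partial>lborel)"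
    by (rule nn_integral_sum) (simp add: Bx_def)
  also have "\<dots> = (\<Sum>z\<in>cell l ` E. ennreal (K * norm (a l z) powr p) * ennreal ((3 / 2 ^ l) ^ ?N))"
    by (intro sum.cong refl) (simp add: nn_integral_cmult_indicator Bx_def vol[unfolded Bx_def])
  also have "\<dots> = (\<Sum>z\<in>cell l ` E. ennreal (K * norm (a l z) powr p * (3 / 2 ^ l) ^ ?N))"
    by (intro sum.cong refl ennreal_mult[symmetric]) (auto simp: K_def)
  also have "\<dots> = ennreal (\<Sum>z\<in>cell l ` E. K * norm (a l z) powr p * (3 / 2 ^ l) ^ ?N)"
    by (rule sum_ennreal) (simp add: K_def)
  also have "\<dots> \<le> ennreal ((3 * 3 ^ ?N) powr p * 3 ^ ?N * M * beta l powr p)"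
  proof (rule ennreal_leI)
    have Keq: "K = (3 * 3 ^ ?N) powr p * 2 powr (real l * p)"
      by (simp add: K_def powr_mult powr_powr flip: powr_realpow)
    have Beq: "(3 / 2 ^ l :: real) ^ ?N = 3 ^ ?N * 2 powr - (real l * ?n)"
      by (simp add: power_divide powr_minus field_simps powr_realpow[symmetric] powr_powr[symmetric])
    have "(\<Sum>z\<in>cell l ` E. K * norm (a l z) powr p * (3 / 2 ^ l) ^ ?N) = K * (3 / 2 ^ l) ^ ?N * (\<Sum>z\<in>cell l ` E. norm (a l z) powr p)"
      unfolding sum_distrib_left by (intro sum.cong refl) (simp add: mult_ac)
    also have "\<dots> \<le> K * (3 / 2 ^ l) ^ ?N * (M * beta l powr p * 2 powr - (real l * (p - ?n)))"
      using assms(4) by (intro mult_left_mono) (auto simp: admissible_def K_def)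
    also have "K * (3 / 2 ^ l) ^ ?N * (M * beta l powr p * 2 powr - (real l * (p - ?n)))
      = (3 * 3 ^ ?N) powr p * 3 ^ ?N * M * beta l powr p * (2 powr (real l * p) * 2 powr - (real l * ?n) * 2 powr - (real l * (p - ?n)))"
      unfolding Keq Beq by (simp add: mult_ac)
    also have "2 powr (real l * p) * 2 powr - (real l * ?n) * 2 powr - (real l * (p - ?n)) = 1"
      by (simp add: algebra_simps flip: powr_add)
    finally show "(\<Sum>z\<in>cell l ` E. K * norm (a l z) powr p * (3 / 2 ^ l) ^ ?N) \<le> (3 * 3 ^ ?N) powr p * 3 ^ ?N * M * beta l powr p"
      by simp
  qed
  finally show ?thesis .
qed

text \<open>Cells have side at most 1, so in each coordinate an active bump reaches at most 2 beyond
  some point of \<open>E\<close>, at every level.\<close>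

lemma bump_series_support:
  fixes a :: "nat \<Rightarrow> int^'n::finite \<Rightarrow> real^'n"
  assumes "\<And>x. x \<in> E \<Longrightarrow> norm x \<le> B" "B + 2 * real CARD('n) < norm x"
  shows "bump_series E a x = 0"
proof -
  have "bump l z x = 0" if z: "z \<in> cell l ` E" for l z
  proof (rule bump_eq_0, rule notI)
    assume nr: "near 1 z (cell l x)"
    obtain y where y: "y \<in> E" "z = cell l y" using z by blast
    have l1: "2 powr - real l \<le> 1" using powr_mono[of "- real l" 0 2] by simp
    have "\<bar>y $ j - x $ j\<bar> \<le> 2" for j
      using near_cell_dist[of 1 l y x j] nr l1 by (auto simp: y(2))
    then have "norm (y - x) \<le> (\<Sum>j\<in>(UNIV::'n set). 2)"
      by (intro order_trans[OF norm_le_l1_cart] sum_mono) simp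
    then have "norm x \<le> norm y + 2 * real CARD('n)"
      using norm_triangle_ineq2[of x y] by (simp add: norm_minus_commute)
    then show False using assms y by force
  qed
  then have "layer E a l x = 0" for l by (simp add: layer_def)
  then show ?thesis by (simp add: bump_series_def)
qed

text \<open>Dominated convergence is applied to both sides of the integration by parts for partial
  sums. The series of derivatives need not converge everywhere; it is controlled almost everywhere
  by the integrable sum \<open>h\<close> of the p-th powers of the derivatives divided by
  \<open>gam l\<close>.\<close>

lemma weak_deriv_bump_series:
  fixes a :: "nat \<Rightarrow> int^'n::finite \<Rightarrow> real^'n"
  assumes "bounded E" "real CARD('n) < p" "0 \<le> M" "admissible E p M a"
  shows "\<exists>g\<in>Lp_functions p. weak_partial_deriv i (\<lambda>x. bump_series E a x $ c) g"
proof -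
  let ?n = "real CARD('n)" and ?N = "CARD('n)"
  have p: "0 < p" using assms(2) by (smt (verit) of_nat_0_le_iff)
  have p1: "1 \<le> p"
  proof -
    have "1 \<le> ?n" by simp
    then show ?thesis using assms(2) by linarith
  qed
  define d where "d l x = dlayer E a c i l x" for l x
  define u where "u l x = layer E a l x $ c" for l x
  have dm[measurable]: "d l \<in> borel_measurable borel" for l
    unfolding d_def[abs_def] by (intro borel_measurable_continuous_onI continuous_dlayer)
  define r where "r l x = (\<bar>d l x\<bar> / gam l) powr p" for l x
  have r0: "0 \<le> r l x" for l x by (simp add: r_def)
  have rm[measurable]: "r l \<in> borel_measurable borel" for l unfolding r_def[abs_def] by measurable
  define K where "K = (3 * 3 ^ ?N) powr p * 3 ^ ?N * M"
  have K0: "0 \<le> K" using assms by (simp add: K_def)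
  have r_int: "(\<integral>\<^sup>+x. ennreal (r l x) \<partial>lborel) \<le> ennreal (K * gam l)" for l
  proof -
    have g0: "0 < gam l powr p" using gam_pos[of l] by simp
    have "(\<integral>\<^sup>+x. ennreal (r l x) \<partial>lborel) = (\<integral>\<^sup>+x. ennreal (1 / gam l powr p) * ennreal (\<bar>d l x\<bar> powr p) \<partial>lborel)"
      using g0 gam_pos[of l] by (intro nn_integral_cong) (simp add: r_def powr_divide less_imp_le flip: ennreal_mult)
    also have "\<dots> = ennreal (1 / gam l powr p) * (\<integral>\<^sup>+x. ennreal (\<bar>d l x\<bar> powr p) \<partial>lborel)"
      by (rule nn_integral_cmult) measurable
    also have "\<dots> \<le> ennreal (1 / gam l powr p) * ennreal (K * beta l powr p)"
      unfolding d_def K_def by (intro mult_left_mono nn_integral_dlayer assms) auto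
    also have "\<dots> = ennreal (1 / gam l powr p * (K * beta l powr p))"
      using g0 K0 by (intro ennreal_mult[symmetric]) auto
    also have "1 / gam l powr p * (K * beta l powr p) = K * gam l powr p"
      using g0 gam_pos[of l] by (simp add: beta_eq powr_mult)
    also have "\<dots> \<le> K * gam l"
      using gam_pos[of l] p1 K0 by (intro mult_left_mono) (use powr_mono'[of 1 p "gam l"] in auto)
    finally show ?thesis by (simp add: ennreal_leI)
  qed
  have fin: "(\<integral>\<^sup>+x. (\<Sum>l. ennreal (r l x)) \<partial>lborel) < \<infinity>"
  proof -
    have "(\<integral>\<^sup>+x. (\<Sum>l. ennreal (r l x)) \<partial>lborel) = (\<Sum>l. \<integral>\<^sup>+x. ennreal (r l x) \<partial>lborel)"
      by (rule nn_integral_suminf) measurable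
    also have "\<dots> \<le> (\<Sum>l. ennreal (K * gam l))" by (intro suminf_le r_int) auto
    also have "\<dots> = ennreal (\<Sum>l. K * gam l)"
      using K0 gam_pos by (intro suminf_ennreal2 summable_mult summable_gam) (auto simp: less_imp_le)
    also have "\<dots> < \<infinity>" by simp
    finally show ?thesis .
  qed
  have AE_sum: "AE x in lborel. summable (\<lambda>l. r l x)"
  proof -
    have "AE x in lborel. (\<Sum>l. ennreal (r l x)) \<noteq> \<infinity>"
      by (rule nn_integral_PInf_AE) (use fin in auto)
    then show ?thesis
    proof eventually_elim
      case (elim x)
      then show ?case using r0 by (intro summable_suminf_not_top) auto
    qed
  qed
  define h where "h x = (\<Sum>l. r l x)" for x
  have hm[measurable]: "h \<in> borel_measurable borel" unfolding h_def[abs_def] by measurable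
  have hint: "integrable lborel h"
  proof (rule integrableI_nonneg)
    show "AE x in lborel. 0 \<le> h x"
      using AE_sum by eventually_elim (auto simp: h_def intro: suminf_nonneg r0)
    have "(\<integral>\<^sup>+x. ennreal (h x) \<partial>lborel) = (\<integral>\<^sup>+x. (\<Sum>l. ennreal (r l x)) \<partial>lborel)"
    proof (rule nn_integral_cong_AE)
      show "AE x in lborel. ennreal (h x) = (\<Sum>l. ennreal (r l x))"
        using AE_sum by eventually_elim (auto simp: h_def r0 suminf_ennreal2)
    qed
    then show "(\<integral>\<^sup>+x. ennreal (h x) \<partial>lborel) < \<infinity>" using fin by simp
  qed simp
  define G where "G = suminf gam"
  have G0: "0 \<le> G" unfolding G_def by (intro suminf_nonneg summable_gam) (simp add: gam_pos less_imp_le)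
  \<comment> \<open>On the null set where the series diverges, \<open>g\<close> takes the default
    value of \<open>suminf\<close>; no integral notices this.\<close>
  define g where "g x = (\<Sum>l. d l x)" for x
  have gm[measurable]: "g \<in> borel_measurable borel" unfolding g_def[abs_def] by measurable
  have pt: "summable (\<lambda>l. \<bar>d l x\<bar>)" "(\<Sum>l. \<bar>d l x\<bar>) powr p \<le> G powr p * h x" if "summable (\<lambda>l. r l x)" for x
    using suminf_powr_le[of p gam "\<lambda>l. \<bar>d l x\<bar>"] that p gam_pos summable_gam by (auto simp: r_def G_def h_def)
  have gb: "\<bar>g x\<bar> \<le> (\<Sum>l. \<bar>d l x\<bar>)" if "summable (\<lambda>l. r l x)" for x
    unfolding g_def by (rule summable_rabs[OF pt(1)[OF that]])
  have gLp: "g \<in> Lp_functions p"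
  proof -
    have "integrable lborel (\<lambda>x. \<bar>g x\<bar> powr p)"
    proof (rule Bochner_Integration.integrable_bound)
      show "integrable lborel (\<lambda>x. G powr p * h x)" using hint by simp
      show "AE x in lborel. norm (\<bar>g x\<bar> powr p) \<le> norm (G powr p * h x)"
        using AE_sum
      proof eventually_elim
        case (elim x)
        have "\<bar>g x\<bar> powr p \<le> (\<Sum>l. \<bar>d l x\<bar>) powr p" using gb[OF elim] p by (intro powr_mono2) auto
        also have "\<dots> \<le> G powr p * h x" by (rule pt(2)[OF elim])
        finally show ?case by simp
      qed
    qed measurable
    then have "integrable lebesgue (\<lambda>x. \<bar>g x\<bar> powr p)" by (subst integrable_completion) auto
    moreover have "g \<in> borel_measurable lebesgue" using gm by (auto intro: measurable_completion)
    ultimately show ?thesis by (simp add: Lp_functions_def)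
  qed
  have "weak_partial_deriv i (\<lambda>x. bump_series E a x $ c) g"
    unfolding weak_partial_deriv_def
  proof (intro allI impI)
    fix \<phi> :: "real^'n \<Rightarrow> real" assume \<phi>: "test_function \<phi>"
    note t = test_function_props[OF \<phi>]
    obtain R where R: "\<And>x. R < norm x \<Longrightarrow> \<phi> x = 0 \<and> partial_deriv i \<phi> x = 0" using t(4)[of i] by blast
    have \<phi>i: "integrable lborel \<phi>" by (rule integrable_continuous_support[of _ R]) (use R t in auto)
    have d\<phi>i: "integrable lborel (partial_deriv i \<phi>)" by (rule integrable_continuous_support[of _ R]) (use R t in auto)
    have [measurable]: "\<phi> \<in> borel_measurable borel" "partial_deriv i \<phi> \<in> borel_measurable borel"
      using t by (auto intro: borel_measurable_continuous_onI)
    obtain B where B: "0 \<le> B" "\<And>x. \<bar>\<phi> x\<bar> \<le> B"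
      using bounded_continuous_support[OF t(1), of R] R by blast
    have bcont: "continuous_on UNIV (\<lambda>x. bump_series E a x $ c)"
      by (intro continuous_intros continuous_bump_series[OF assms])
    have [measurable]: "(\<lambda>x. bump_series E a x $ c) \<in> borel_measurable borel"
      by (rule borel_measurable_continuous_onI[OF bcont])
    have ucont: "continuous_on UNIV (\<lambda>x. \<Sum>l<k. u l x)" for k
      unfolding u_def by (intro continuous_intros continuous_layer)
    have dcont: "continuous_on UNIV (\<lambda>x. \<Sum>l<k. d l x)" for k
      unfolding d_def by (intro continuous_intros continuous_dlayer)
    have [measurable]: "u l \<in> borel_measurable borel" for l
      unfolding u_def[abs_def] by (intro borel_measurable_continuous_onI continuous_intros continuous_layer)
    have parts: "(LINT x|lborel. (\<Sum>l<k. u l x) * partial_deriv i \<phi> x) = - (LINT x|lborel. (\<Sum>l<k. d l x) * \<phi> x)" for k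
      by (rule integration_by_parts[OF \<phi> _ ucont dcont])
         (unfold u_def d_def, intro line_deriv_sum line_deriv_layer)
    define U where "U = 3 ^ ?N * M powr (1 / p) * G"
    have uU: "\<bar>\<Sum>l<k. u l x\<bar> \<le> U" for k x
    proof -
      have "\<bar>\<Sum>l<k. u l x\<bar> \<le> (\<Sum>l<k. 3 ^ ?N * M powr (1 / p) * gam l)"
        unfolding u_def
        by (rule order_trans[OF sum_abs], rule sum_mono)
           (rule order_trans[OF component_le_norm_cart norm_layer_admissible(1)[OF assms]])
      also have "\<dots> = 3 ^ ?N * M powr (1 / p) * (\<Sum>l<k. gam l)" by (simp add: sum_distrib_left)
      also have "\<dots> \<le> U" unfolding U_def G_def
        by (intro mult_left_mono sum_le_suminf summable_gam) (auto simp: gam_pos less_imp_le)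
      finally show ?thesis .
    qed
    have L1: "(\<lambda>k. LINT x|lborel. (\<Sum>l<k. u l x) * partial_deriv i \<phi> x) \<longlonglongrightarrow> (LINT x|lborel. bump_series E a x $ c * partial_deriv i \<phi> x)"
    proof (rule integral_dominated_convergence)
      show "integrable lborel (\<lambda>x. U * \<bar>partial_deriv i \<phi> x\<bar>)" using d\<phi>i by simp
      show "AE x in lborel. norm ((\<Sum>l<k. u l x) * partial_deriv i \<phi> x) \<le> U * \<bar>partial_deriv i \<phi> x\<bar>" for k
        using uU by (auto simp: abs_mult intro!: mult_right_mono)
      show "AE x in lborel. (\<lambda>k. (\<Sum>l<k. u l x) * partial_deriv i \<phi> x) \<longlonglongrightarrow> bump_series E a x $ c * partial_deriv i \<phi> x"
      proof (intro AE_I2 tendsto_mult tendsto_const)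
        fix x
        have "(\<lambda>k. (\<Sum>l<k. layer E a l x) $ c) \<longlonglongrightarrow> bump_series E a x $ c"
          unfolding bump_series_def using summable_LIMSEQ[OF summable_layer[OF assms, of x]] by (rule tendsto_vec_nth)
        then show "(\<lambda>k. \<Sum>l<k. u l x) \<longlonglongrightarrow> bump_series E a x $ c" by (simp add: u_def)
      qed
    qed measurable
    have L2: "(\<lambda>k. LINT x|lborel. (\<Sum>l<k. d l x) * \<phi> x) \<longlonglongrightarrow> (LINT x|lborel. g x * \<phi> x)"
    proof (rule integral_dominated_convergence)
      \<comment> \<open>The majorant rests on D \<le> 1 + D powr p. The summand 1 becomes integrable
        through the test function, the other one through \<open>h\<close> and the bound
        \<open>B\<close>.\<close>
      show "integrable lborel (\<lambda>x. \<bar>\<phi> x\<bar> + B * (G powr p * h x))" using \<phi>i hint by simp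
      show "AE x in lborel. norm ((\<Sum>l<k. d l x) * \<phi> x) \<le> \<bar>\<phi> x\<bar> + B * (G powr p * h x)" for k
        using AE_sum
      proof eventually_elim
        case (elim x)
        define D where "D = (\<Sum>l. \<bar>d l x\<bar>)"
        have D0: "0 \<le> D" unfolding D_def by (intro suminf_nonneg pt(1) elim) auto
        have "\<bar>\<Sum>l<k. d l x\<bar> \<le> (\<Sum>l<k. \<bar>d l x\<bar>)" by (rule sum_abs)
        also have "\<dots> \<le> D" unfolding D_def by (intro sum_le_suminf pt(1) elim) auto
        also have "D \<le> 1 + D powr p"
        proof (cases "D \<le> 1")
          case False
          then have "D powr 1 \<le> D powr p" using p1 by (intro powr_mono) auto
          then show ?thesis using False by simp
        qed (simp add: add_increasing2)
        also have "D powr p \<le> G powr p * h x" unfolding D_def by (rule pt(2)[OF elim])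
        finally have le: "\<bar>\<Sum>l<k. d l x\<bar> \<le> 1 + G powr p * h x" by simp
        have h0: "0 \<le> G powr p * h x" using pt(2)[OF elim] by (smt (verit) powr_ge_zero)
        have "norm ((\<Sum>l<k. d l x) * \<phi> x) \<le> (1 + G powr p * h x) * \<bar>\<phi> x\<bar>"
          using le by (simp add: abs_mult mult_right_mono)
        also have "\<dots> \<le> \<bar>\<phi> x\<bar> + B * (G powr p * h x)"
          using mult_right_mono[OF B(2)[of x] h0] by (simp add: algebra_simps)
        finally show ?case .
      qed
      show "AE x in lborel. (\<lambda>k. (\<Sum>l<k. d l x) * \<phi> x) \<longlonglongrightarrow> g x * \<phi> x"
        using AE_sum
      proof eventually_elim
        case (elim x)
        show ?case unfolding g_def
          by (rule tendsto_mult[OF summable_LIMSEQ[OF summable_rabs_cancel[OF pt(1)[OF elim]]] tendsto_const])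
      qed
    qed measurable
    have "(LINT x|lborel. bump_series E a x $ c * partial_deriv i \<phi> x) = - (LINT x|lborel. g x * \<phi> x)"
      using L1 tendsto_minus[OF L2] unfolding parts by (rule LIMSEQ_unique)
    then show "(LINT x|lebesgue. bump_series E a x $ c * partial_deriv i \<phi> x) = - (LINT x|lebesgue. g x * \<phi> x)"
      by (simp add: integral_completion)
  qed
  then show ?thesis using gLp by blast
qed

text \<open>The map itself lies in L^p because it is continuous with bounded support.\<close>

theorem bump_series_sobolev:
  fixes a :: "nat \<Rightarrow> int^'n::finite \<Rightarrow> real^'n"
  assumes "bounded E" "real CARD('n) < p" "0 \<le> M" "admissible E p M a"
  shows "bump_series E a \<in> sobolev_W1_maps p"
proof -
  have p: "0 < p" using assms(2) by (smt (verit) of_nat_0_le_iff)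
  obtain B where B: "\<And>x. x \<in> E \<Longrightarrow> norm x \<le> B" using assms(1) by (auto simp: bounded_iff)
  have "(\<lambda>x. bump_series E a x $ c) \<in> Lp_functions p" for c
  proof -
    have cont: "continuous_on UNIV (\<lambda>x. bump_series E a x $ c)"
      by (intro continuous_intros continuous_bump_series[OF assms])
    have m: "(\<lambda>x. bump_series E a x $ c) \<in> borel_measurable borel"
      by (rule borel_measurable_continuous_onI[OF cont])
    have "integrable lborel (\<lambda>x. \<bar>bump_series E a x $ c\<bar> powr p)"
    proof (rule integrable_continuous_support)
      show "continuous_on UNIV (\<lambda>x. \<bar>bump_series E a x $ c\<bar> powr p)"
        using p by (intro continuous_on_powr' continuous_intros cont) auto
      show "\<bar>bump_series E a x $ c\<bar> powr p = 0" if "B + 2 * real CARD('n) < norm x" for x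
        using bump_series_support[OF B that, where a=a] by simp
    qed
    then have "integrable lebesgue (\<lambda>x. \<bar>bump_series E a x $ c\<bar> powr p)"
      using m by (subst integrable_completion) auto
    moreover have "(\<lambda>x. bump_series E a x $ c) \<in> borel_measurable lebesgue"
      using m by (auto intro: measurable_completion)
    ultimately show ?thesis by (simp add: Lp_functions_def)
  qed
  then show ?thesis
    using weak_deriv_bump_series[OF assms] by (simp add: sobolev_W1_maps_def sobolev_W1_def)
qed

section \<open>Energy estimates for random coefficients\<close>

text \<open>A discrete Riesz energy: the sum of 2^{it} over the scales at which two images are still
  close behaves like the distance to the power -t, cut off at the ends of the window. The slack
  \<open>r\<close> is 3 for partial sums and 1 for the limit map.\<close>

definition energy :: "(real^'n::finite) set \<Rightarrow> (real^'n \<Rightarrow> real) \<Rightarrow> real \<Rightarrow> nat \<Rightarrow> nat \<Rightarrow> real \<Rightarrow>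
    (real^'n \<Rightarrow> real^'n) \<Rightarrow> real" where
  "energy F \<mu> t m m1 r v = (\<Sum>(x, y, i)\<in>F \<times> F \<times> {m..m1}. \<mu> x * \<mu> y * 2 powr (real i * t) *
     of_bool (\<forall>j. \<bar>v x $ j - v y $ j\<bar> \<le> r * 2 powr - real i))"

text \<open>
  Cauchy-Schwarz over the cells of the cover, each point being assigned to one cell.
\<close>

lemma energy_cost:
  fixes v :: "real^'n::finite \<Rightarrow> real^'n"
  assumes "finite F" "F \<subseteq> E" and \<mu>: "\<And>x. x \<in> F \<Longrightarrow> 0 \<le> \<mu> x" "sum \<mu> F = 1"
    and C: "cell_cover \<theta> m (v ` E) C"
  shows "1 \<le> energy F \<mu> t m (top_level \<theta> m) 1 v * cover_cost t C"
proof -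
  define m1 where "m1 = top_level \<theta> m"
  have finC: "finite C" using C by (simp add: cell_cover_def)
  have "\<forall>x\<in>F. \<exists>c\<in>C. cell (fst c) (v x) = snd c"
    using C assms(2) unfolding cell_cover_def by (metis fst_conv image_eqI snd_conv subsetD)
  then obtain c where c: "\<And>x. x \<in> F \<Longrightarrow> c x \<in> C \<and> cell (fst (c x)) (v x) = snd (c x)" by metis
  define \<nu> where "\<nu> d = sum \<mu> {x\<in>F. c x = d}" for d
  define W where "W x y i = \<mu> x * \<mu> y * 2 powr (real i * t)" for x y i
  define P where "P x y i \<longleftrightarrow> (\<forall>j. \<bar>v x $ j - v y $ j\<bar> \<le> 2 powr - real i)" for x y i
  have "1 = (\<Sum>d\<in>C. \<nu> d)"
    unfolding \<nu>_def using sum.group[OF assms(1) finC, of c \<mu>] c \<mu>(2) by auto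
  also have "\<dots> = (\<Sum>d\<in>C. (\<nu> d * 2 powr (real (fst d) * t / 2)) * 2 powr - (real (fst d) * t / 2))"
    by (intro sum.cong refl) (simp add: powr_minus)
  finally have "1\<^sup>2 = (\<Sum>d\<in>C. (\<nu> d * 2 powr (real (fst d) * t / 2)) * 2 powr - (real (fst d) * t / 2))\<^sup>2"
    by simp
  also have "\<dots> \<le> (\<Sum>d\<in>C. (\<nu> d * 2 powr (real (fst d) * t / 2))\<^sup>2) * (\<Sum>d\<in>C. (2 powr - (real (fst d) * t / 2))\<^sup>2)"
    by (rule Cauchy_Schwarz_ineq_sum)
  also have "(\<Sum>d\<in>C. (2 powr - (real (fst d) * t / 2))\<^sup>2) = cover_cost t C"
    unfolding cover_cost_def by (intro sum.cong refl) (auto simp: power2_eq_square mult.commute simp flip: powr_add)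
  also have "(\<Sum>d\<in>C. (\<nu> d * 2 powr (real (fst d) * t / 2))\<^sup>2) = (\<Sum>d\<in>C. \<Sum>x\<in>{x\<in>F. c x = d}. \<Sum>y\<in>{y\<in>F. c y = d}. W x y (fst d))"
  proof (intro sum.cong refl)
    fix d
    have "(\<nu> d * 2 powr (real (fst d) * t / 2))\<^sup>2 = (\<nu> d * \<nu> d) * 2 powr (real (fst d) * t)"
      by (simp add: power2_eq_square mult_ac flip: powr_add)
    also have "\<dots> = (\<Sum>x\<in>{x\<in>F. c x = d}. \<Sum>y\<in>{y\<in>F. c y = d}. W x y (fst d))"
      unfolding \<nu>_def sum_product W_def by (simp add: sum_distrib_right)
    finally show "(\<nu> d * 2 powr (real (fst d) * t / 2))\<^sup>2 = (\<Sum>x\<in>{x\<in>F. c x = d}. \<Sum>y\<in>{y\<in>F. c y = d}. W x y (fst d))" .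
  qed
  also have "\<dots> = (\<Sum>d\<in>C. \<Sum>x\<in>{x\<in>F. c x = d}. \<Sum>y\<in>{y\<in>F. c y = c x}. W x y (fst (c x)))"
    by (intro sum.cong refl) auto
  also have "\<dots> = (\<Sum>x\<in>F. \<Sum>y\<in>{y\<in>F. c y = c x}. W x y (fst (c x)))"
    by (rule sum.group[OF assms(1) finC]) (use c in auto)
  also have "\<dots> \<le> (\<Sum>x\<in>F. \<Sum>y\<in>F. \<Sum>i\<in>{m..m1}. W x y i * of_bool (P x y i))"
  proof (rule sum_mono)
    fix x assume x: "x \<in> F"
    have W0: "0 \<le> W x y i" if "y \<in> F" for y i using \<mu>(1)[OF x] \<mu>(1)[OF that] by (simp add: W_def)
    have "(\<Sum>y\<in>{y\<in>F. c y = c x}. W x y (fst (c x))) \<le> (\<Sum>y\<in>{y\<in>F. c y = c x}. \<Sum>i\<in>{m..m1}. W x y i * of_bool (P x y i))"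
    proof (rule sum_mono)
      fix y assume y: "y \<in> {y\<in>F. c y = c x}"
      let ?i = "fst (c x)"
      have i: "?i \<in> {m..m1}" using c[OF x] C by (auto simp: cell_cover_def m1_def)
      have "cell ?i (v x) = cell ?i (v y)" using c[OF x] c[of y] y by auto
      then have "P x y ?i" unfolding P_def by (intro allI cell_eq_dist)
      then have "W x y ?i = W x y ?i * of_bool (P x y ?i)" by simp
      also have "\<dots> \<le> (\<Sum>i\<in>{m..m1}. W x y i * of_bool (P x y i))"
        using i W0 y by (intro member_le_sum) auto
      finally show "W x y ?i \<le> (\<Sum>i\<in>{m..m1}. W x y i * of_bool (P x y i))" .
    qed
    also have "\<dots> \<le> (\<Sum>y\<in>F. \<Sum>i\<in>{m..m1}. W x y i * of_bool (P x y i))"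
      using assms(1) W0 by (intro sum_mono2 sum_nonneg) auto
    finally show "(\<Sum>y\<in>{y\<in>F. c y = c x}. W x y (fst (c x))) \<le> (\<Sum>y\<in>F. \<Sum>i\<in>{m..m1}. W x y i * of_bool (P x y i))" .
  qed
  also have "\<dots> = (\<Sum>(x, y, i)\<in>F \<times> F \<times> {m..m1}. W x y i * of_bool (P x y i))"
    by (simp only: sum.cartesian_product)
  finally show ?thesis using cover_cost_nonneg[of t C] unfolding W_def P_def m1_def energy_def by (simp add: mult_right_mono)
qed

section \<open>Counting grid vectors that bring two points close together\<close>

lemma card_nat_interval:
  fixes A b r :: real
  assumes "0 < b" "0 < M" "0 \<le> r"
  shows "real (card {k. k < M \<and> \<bar>A + b * (real k / real M)\<bar> \<le> r}) \<le> 2 * r * real M / b + 1"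
proof -
  define lo where "lo = (- r - A) * real M / b"
  define hi where "hi = (r - A) * real M / b"
  let ?S = "{k. k < M \<and> \<bar>A + b * (real k / real M)\<bar> \<le> r}"
  have bM: "0 < b / real M" using assms by simp
  have sub: "int ` ?S \<subseteq> {\<lceil>lo\<rceil>..\<lfloor>hi\<rfloor>}"
  proof (clarsimp simp: ceiling_le_iff le_floor_iff)
    fix k :: nat assume "\<bar>A + b * real k / real M\<bar> \<le> r"
    then have "- r - A \<le> b * real k / real M" "b * real k / real M \<le> r - A" by linarith+
    then show "lo \<le> real k \<and> real k \<le> hi"
      using assms by (simp add: lo_def hi_def field_simps)
  qed
  have "card ?S = card (int ` ?S)" by (rule card_image[symmetric]) simp
  also have "\<dots> \<le> card {\<lceil>lo\<rceil>..\<lfloor>hi\<rfloor>}" by (rule card_mono[OF _ sub]) simp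
  finally have "real (card ?S) \<le> real (nat (\<lfloor>hi\<rfloor> + 1 - \<lceil>lo\<rceil>))" by simp
  also have "\<dots> \<le> hi - lo + 1"
  proof -
    have "lo \<le> hi" unfolding lo_def hi_def using assms by (intro divide_right_mono mult_right_mono) auto
    then show ?thesis by linarith
  qed
  also have "hi - lo = 2 * r * real M / b"
    by (simp add: hi_def lo_def algebra_simps flip: diff_divide_distrib)
  finally show ?thesis .
qed

text \<open>In each coordinate at most 6 r M / b + 1 grid values are bad. The grid is fine enough,
  and b \<le> 1, for the 1 to be at most r M / b, which gives the factor 7.\<close>

lemma card_grid_bad:
  fixes A :: "real^'n::finite"
  assumes "0 < b" "b \<le> 1" "0 < M" "1 \<le> r * real M"
  shows "real (card {v \<in> {v :: nat^'n. \<forall>j. v $ j < M}. \<forall>j. \<bar>A $ j + b * (real (v $ j) / real M)\<bar> \<le> 3 * r})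
    \<le> (7 * r / b) ^ CARD('n) * real (card {v :: nat^'n. \<forall>j. v $ j < M})"
proof -
  have "0 < r * real M" using assms(4) by linarith
  then have r: "0 < r" using assms(3) by (simp add: zero_less_mult_iff)
  let ?S = "\<lambda>j. {k. k < M \<and> \<bar>A $ j + b * (real k / real M)\<bar> \<le> 3 * r}"
  have finS: "finite (?S j)" for j by simp
  have "{v \<in> {v :: nat^'n. \<forall>j. v $ j < M}. \<forall>j. \<bar>A $ j + b * (real (v $ j) / real M)\<bar> \<le> 3 * r} = {v :: nat^'n. \<forall>j. v $ j \<in> ?S j}"
    by auto
  then have "real (card {v \<in> {v :: nat^'n. \<forall>j. v $ j < M}. \<forall>j. \<bar>A $ j + b * (real (v $ j) / real M)\<bar> \<le> 3 * r}) = (\<Prod>j\<in>UNIV. real (card (?S j)))"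
    by (simp only: finite_vec_coords(2)[of ?S, OF finS] of_nat_prod)
  also have "\<dots> \<le> (\<Prod>j\<in>(UNIV::'n set). 7 * r / b * real M)"
  proof (intro prod_mono conjI)
    fix j
    have "real (card (?S j)) \<le> 2 * (3 * r) * real M / b + 1"
      by (rule card_nat_interval) (use assms r in auto)
    also have "1 \<le> r * real M / b" using assms by (simp add: pos_le_divide_eq)
    finally show "real (card (?S j)) \<le> 7 * r / b * real M" by (simp add: field_simps)
  qed simp
  also have "\<dots> = (7 * r / b) ^ CARD('n) * real M ^ CARD('n)"
    by (simp only: prod_constant power_mult_distrib)
  also have "real M ^ CARD('n) = real (card {v :: nat^'n. \<forall>j. v $ j < M})"
    using finite_vec_coords(2)[of "\<lambda>_::'n. {..<M}"] by (simp add: lessThan_def)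
  finally show ?thesis .
qed

text \<open>The mass available to points that are first separated at level \<open>l\<close> from a
  point of the cell \<open>z\<close>, provided they were not separated one level before: by
  \<open>near_cell_Suc\<close> these are 3-near.\<close>

definition nbmass :: "(real^'n::finite) set \<Rightarrow> (real^'n \<Rightarrow> real) \<Rightarrow> nat \<Rightarrow> int^'n \<Rightarrow> real" where
  "nbmass F \<mu> l z = sum \<mu> {y\<in>F. near 3 z (cell l y)}"

lemma nbmass_le:
  fixes F :: "(real^'n::finite) set"
  assumes "finite F" "\<And>w. sum \<mu> {y\<in>F. cell l y = w} \<le> B" and \<mu>: "\<And>x. x \<in> F \<Longrightarrow> 0 \<le> \<mu> x"
  shows "nbmass F \<mu> l z \<le> 7 ^ CARD('n) * B"
proof -
  let ?W = "{w. near 3 z w}"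
  have "nbmass F \<mu> l z = (\<Sum>w\<in>?W. sum \<mu> {y\<in>{y\<in>F. near 3 z (cell l y)}. cell l y = w})"
    unfolding nbmass_def by (rule sum.group[symmetric]) (use assms(1) finite_near in auto)
  also have "\<dots> \<le> (\<Sum>w\<in>?W. B)"
  proof (rule sum_mono)
    fix w assume "w \<in> ?W"
    have "sum \<mu> {y\<in>{y\<in>F. near 3 z (cell l y)}. cell l y = w} \<le> sum \<mu> {y\<in>F. cell l y = w}"
      using assms(1) \<mu> by (intro sum_mono2) auto
    then show "sum \<mu> {y\<in>{y\<in>F. near 3 z (cell l y)}. cell l y = w} \<le> B" using assms(2) order_trans by blast
  qed
  also have "\<dots> = 7 ^ CARD('n) * B" by (simp add: card_near)
  finally show ?thesis .
qed

text \<open>The Frostman bound starts at level \<open>k\<close>; a coarser cell is split into its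
  2^{n(k-l)} subcells of that level.\<close>

lemma coarse_mass_le:
  fixes F :: "(real^'n::finite) set"
  assumes "finite F" "l \<le> k" "\<And>w. sum \<mu> {y\<in>F. cell k y = w} \<le> B" "0 \<le> B" and \<mu>: "\<And>x. x \<in> F \<Longrightarrow> 0 \<le> \<mu> x"
  shows "sum \<mu> {y\<in>F. cell l y = z} \<le> 2 powr (real CARD('n) * (real k - real l)) * B"
proof -
  let ?S = "{y\<in>F. cell l y = z}"
  have "sum \<mu> ?S = (\<Sum>w\<in>cell k ` ?S. sum \<mu> {y\<in>?S. cell k y = w})"
    by (rule sum.image_gen) (use assms(1) in simp)
  also have "\<dots> \<le> (\<Sum>w\<in>cell k ` ?S. B)"
  proof (rule sum_mono)
    fix w
    have "sum \<mu> {y\<in>?S. cell k y = w} \<le> sum \<mu> {y\<in>F. cell k y = w}"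
      using assms(1) \<mu> by (intro sum_mono2) auto
    then show "sum \<mu> {y\<in>?S. cell k y = w} \<le> B" using assms(3) order_trans by blast
  qed
  also have "\<dots> = real (card (cell k ` ?S)) * B" by simp
  also have "\<dots> \<le> real ((2 ^ (k - l)) ^ CARD('n)) * B"
    by (intro mult_right_mono of_nat_mono card_subcells(2) assms)
  also have "real ((2 ^ (k - l)) ^ CARD('n)) = 2 powr (real CARD('n) * (real k - real l))"
    using assms(2) by (simp add: powr_realpow[symmetric] powr_powr[symmetric] of_nat_diff mult.commute[of "real CARD('n)"])
  finally show ?thesis .
qed

text \<open>Bounded overlap: a point is counted for at most 7 ^ n cells.\<close>

lemma sum_nbmass:
  fixes F :: "(real^'n::finite) set"
  assumes "finite F" and \<mu>: "\<And>x. x \<in> F \<Longrightarrow> 0 \<le> \<mu> x" "sum \<mu> F = 1"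
  shows "(\<Sum>z\<in>cell l ` F. nbmass F \<mu> l z) \<le> 7 ^ CARD('n)"
proof -
  have "(\<Sum>z\<in>cell l ` F. nbmass F \<mu> l z) = (\<Sum>y\<in>F. \<Sum>z\<in>{z\<in>cell l ` F. near 3 z (cell l y)}. \<mu> y)"
    unfolding nbmass_def by (rule sum.swap_restrict) (use assms in auto)
  also have "\<dots> = (\<Sum>y\<in>F. real (card {z\<in>cell l ` F. near 3 z (cell l y)}) * \<mu> y)" by simp
  also have "\<dots> \<le> (\<Sum>y\<in>F. 7 ^ CARD('n) * \<mu> y)"
  proof (intro sum_mono mult_right_mono \<mu>)
    fix y
    have "card {z\<in>cell l ` F. near 3 z (cell l y)} \<le> card {z. near 3 (cell l y) z}"
      by (intro card_mono finite_near) (auto simp: near_commute)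
    also have "\<dots> = 7 ^ CARD('n)" by (simp add: card_near)
    finally have "real (card {z\<in>cell l ` F. near 3 z (cell l y)}) \<le> real (7 ^ CARD('n))" by (rule of_nat_mono)
    then show "real (card {z\<in>cell l ` F. near 3 z (cell l y)}) \<le> 7 ^ CARD('n)" by simp
  qed
  also have "\<dots> = 7 ^ CARD('n)" using \<mu>(2) by (simp flip: sum_distrib_left)
  finally show ?thesis .
qed

lemma nbmass_ge_mass:
  assumes "finite F" and \<mu>: "\<And>x. x \<in> F \<Longrightarrow> 0 \<le> \<mu> x"
  shows "sum \<mu> {y\<in>F. cell l y = z} \<le> nbmass F \<mu> l z"
  unfolding nbmass_def using assms by (intro sum_mono2) (auto simp: near_refl)

lemma nbmass_le_1:
  assumes "finite F" and \<mu>: "\<And>x. x \<in> F \<Longrightarrow> 0 \<le> \<mu> x" "sum \<mu> F = 1"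
  shows "nbmass F \<mu> l z \<le> 1"
  unfolding nbmass_def \<mu>(2)[symmetric] using assms by (intro sum_mono2) auto

lemma nbmass_pos:
  assumes "finite F" and \<mu>: "\<And>x. x \<in> F \<Longrightarrow> 0 < \<mu> x" and "x \<in> F"
  shows "0 < nbmass F \<mu> l (cell l x)"
proof -
  have "\<mu> x \<le> nbmass F \<mu> l (cell l x)"
    unfolding nbmass_def using assms by (intro member_le_sum) (auto simp: near_refl less_imp_le)
  then show ?thesis using \<mu>[OF assms(3)] by linarith
qed

text \<open>Grid vectors stand for uniformly distributed ones, so that probabilities become finite
  counts. Keeping \<open>a0\<close> below \<open>J\<close> protects the work of earlier
  stages.\<close>

definition rcoeff :: "(nat \<Rightarrow> int^'n \<Rightarrow> real^'n) \<Rightarrow> nat \<Rightarrow> (nat \<times> (int^'n)) set \<Rightarrow> (nat \<Rightarrow> int^'n \<Rightarrow> real) \<Rightarrow> nat \<Rightarrow>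
    (nat \<times> (int^'n) \<Rightarrow> nat^'n) \<Rightarrow> nat \<Rightarrow> int^'n \<Rightarrow> real^'n::finite" where
  "rcoeff a0 J S h M \<xi> l z = (if l < J then a0 l z else if (l, z) \<in> S
      then (\<chi> j. h l z * (real (\<xi> (l, z) $ j) / real M)) else 0)"

lemma rcoeff_update:
  assumes "c \<in> S" "J \<le> fst c"
  shows "rcoeff a0 J S h M (\<xi>(c := v)) l z = rcoeff a0 J S h M (\<xi>(c := 0)) l z +
     (if (l, z) = c then (\<chi> j. h l z * (real (v $ j) / real M)) else 0)"
  using assms by (auto simp: rcoeff_def vec_eq_iff)

text \<open>The images depend affinely on each grid vector; its value 0 serves as the reference
  point.\<close>

lemma layer_sum_update:
  fixes E :: "(real^'n::finite) set"
  assumes "bounded E" "(l0, z0) \<in> S" "J \<le> l0" "l0 \<le> k1" "z0 \<in> cell l0 ` E"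
  shows "(\<Sum>l\<le>k1. layer E (rcoeff a0 J S h M (\<xi>((l0, z0) := v))) l x) $ j =
     (\<Sum>l\<le>k1. layer E (rcoeff a0 J S h M (\<xi>((l0, z0) := 0))) l x) $ j
       + bump l0 z0 x * (h l0 z0 * (real (v $ j) / real M))"
proof -
  have fin: "finite (cell l ` E)" for l by (rule finite_cell_image[OF assms(1)])
  have lay: "layer E (rcoeff a0 J S h M (\<xi>((l0, z0) := v))) l x $ j =
     layer E (rcoeff a0 J S h M (\<xi>((l0, z0) := 0))) l x $ j +
     (if l = l0 then bump l0 z0 x * (h l0 z0 * (real (v $ j) / real M)) else 0)" for l
  proof -
    have "layer E (rcoeff a0 J S h M (\<xi>((l0, z0) := v))) l x $ j =
        (\<Sum>z\<in>cell l ` E. bump l z x * rcoeff a0 J S h M (\<xi>((l0, z0) := 0)) l z $ j +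
          (if z = z0 then (if l = l0 then bump l z x * (h l0 z0 * (real (v $ j) / real M)) else 0) else 0))"
      unfolding layer_def sum_component
    proof (intro sum.cong refl)
      fix z
      have "rcoeff a0 J S h M (\<xi>((l0, z0) := v)) l z = rcoeff a0 J S h M (\<xi>((l0, z0) := 0)) l z +
         (if (l, z) = (l0, z0) then (\<chi> j. h l z * (real (v $ j) / real M)) else 0)"
        by (rule rcoeff_update) (use assms in auto)
      then show "(bump l z x *\<^sub>R rcoeff a0 J S h M (\<xi>((l0, z0) := v)) l z) $ j =
         bump l z x * rcoeff a0 J S h M (\<xi>((l0, z0) := 0)) l z $ j +
          (if z = z0 then (if l = l0 then bump l z x * (h l0 z0 * (real (v $ j) / real M)) else 0) else 0)"
        by (auto simp: distrib_left)
    qed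
    also have "\<dots> = layer E (rcoeff a0 J S h M (\<xi>((l0, z0) := 0))) l x $ j +
       (if z0 \<in> cell l ` E then (if l = l0 then bump l z0 x * (h l0 z0 * (real (v $ j) / real M)) else 0) else 0)"
      unfolding sum.distrib layer_def sum_component using fin by (simp add: sum.delta)
    finally show ?thesis using assms(5) by auto
  qed
  show ?thesis
    unfolding sum_component lay sum.distrib using assms(4) by (simp add: sum.delta)
qed

section \<open>Separation levels and the expected energy\<close>

definition sep :: "nat \<Rightarrow> nat \<Rightarrow> real^'n \<Rightarrow> real^'n \<Rightarrow> nat \<Rightarrow> bool" where
  "sep J k x y l \<longleftrightarrow> J \<le> l \<and> l \<le> k \<and> \<not> near 1 (cell l x) (cell l y)"

text \<open>At the first level where x and y are separated, the bump of the cell of x is at least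
  2^{-n} at x and vanishes at y. With all other vectors fixed, the difference of the images runs
  through a translated grid of side \<open>b\<close>, and \<open>card_grid_bad\<close> bounds the
  proportion of bad choices.\<close>

lemma random_coefficients:
  fixes E :: "(real^'n::finite) set" and J k1 m m1 :: nat and t :: real
    and h :: "nat \<Rightarrow> int^'n \<Rightarrow> real" and \<mu> :: "real^'n \<Rightarrow> real"
  assumes "bounded E" "finite F" "F \<subseteq> E" and \<mu>: "\<And>x. x \<in> F \<Longrightarrow> 0 \<le> \<mu> x"
    and h: "\<And>l x. x \<in> F \<Longrightarrow> 0 < h l (cell l x) \<and> h l (cell l x) \<le> 1"
  defines "S \<equiv> {(l, z). J \<le> l \<and> l \<le> k1 \<and> z \<in> cell l ` F}"
    and "M \<equiv> 2 ^ m1"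
    and "X \<equiv> \<lambda>l x i. 7 * 2 ^ CARD('n) * 2 powr - real i / h l (cell l x)"
  shows "\<exists>\<xi>. (\<forall>c\<in>S. \<forall>j. \<xi> c $ j < M) \<and>
    energy F \<mu> t m m1 3 (\<lambda>x. \<Sum>l\<le>k1. layer E (rcoeff a0 J S h M \<xi>) l x)
    \<le> (\<Sum>(x, y, i)\<in>F \<times> F \<times> {m..m1}. \<mu> x * \<mu> y * 2 powr (real i * t) *
       (if \<exists>l. sep J k1 x y l then min 1 (X (LEAST l. sep J k1 x y l) x i ^ CARD('n)) else 1))"
proof -
  let ?N = "CARD('n)"
  define w where "w \<xi> x = (\<Sum>l\<le>k1. layer E (rcoeff a0 J S h M \<xi>) l x)" for \<xi> and x :: "real^'n"
  define lv where "lv x y = (LEAST l. sep J k1 x y l)" for x y :: "real^'n"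
  define G where "G = {v :: nat^'n. \<forall>j. v $ j < M}"
  have M0: "0 < M" by (simp add: M_def)
  have finG: "finite G" unfolding G_def using finite_vec_coords(1)[of "\<lambda>_::'n. {..<M}"] by simp
  have "0 \<in> G" using M0 by (simp add: G_def)
  then have Gne: "G \<noteq> {}" by blast
  have "S \<subseteq> Sigma {..k1} (\<lambda>l. cell l ` F)" by (auto simp: S_def)
  then have finS: "finite S" by (rule finite_subset) (use assms(2) in auto)
  define wt where "wt = (\<lambda>(x, y, i). \<mu> x * \<mu> y * 2 powr (real i * t))"
  define bad where "bad = (\<lambda>(x, y, i) \<xi>. \<forall>j. \<bar>w \<xi> x $ j - w \<xi> y $ j\<bar> \<le> 3 * 2 powr - real i)"
  define q where "q = (\<lambda>(x, y, i). if \<exists>l. sep J k1 x y l then min 1 (X (lv x y) x i ^ ?N) else 1)"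
  define crd where "crd = (\<lambda>(x, y, i :: nat). (lv x y, cell (lv x y) x))"
  have "\<exists>\<xi>\<in>PiE S (\<lambda>_. G). (\<Sum>p\<in>F \<times> F \<times> {m..m1}. wt p * of_bool (bad p \<xi>)) \<le> (\<Sum>p\<in>F \<times> F \<times> {m..m1}. wt p * q p)"
  proof (rule averaging_choice[OF finS finG Gne])
    show "finite (F \<times> F \<times> {m..m1})" using assms(2) by simp
    show "0 \<le> wt p" if "p \<in> F \<times> F \<times> {m..m1}" for p using that \<mu> by (auto simp: wt_def)
    fix p assume "p \<in> F \<times> F \<times> {m..m1}"
    then obtain x y i where p: "p = (x, y, i)" and xyi: "x \<in> F" "y \<in> F" "i \<in> {m..m1}" by auto
    show "1 \<le> q p \<or> crd p \<in> S \<and> (\<forall>g\<in>PiE S (\<lambda>_. G). real (card {v \<in> G. bad p (g(crd p := v))}) \<le> q p * real (card G))"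
    proof (cases "1 \<le> q p")
      case False
      then have ex: "\<exists>l. sep J k1 x y l" and qX: "q p = X (lv x y) x i ^ ?N"
        by (auto simp: q_def p min_def split: if_splits)
      define l where "l = lv x y"
      define z where "z = cell l x"
      have "sep J k1 x y l" unfolding l_def lv_def using ex by (rule LeastI_ex)
      then have l: "J \<le> l" "l \<le> k1" "\<not> near 1 z (cell l y)" by (auto simp: sep_def z_def)
      have zS: "(l, z) \<in> S" using l xyi by (auto simp: S_def z_def)
      have zE: "z \<in> cell l ` E" using xyi assms(3) by (auto simp: z_def)
      have c: "crd p = (l, z)" by (simp add: crd_def p l_def z_def)
      define b where "b = bump l z x * h l z"
      have b: "(1 / 2) ^ ?N * h l z \<le> b" "b \<le> 1" "0 < h l z"
      proof -
        show hz: "0 < h l z" using h[OF xyi(1)] by (simp add: z_def)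
        show "(1 / 2) ^ ?N * h l z \<le> b"
          unfolding b_def using hz bump_cell_ge[of l x] by (intro mult_right_mono) (auto simp: z_def)
        have "b \<le> 1 * 1" unfolding b_def using hz h[OF xyi(1), of l] bump_bounds[of l z x]
          by (intro mult_mono) (auto simp: z_def)
        then show "b \<le> 1" by simp
      qed
      have "0 < (1 / 2) ^ ?N * h l z" using b(3) by simp
      then have b0: "0 < b" using b(1) by linarith
      have "real (card {v \<in> G. bad p (g(crd p := v))}) \<le> q p * real (card G)" for g
      proof -
        define A where "A = w (g((l, z) := 0)) x - w (g((l, z) := 0)) y"
        have diff: "w (g((l, z) := v)) x $ j - w (g((l, z) := v)) y $ j = A $ j + b * (real (v $ j) / real M)" for v j
        proof -
          have upd: "w (g((l, z) := v)) u $ j = w (g((l, z) := 0)) u $ j + bump l z u * (h l z * (real (v $ j) / real M))" for u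
            unfolding w_def by (rule layer_sum_update[OF assms(1) zS l(1,2) zE])
          show ?thesis
            using upd[of x] upd[of y] bump_eq_0[OF l(3)] by (simp add: A_def b_def)
        qed
        have "{v \<in> G. bad p (g(crd p := v))} = {v \<in> {v :: nat^'n. \<forall>j. v $ j < M}. \<forall>j. \<bar>A $ j + b * (real (v $ j) / real M)\<bar> \<le> 3 * 2 powr - real i}"
          by (simp add: bad_def p c[unfolded p] diff G_def)
        also have "real (card \<dots>) \<le> (7 * 2 powr - real i / b) ^ ?N * real (card {v :: nat^'n. \<forall>j. v $ j < M})"
        proof (rule card_grid_bad[OF b0 b(2) M0])
          \<comment> \<open>The grid with \<open>M\<close> = 2 ^ m1 steps resolves every scale of
            the energy, since i \<le> m1.\<close>
          have "2 powr 0 \<le> 2 powr (real m1 - real i)" using xyi by (intro powr_mono) auto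
          then show "1 \<le> 2 powr - real i * real M"
            by (simp add: M_def powr_diff powr_minus powr_realpow field_simps)
        qed
        also have "\<dots> \<le> X l x i ^ ?N * real (card G)"
          unfolding G_def
        proof (intro mult_right_mono power_mono)
          have "7 * 2 powr - real i / b \<le> 7 * 2 powr - real i / ((1 / 2) ^ ?N * h l z)"
            using b b0 by (intro divide_left_mono) auto
          also have "\<dots> = X l x i" by (simp add: X_def z_def power_one_over field_simps)
          finally show "7 * 2 powr - real i / b \<le> X l x i" .
        qed (use b0 in auto)
        finally show ?thesis unfolding qX l_def .
      qed
      then show ?thesis using c zS by simp
    qed simp
  qed
  then obtain \<xi> where \<xi>: "\<xi> \<in> PiE S (\<lambda>_. G)" 
    "(\<Sum>p\<in>F \<times> F \<times> {m..m1}. wt p * of_bool (bad p \<xi>)) \<le> (\<Sum>p\<in>F \<times> F \<times> {m..m1}. wt p * q p)" by blast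
  have "\<forall>c\<in>S. \<forall>j. \<xi> c $ j < M" using \<xi>(1) by (auto simp: PiE_def Pi_def G_def)
  then show ?thesis
    using \<xi>(2) unfolding wt_def bad_def q_def w_def lv_def energy_def by (intro exI[of _ \<xi>]) (simp add: case_prod_beta)
qed

text \<open>The three terms stand for pairs not separated up to \<open>k1\<close>, pairs first
  separated after level \<open>J\<close>, and pairs already separated at \<open>J\<close>. In the
  first two cases the points are 3-near at the level concerned; in the last one nothing is known
  about their distance.\<close>

lemma sep_prob_le:
  fixes x y :: "real^'n::finite" and X :: "nat \<Rightarrow> real"
  assumes "J \<le> k1" and X: "\<And>l. 0 \<le> X l"
  shows "(if \<exists>l. sep J k1 x y l then min 1 (X (LEAST l. sep J k1 x y l)) else 1)
    \<le> of_bool (near 3 (cell k1 x) (cell k1 y)) +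
       (\<Sum>l\<in>{J<..k1}. of_bool (near 3 (cell l x) (cell l y)) * min 1 (X l)) + X J"
proof -
  define T where "T = (\<Sum>l\<in>{J<..k1}. of_bool (near 3 (cell l x) (cell l y)) * min 1 (X l))"
  have s0: "0 \<le> T"
    unfolding T_def using X by (intro sum_nonneg) auto
  have "(if \<exists>l. sep J k1 x y l then min 1 (X (LEAST l. sep J k1 x y l)) else 1)
    \<le> of_bool (near 3 (cell k1 x) (cell k1 y)) + T + X J"
  proof (cases "\<exists>l. sep J k1 x y l")
    case False
    then have "near 1 (cell k1 x) (cell k1 y)" using assms(1) by (auto simp: sep_def)
    then have "near 3 (cell k1 x) (cell k1 y)" by (rule near_mono) simp
    then show ?thesis using False s0 X[of J] by simp
  next
    case True
    define l where "l = (LEAST l. sep J k1 x y l)"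
    have l: "sep J k1 x y l" unfolding l_def using True by (rule LeastI_ex)
    show ?thesis
    proof (cases "l = J")
      case True
      then show ?thesis using \<open>\<exists>l. sep J k1 x y l\<close> s0 unfolding l_def[symmetric] by (simp add: min_def)
    next
      case False
      then obtain l' where l': "l = Suc l'" "J \<le> l'" using l by (cases l) (auto simp: sep_def)
      have "\<not> sep J k1 x y l'" using not_less_Least[of l' "sep J k1 x y"] l' unfolding l_def by simp
      then have "near 1 (cell l' x) (cell l' y)" using l l' by (auto simp: sep_def)
      then have "near 3 (cell l x) (cell l y)" unfolding l' by (rule near_cell_Suc)
      then have "min 1 (X l) = of_bool (near 3 (cell l x) (cell l y)) * min 1 (X l)" by simp
      also have "\<dots> \<le> T"
        unfolding T_def using l l' X by (intro member_le_sum) (auto simp: sep_def)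
      finally show ?thesis using \<open>\<exists>l. sep J k1 x y l\<close> X[of J] unfolding l_def[symmetric] by simp
    qed
  qed
  then show ?thesis unfolding T_def .
qed

text \<open>Summation over y turns the indicators of nearness into \<open>nbmass\<close>. The term
  for level \<open>J\<close> carries no such indicator, so it keeps its average over x.\<close>

lemma expected_energy_le:
  fixes F :: "(real^'n::finite) set" and \<mu> :: "real^'n \<Rightarrow> real" and X :: "nat \<Rightarrow> real^'n \<Rightarrow> nat \<Rightarrow> real"
  assumes "finite F" "J \<le> k1" and \<mu>: "\<And>x. x \<in> F \<Longrightarrow> 0 \<le> \<mu> x" "sum \<mu> F = 1"
    and X: "\<And>l x i. 0 \<le> X l x i"
    and b1: "\<And>x i. x \<in> F \<Longrightarrow> i \<in> {m..m1} \<Longrightarrow> 2 powr (real i * t) * nbmass F \<mu> k1 (cell k1 x) \<le> A1"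
    and b2: "\<And>x i l. x \<in> F \<Longrightarrow> i \<in> {m..m1} \<Longrightarrow> l \<le> k1 \<Longrightarrow>
        2 powr (real i * t) * (nbmass F \<mu> l (cell l x) * min 1 (X l x i)) \<le> A2"
    and b3: "\<And>i. i \<in> {m..m1} \<Longrightarrow> 2 powr (real i * t) * (\<Sum>x\<in>F. \<mu> x * X J x i) \<le> A3"
    and A: "0 \<le> A1" "0 \<le> A2" "0 \<le> A3"
  shows "(\<Sum>(x, y, i)\<in>F \<times> F \<times> {m..m1}. \<mu> x * \<mu> y * 2 powr (real i * t) *
       (if \<exists>l. sep J k1 x y l then min 1 (X (LEAST l. sep J k1 x y l) x i) else 1))
    \<le> (real m1 + 1) * (A1 + real k1 * A2 + A3)"
proof -
  define q where "q x y i = (if \<exists>l. sep J k1 x y l then min 1 (X (LEAST l. sep J k1 x y l) x i) else 1)" for x y i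
  have nb: "(\<Sum>y\<in>F. \<mu> y * of_bool (near 3 (cell l x) (cell l y))) = nbmass F \<mu> l (cell l x)" for l x
    unfolding nbmass_def using assms(1) by (simp add: Int_def)
  have "(\<Sum>(x, y, i)\<in>F \<times> F \<times> {m..m1}. \<mu> x * \<mu> y * 2 powr (real i * t) * q x y i)
     = (\<Sum>x\<in>F. \<Sum>y\<in>F. \<Sum>i\<in>{m..m1}. \<mu> x * \<mu> y * 2 powr (real i * t) * q x y i)"
    by (simp only: sum.cartesian_product)
  also have "\<dots> = (\<Sum>i\<in>{m..m1}. \<Sum>x\<in>F. \<Sum>y\<in>F. \<mu> x * \<mu> y * 2 powr (real i * t) * q x y i)"
    by (subst sum.swap[of _ F "{m..m1}"], subst sum.swap[of _ F "{m..m1}"]) (rule refl)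
  also have "\<dots> \<le> (\<Sum>i\<in>{m..m1}. A1 + real k1 * A2 + A3)"
  proof (rule sum_mono)
    fix i assume i: "i \<in> {m..m1}"
    have "(\<Sum>x\<in>F. \<Sum>y\<in>F. \<mu> x * \<mu> y * 2 powr (real i * t) * q x y i)
      \<le> (\<Sum>x\<in>F. \<mu> x * (A1 + real k1 * A2) + 2 powr (real i * t) * (\<mu> x * X J x i))"
    proof (rule sum_mono)
      fix x assume x: "x \<in> F"
      have "(\<Sum>y\<in>F. \<mu> x * \<mu> y * 2 powr (real i * t) * q x y i) \<le> (\<Sum>y\<in>F. \<mu> x * \<mu> y * 2 powr (real i * t) *
          (of_bool (near 3 (cell k1 x) (cell k1 y)) +
             (\<Sum>l\<in>{J<..k1}. of_bool (near 3 (cell l x) (cell l y)) * min 1 (X l x i)) + X J x i))"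
        unfolding q_def using \<mu> x by (intro sum_mono mult_left_mono sep_prob_le assms) auto
      also have "\<dots> = \<mu> x * (2 powr (real i * t) * (\<Sum>y\<in>F. \<mu> y * of_bool (near 3 (cell k1 x) (cell k1 y)))
           + (\<Sum>l\<in>{J<..k1}. 2 powr (real i * t) * ((\<Sum>y\<in>F. \<mu> y * of_bool (near 3 (cell l x) (cell l y))) * min 1 (X l x i)))
           + 2 powr (real i * t) * (sum \<mu> F * X J x i))"
      proof -
        have "(\<Sum>y\<in>F. \<mu> y * (\<Sum>l\<in>{J<..k1}. of_bool (near 3 (cell l x) (cell l y)) * min 1 (X l x i)))
          = (\<Sum>l\<in>{J<..k1}. (\<Sum>y\<in>F. \<mu> y * of_bool (near 3 (cell l x) (cell l y))) * min 1 (X l x i))"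
          unfolding sum_distrib_left sum_distrib_right by (subst sum.swap) (simp add: mult_ac)
        then have "(\<Sum>y\<in>F. \<mu> y * (of_bool (near 3 (cell k1 x) (cell k1 y)) +
             (\<Sum>l\<in>{J<..k1}. of_bool (near 3 (cell l x) (cell l y)) * min 1 (X l x i)) + X J x i))
          = (\<Sum>y\<in>F. \<mu> y * of_bool (near 3 (cell k1 x) (cell k1 y))) +
            (\<Sum>l\<in>{J<..k1}. (\<Sum>y\<in>F. \<mu> y * of_bool (near 3 (cell l x) (cell l y))) * min 1 (X l x i)) + sum \<mu> F * X J x i"
          by (simp only: distrib_left sum.distrib sum_distrib_right)
        then have "\<mu> x * 2 powr (real i * t) * (\<Sum>y\<in>F. \<mu> y * (of_bool (near 3 (cell k1 x) (cell k1 y)) +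
             (\<Sum>l\<in>{J<..k1}. of_bool (near 3 (cell l x) (cell l y)) * min 1 (X l x i)) + X J x i))
          = \<mu> x * (2 powr (real i * t) * (\<Sum>y\<in>F. \<mu> y * of_bool (near 3 (cell k1 x) (cell k1 y)))
           + 2 powr (real i * t) * (\<Sum>l\<in>{J<..k1}. (\<Sum>y\<in>F. \<mu> y * of_bool (near 3 (cell l x) (cell l y))) * min 1 (X l x i))
           + 2 powr (real i * t) * (sum \<mu> F * X J x i))"
          by (simp only: mult.assoc distrib_left)
        moreover have "(\<Sum>y\<in>F. \<mu> x * \<mu> y * 2 powr (real i * t) * c y) = \<mu> x * 2 powr (real i * t) * (\<Sum>y\<in>F. \<mu> y * c y)" for c
          unfolding sum_distrib_left by (intro sum.cong refl) (simp add: mult_ac)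
        ultimately show ?thesis by (simp only: sum_distrib_left)
      qed
      also have "\<dots> \<le> \<mu> x * (A1 + (\<Sum>l\<in>{J<..k1}. A2) + 2 powr (real i * t) * X J x i)"
        unfolding nb \<mu>(2) using b1[OF x i] b2[OF x i] \<mu>(1)[OF x]
        by (intro mult_left_mono add_mono sum_mono) auto
      also have "\<dots> \<le> \<mu> x * (A1 + real k1 * A2) + 2 powr (real i * t) * (\<mu> x * X J x i)"
      proof -
        have "real (card {J<..k1}) * A2 \<le> real k1 * A2" using A by (intro mult_right_mono) auto
        then have "\<mu> x * (A1 + real (card {J<..k1}) * A2) \<le> \<mu> x * (A1 + real k1 * A2)"
          using \<mu>(1)[OF x] by (intro mult_left_mono) auto
        then show ?thesis by (simp add: distrib_left mult_ac)
      qed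
      finally show "(\<Sum>y\<in>F. \<mu> x * \<mu> y * 2 powr (real i * t) * q x y i) \<le> \<mu> x * (A1 + real k1 * A2) + 2 powr (real i * t) * (\<mu> x * X J x i)" .
    qed
    also have "\<dots> = (A1 + real k1 * A2) + 2 powr (real i * t) * (\<Sum>x\<in>F. \<mu> x * X J x i)"
      unfolding sum.distrib sum_distrib_right[symmetric] sum_distrib_left[symmetric] \<mu>(2) by simp
    also have "\<dots> \<le> (A1 + real k1 * A2) + A3" using b3[OF i] by simp
    finally show "(\<Sum>x\<in>F. \<Sum>y\<in>F. \<mu> x * \<mu> y * 2 powr (real i * t) * q x y i) \<le> A1 + real k1 * A2 + A3" by simp
  qed
  also have "\<dots> = real (card {m..m1}) * (A1 + real k1 * A2 + A3)" by simp
  also have "\<dots> \<le> (real m1 + 1) * (A1 + real k1 * A2 + A3)"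
    using A by (intro mult_right_mono) auto
  finally show ?thesis unfolding q_def .
qed

text \<open>Since t < N, min 1 (r ^ N) is at most r powr t, which cancels 2 powr (i * t) and leaves
  the mass to the power 1 - t / p. The Frostman bound then produces the exponent \<omega>, which is
  positive exactly when t < p s / (p - N + s).\<close>

lemma fine_term_le:
  fixes p s t M b c :: real and N :: nat
  assumes "0 < t" "t < real N" "real N < p" "0 < s" "0 < M" "0 < b" "b \<le> 1" "1 \<le> c"
    and M: "M \<le> 7 ^ N * 2 powr - (real l * s)"
    and \<omega>: "\<omega> = s - (p - real N + s) / p * t"
  shows "2 powr (real i * t) * (M * min 1 ((c * 2 powr - real i / (b * (2 powr - (real l * (p - real N)) * M) powr (1 / p))) ^ N))
    \<le> c ^ N * 7 ^ N / b ^ N * 2 powr - (real l * \<omega>)"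
proof -
  have p: "0 < p" "t < p" using assms by auto
  define u where "u = 1 - t / p"
  have u: "0 < u" "u \<le> 1" using p assms by (auto simp: u_def)
  define hh where "hh = b * (2 powr - (real l * (p - real N)) * M) powr (1 / p)"
  have hh: "hh = b * (2 powr - (real l * ((p - real N) / p)) * M powr (1 / p))"
    using assms by (simp add: hh_def powr_mult powr_powr)
  have hh0: "0 < hh" using assms by (simp add: hh)
  define r where "r = c * 2 powr - real i / hh"
  have r0: "0 < r" using hh0 assms by (simp add: r_def)
  have "min 1 (r ^ N) \<le> r powr t"
  proof (cases "r \<le> 1")
    case True
    have "r ^ N = r powr real N" using r0 by (simp add: powr_realpow)
    also have "\<dots> \<le> r powr t" using True r0 assms by (intro powr_mono') auto
    finally show ?thesis by simp
  next
    case False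
    then have "1 \<le> r powr t" using assms by (intro ge_one_powr_ge_zero) auto
    then show ?thesis by simp
  qed
  then have "2 powr (real i * t) * (M * min 1 (r ^ N)) \<le> 2 powr (real i * t) * (M * r powr t)"
    using assms by (intro mult_left_mono) auto
  also have "r powr t = c powr t * 2 powr - (real i * t) * b powr - t * 2 powr (real l * ((p - real N) / p) * t) * M powr - (t / p)"
    unfolding r_def hh using assms
    by (simp add: powr_divide powr_mult powr_powr powr_minus field_simps)
  also have "2 powr (real i * t) * (M * (c powr t * 2 powr - (real i * t) * b powr - t * 2 powr (real l * ((p - real N) / p) * t) * M powr - (t / p)))
     = c powr t * b powr - t * (2 powr (real l * ((p - real N) / p) * t) * (M * M powr - (t / p)))"
    by (simp add: powr_minus)
  also have "M * M powr - (t / p) = M powr u"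
    using powr_add[of M 1 "- (t / p)"] assms by (simp add: u_def)
  also have "c powr t * b powr - t * (2 powr (real l * ((p - real N) / p) * t) * M powr u)
     \<le> c ^ N * (1 / b ^ N) * (2 powr (real l * ((p - real N) / p) * t) * (7 ^ N * 2 powr - (real l * s * u)))"
  proof (intro mult_mono mult_left_mono)
    show "c powr t \<le> c ^ N" using assms powr_mono[of t "real N" c] by (simp add: powr_realpow)
    have "b powr - t \<le> b powr - real N" using assms by (intro powr_mono') auto
    then show "b powr - t \<le> 1 / b ^ N" using assms by (simp add: powr_minus powr_realpow inverse_eq_divide)
    have "M powr u \<le> (7 ^ N * 2 powr - (real l * s)) powr u" using assms u by (intro powr_mono2) auto
    also have "\<dots> = (7 ^ N) powr u * 2 powr - (real l * s * u)" by (simp add: powr_mult powr_powr)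
    also have "\<dots> \<le> (7 ^ N) powr 1 * 2 powr - (real l * s * u)"
      using u by (intro mult_right_mono powr_mono) auto
    finally show "M powr u \<le> 7 ^ N * 2 powr - (real l * s * u)" by simp
  qed (use assms in auto)
  also have "\<dots> = c ^ N * 7 ^ N / b ^ N * (2 powr (real l * ((p - real N) / p) * t) * 2 powr - (real l * s * u))"
    by simp
  also have "2 powr (real l * ((p - real N) / p) * t) * 2 powr - (real l * s * u) = 2 powr - (real l * \<omega>)"
  proof -
    have "real l * ((p - real N) / p) * t + - (real l * s * u) = - (real l * \<omega>)"
      using p by (simp add: u_def \<omega> field_simps)
    then show ?thesis by (simp flip: powr_add)
  qed
  finally show ?thesis unfolding r_def hh_def .
qed

text \<open>At levels coarser than \<open>k\<close> the full power r ^ N is used. The powers of 2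
  that depend on \<open>l\<close> cancel, and i \<ge> \<alpha> k - 1 with \<alpha> = (p - N + s) / p
  leaves the same decay 2 powr - (k * \<omega>) for every such level.\<close>

lemma coarse_term_le:
  fixes p s t M b c :: real and N :: nat
  assumes "0 < t" "t < real N" "real N < p" "0 < s" "s \<le> real N" "0 < M" "0 < b" "b \<le> 1" "1 \<le> c"
    and M: "M \<le> 7 ^ N * (2 powr (real N * (real k - real l)) * 2 powr - (real k * s))"
    and \<omega>: "\<omega> = s - (p - real N + s) / p * t"
    and i: "(p - real N + s) / p * real k \<le> real i + 1"
  shows "2 powr (real i * t) * (M * min 1 ((c * 2 powr - real i / (b * (2 powr - (real l * (p - real N)) * M) powr (1 / p))) ^ N))
    \<le> 2 ^ N * c ^ N * 7 ^ N / b ^ N * 2 powr - (real k * \<omega>)"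
proof -
  have p: "0 < p" using assms by auto
  define u where "u = (p - real N) / p"
  have u: "0 < u" "u \<le> 1" using p assms by (auto simp: u_def)
  have u': "1 - real N / p = u" using p by (simp add: u_def field_simps)
  define hh where "hh = b * (2 powr - (real l * (p - real N)) * M) powr (1 / p)"
  have hh: "hh = b * (2 powr - (real l * u) * M powr (1 / p))"
    using assms by (simp add: hh_def powr_mult powr_powr u_def)
  have hh0: "0 < hh" using assms by (simp add: hh)
  define r where "r = c * 2 powr - real i / hh"
  have r0: "0 < r" using hh0 assms by (simp add: r_def)
  have rN: "r ^ N = c ^ N * 2 powr - (real i * real N) * (1 / b ^ N) * 2 powr (real l * u * real N) * M powr - (real N / p)"
  proof -
  have "r ^ N = r powr real N" using r0 by (simp add: powr_realpow)
  also have "\<dots> = c ^ N * 2 powr - (real i * real N) * (1 / b ^ N) * 2 powr (real l * u * real N) * M powr - (real N / p)"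
  proof -
    have cN: "c powr real N = c ^ N" "b powr real N = b ^ N" using assms by (simp_all add: powr_realpow)
    show ?thesis
      unfolding r_def hh using assms(6,7,9)
      by (simp add: powr_divide powr_mult powr_powr powr_minus field_simps cN)
  qed
  finally show ?thesis .
  qed
  have "2 powr (real i * t) * (M * min 1 (r ^ N)) \<le> 2 powr (real i * t) * (M * r ^ N)"
    using assms by (intro mult_left_mono) auto
  also have "2 powr (real i * t) * (M * r ^ N)
     = c ^ N * (1 / b ^ N) * ((2 powr (real i * t) * 2 powr - (real i * real N)) * (2 powr (real l * u * real N) * (M * M powr - (real N / p))))"
    unfolding rN by simp
  also have "M * M powr - (real N / p) = M powr u"
    using powr_add[of M 1 "- (real N / p)"] assms u' by simp
  also have "c ^ N * (1 / b ^ N) * ((2 powr (real i * t) * 2 powr - (real i * real N)) * (2 powr (real l * u * real N) * M powr u))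
    \<le> c ^ N * (1 / b ^ N) * ((2 ^ N * 2 powr - ((p - real N + s) / p * real k * (real N - t))) *
        (2 powr (real l * u * real N) * (7 ^ N * 2 powr ((real N * (real k - real l) - real k * s) * u))))"
  proof (rule mult_left_mono[OF mult_mono[OF _ mult_left_mono]])
    have "2 powr (real i * t) * 2 powr - (real i * real N) = 2 powr - (real i * (real N - t))"
      by (simp add: algebra_simps flip: powr_add)
    also have "\<dots> \<le> 2 powr (real N - (p - real N + s) / p * real k * (real N - t))"
    proof -
      have "((p - real N + s) / p * real k) * (real N - t) \<le> (real i + 1) * (real N - t)"
        using i assms by (intro mult_right_mono) auto
      then show ?thesis using assms by (simp add: algebra_simps)
    qed
    also have "\<dots> = 2 ^ N * 2 powr - ((p - real N + s) / p * real k * (real N - t))"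
      by (simp add: powr_diff powr_minus powr_realpow field_simps)
    finally show "2 powr (real i * t) * 2 powr - (real i * real N) \<le> 2 ^ N * 2 powr - ((p - real N + s) / p * real k * (real N - t))" .
    have "M powr u \<le> (7 ^ N * (2 powr (real N * (real k - real l)) * 2 powr - (real k * s))) powr u"
      using assms u by (intro powr_mono2) auto
    also have "2 powr (real N * (real k - real l)) * 2 powr - (real k * s) = 2 powr (real N * (real k - real l) - real k * s)"
      by (simp add: powr_diff powr_minus divide_inverse)
    also have "(7 ^ N * 2 powr (real N * (real k - real l) - real k * s)) powr u
        = (7 ^ N) powr u * 2 powr ((real N * (real k - real l) - real k * s) * u)"
      by (simp add: powr_mult powr_powr)
    also have "\<dots> \<le> (7 ^ N) powr 1 * 2 powr ((real N * (real k - real l) - real k * s) * u)"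
      using u by (intro mult_right_mono powr_mono) auto
    finally show "M powr u \<le> 7 ^ N * 2 powr ((real N * (real k - real l) - real k * s) * u)" by simp
  qed (use assms in auto)
  also have "\<dots> = 2 ^ N * c ^ N * 7 ^ N / b ^ N * (2 powr - ((p - real N + s) / p * real k * (real N - t)) *
     (2 powr (real l * u * real N) * 2 powr ((real N * (real k - real l) - real k * s) * u)))"
    by simp
  also have "2 powr - ((p - real N + s) / p * real k * (real N - t)) *
     (2 powr (real l * u * real N) * 2 powr ((real N * (real k - real l) - real k * s) * u)) = 2 powr - (real k * \<omega>)"
  proof -
    have "- ((p - real N + s) / p * real k * (real N - t)) + (real l * u * real N + (real N * (real k - real l) - real k * s) * u) = - (real k * \<omega>)"
      using p by (simp add: u_def \<omega> field_simps)
    then show ?thesis by (simp flip: powr_add)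
  qed
  finally show ?thesis unfolding r_def hh_def .
qed

text \<open>Pairs separated already at \<open>J\<close> may be far apart, so no small mass is
  gained. Instead each cell of level \<open>J\<close> with mass \<nu> contributes at most \<nu> powr
  (1 - N / p) \<le> 1, by N < p, and the number of these cells does not depend on the scale. The
  decay comes from t < N.\<close>

lemma base_term_le:
  fixes F :: "(real^'n::finite) set" and p t b c :: real
  defines "N \<equiv> CARD('n)"
  assumes "finite F" and \<mu>: "\<And>x. x \<in> F \<Longrightarrow> 0 < \<mu> x" "sum \<mu> F = 1"
    and "0 < t" "t < real N" "real N < p" "0 < b" "0 < c" "q \<le> real i + 1"
  shows "2 powr (real i * t) * (\<Sum>x\<in>F. \<mu> x * (c * 2 powr - real i / (b * (2 powr - (real J * (p - real N)) * nbmass F \<mu> J (cell J x)) powr (1 / p))) ^ N)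
    \<le> c ^ N / b ^ N * 2 powr (real J * real N) * real (card (cell J ` F)) * 2 ^ N * 2 powr - (q * (real N - t))"
proof -
  have p: "0 < p" using assms by auto
  have \<mu>0: "\<And>x. x \<in> F \<Longrightarrow> 0 \<le> \<mu> x" using \<mu>(1) less_imp_le by blast
  define u where "u = (p - real N) / p"
  define nb where "nb x = nbmass F \<mu> J (cell J x)" for x
  have nb0: "0 < nb x" if "x \<in> F" for x unfolding nb_def by (rule nbmass_pos[OF assms(2) \<mu>(1) that])
  define T where "T = 2 powr (real i * t)"
  have trm: "(c * 2 powr - real i / (b * (2 powr - (real J * (p - real N)) * nb x) powr (1 / p))) ^ N
     \<le> c ^ N / b ^ N * 2 powr (real J * real N) * 2 powr - (real i * real N) * nb x powr - (real N / p)" if x: "x \<in> F" for x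
  proof -
    note n0 = nb0[OF x]
    have "(c * 2 powr - real i / (b * (2 powr - (real J * (p - real N)) * nb x) powr (1 / p))) ^ N
       = (c * 2 powr - real i / (b * (2 powr - (real J * (p - real N)) * nb x) powr (1 / p))) powr real N"
      using n0 assms by (simp add: powr_realpow)
    also have "(c * 2 powr - real i / (b * (2 powr - (real J * (p - real N)) * nb x) powr (1 / p))) powr real N
       = (c * 2 powr - real i / (b * (2 powr - (real J * u) * nb x powr (1 / p)))) powr real N"
    proof -
      have "(2 powr - (real J * (p - real N)) * nb x) powr (1 / p) = 2 powr - (real J * u) * nb x powr (1 / p)"
        using n0 by (simp add: powr_mult powr_powr u_def)
      then show ?thesis by simp
    qed
    also have "(c * 2 powr - real i / (b * (2 powr - (real J * u) * nb x powr (1 / p)))) powr real N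
        = c ^ N / b ^ N * 2 powr (real J * u * real N) * 2 powr - (real i * real N) * nb x powr - (real N / p)"
    proof -
      have cN: "c powr real N = c ^ N" "b powr real N = b ^ N" using assms by (simp_all add: powr_realpow)
      show ?thesis
        using n0 \<open>0 < b\<close> \<open>0 < c\<close> by (simp add: powr_divide powr_mult powr_powr powr_minus field_simps cN)
    qed
    also have "\<dots> \<le> c ^ N / b ^ N * 2 powr (real J * real N) * 2 powr - (real i * real N) * nb x powr - (real N / p)"
    proof (intro mult_right_mono mult_left_mono powr_mono)
      have "u \<le> 1" using p assms by (simp add: u_def)
      then show "real J * u \<le> real J" by (intro mult_left_le) auto
    qed (use assms in auto)
    finally show ?thesis .
  qed
  have sumnb: "(\<Sum>x\<in>F. \<mu> x * nb x powr - (real N / p)) \<le> real (card (cell J ` F))"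
  proof -
    have "(\<Sum>x\<in>F. \<mu> x * nb x powr - (real N / p)) = (\<Sum>z\<in>cell J ` F. \<Sum>x\<in>{x\<in>F. cell J x = z}. \<mu> x * nb x powr - (real N / p))"
      by (rule sum.image_gen[OF assms(2)])
    also have "\<dots> \<le> (\<Sum>z\<in>cell J ` F. 1)"
    proof (rule sum_mono)
      fix z assume "z \<in> cell J ` F"
      then obtain x0 where x0: "x0 \<in> F" "z = cell J x0" by blast
      define \<nu> where "\<nu> = sum \<mu> {x\<in>F. cell J x = z}"
      have "\<mu> x0 \<le> \<nu>" unfolding \<nu>_def using x0 assms(2) \<mu>0 by (intro member_le_sum) auto
      then have \<nu>0: "0 < \<nu>" using \<mu>(1)[OF x0(1)] by linarith
      have \<nu>1: "\<nu> \<le> 1" unfolding \<nu>_def \<mu>(2)[symmetric] using assms(2) \<mu>0 by (intro sum_mono2) auto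
      have "(\<Sum>x\<in>{x\<in>F. cell J x = z}. \<mu> x * nb x powr - (real N / p)) \<le> (\<Sum>x\<in>{x\<in>F. cell J x = z}. \<mu> x * \<nu> powr - (real N / p))"
      proof (intro sum_mono mult_left_mono)
        fix x assume x: "x \<in> {x\<in>F. cell J x = z}"
        have "\<nu> \<le> nb x" using nbmass_ge_mass[where l = J and z = z, OF assms(2) \<mu>0] x by (simp add: \<nu>_def nb_def)
        then show "nb x powr - (real N / p) \<le> \<nu> powr - (real N / p)"
          using \<nu>0 p by (intro powr_mono2') auto
      qed (use \<mu>0 in auto)
      also have "\<dots> = \<nu> powr 1 * \<nu> powr - (real N / p)" using \<nu>0 by (simp add: \<nu>_def sum_distrib_right)
      also have "\<dots> = \<nu> powr (1 - real N / p)" using powr_add[of \<nu> 1 "- (real N / p)"] by simp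
      also have "\<dots> \<le> 1" using \<nu>0 \<nu>1 p assms by (intro powr_le1) auto
      finally show "(\<Sum>x\<in>{x\<in>F. cell J x = z}. \<mu> x * nb x powr - (real N / p)) \<le> 1" .
    qed
    finally show ?thesis by simp
  qed
  define K where "K = c ^ N / b ^ N * 2 powr (real J * real N)"
  have K0: "0 \<le> K" using assms by (simp add: K_def)
  have "T * (\<Sum>x\<in>F. \<mu> x * (c * 2 powr - real i / (b * (2 powr - (real J * (p - real N)) * nb x) powr (1 / p))) ^ N)
     \<le> T * (\<Sum>x\<in>F. \<mu> x * (K * 2 powr - (real i * real N) * nb x powr - (real N / p)))"
    unfolding K_def by (intro mult_left_mono sum_mono trm \<mu>0) (auto simp: T_def)
  also have "\<dots> = K * (T * 2 powr - (real i * real N)) * (\<Sum>x\<in>F. \<mu> x * nb x powr - (real N / p))"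
    unfolding sum_distrib_left by (intro sum.cong refl) (simp add: mult_ac)
  also have "\<dots> \<le> K * (2 ^ N * 2 powr - (q * (real N - t))) * real (card (cell J ` F))"
  proof (rule mult_mono[OF mult_left_mono sumnb])
    have "T * 2 powr - (real i * real N) = 2 powr - (real i * (real N - t))"
      by (simp add: T_def algebra_simps flip: powr_add)
    also have "\<dots> \<le> 2 powr (real N - q * (real N - t))"
    proof -
      have "q * (real N - t) \<le> (real i + 1) * (real N - t)" using assms by (intro mult_right_mono) auto
      then show ?thesis using assms by (simp add: algebra_simps)
    qed
    also have "\<dots> = 2 ^ N * 2 powr - (q * (real N - t))"
      by (simp only: powr_diff powr_minus divide_inverse) (simp add: powr_realpow)
    finally show "T * 2 powr - (real i * real N) \<le> 2 ^ N * 2 powr - (q * (real N - t))" .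
  qed (use K0 \<mu>0 in \<open>auto intro!: sum_nonneg mult_nonneg_nonneg\<close>)
  finally show ?thesis unfolding K_def T_def nb_def by (simp add: mult_ac)
qed

lemma poly_decay:
  fixes c w :: real
  assumes "0 < c" "0 < w"
  shows "(\<lambda>k::nat. (real k / c + 2) ^ q * 2 powr - (real k * w)) \<longlonglongrightarrow> 0"
proof -
  have "(\<lambda>k::nat. (real k / c + 2) powr real q * 2 powr - (real k * w)) \<longlonglongrightarrow> 0"
    using assms by real_asymp
  moreover have "(real k / c + 2) powr real q = (real k / c + 2) ^ q" for k :: nat
  proof -
    have "0 \<le> real k / c" using assms by simp
    then show ?thesis by (intro powr_realpow) linarith
  qed
  ultimately show ?thesis by simp
qed

section \<open>One stage of the construction\<close>

text \<open>The p-th powers over the cells of level \<open>l\<close> that meet \<open>F\<close> sum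
  to beta^p 2^{-l(p-n)} times a number between 1 and 7 ^ n, so the budget of
  \<open>admissible\<close> is used up to a constant.\<close>

definition scoeff :: "(real^'n::finite) set \<Rightarrow> (real^'n \<Rightarrow> real) \<Rightarrow> real \<Rightarrow> nat \<Rightarrow> int^'n \<Rightarrow> real" where
  "scoeff F \<mu> p l z = beta l * (2 powr - (real l * (p - real CARD('n))) * nbmass F \<mu> l z) powr (1 / p)"

text \<open>In \<open>M0\<close> the factor \<open>CARD('n) powr p\<close> comes from bounding a
  norm by the sum of the coordinates, and \<open>7 ^ CARD('n)\<close> from
  \<open>sum_nbmass\<close>. The bound holds level by level, so mixing old and new levels preserves
  the same constant.\<close>

lemma admissible_rcoeff:
  fixes E :: "(real^'n::finite) set" and p :: real
  defines "M0 \<equiv> real CARD('n) powr p * 7 ^ CARD('n)"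
  assumes "bounded E" "real CARD('n) < p" "finite F" "F \<subseteq> E" and \<mu>: "\<And>x. x \<in> F \<Longrightarrow> 0 \<le> \<mu> x" "sum \<mu> F = 1"
    and a0: "admissible E p M0 a0" and \<xi>: "\<forall>c\<in>S. \<forall>j. \<xi> c $ j < M"
    and S: "S = {(l, z). J \<le> l \<and> l \<le> k1 \<and> z \<in> cell l ` F}"
  shows "admissible E p M0 (rcoeff a0 J S (scoeff F \<mu> p) M \<xi>)"
  unfolding admissible_def
proof
  fix l
  let ?a = "rcoeff a0 J S (scoeff F \<mu> p) M \<xi>"
  let ?R = "M0 * beta l powr p * 2 powr - (real l * (p - real CARD('n)))"
  have p: "0 < p" using assms by (smt (verit) of_nat_0_le_iff)
  have M0: "0 \<le> M0" by (simp add: M0_def)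
  have fin: "finite (cell l ` E)" by (rule finite_cell_image[OF assms(2)])
  consider "l < J" | "J \<le> l" "l \<le> k1" | "k1 < l" "J \<le> l" by linarith
  then show "(\<Sum>z\<in>cell l ` E. norm (?a l z) powr p) \<le> ?R"
  proof cases
    case 1
    then have "(\<Sum>z\<in>cell l ` E. norm (?a l z) powr p) = (\<Sum>z\<in>cell l ` E. norm (a0 l z) powr p)"
      by (simp add: rcoeff_def)
    then show ?thesis using a0 by (simp add: admissible_def)
  next
    case 3
    then have "(\<Sum>z\<in>cell l ` E. norm (?a l z) powr p) = 0" by (simp add: rcoeff_def S)
    then show ?thesis using M0 by simp
  next
    case 2
    have nb0: "0 \<le> nbmass F \<mu> l z" for z unfolding nbmass_def using \<mu> by (intro sum_nonneg) auto
    have s0: "0 \<le> scoeff F \<mu> p l z" for z using beta_pos(1)[of l] by (simp add: scoeff_def)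
    have "(\<Sum>z\<in>cell l ` E. norm (?a l z) powr p) = (\<Sum>z\<in>cell l ` F. norm (?a l z) powr p)"
      using assms(5) fin 2 by (intro sum.mono_neutral_right) (auto simp: rcoeff_def S)
    also have "\<dots> \<le> (\<Sum>z\<in>cell l ` F. real CARD('n) powr p * beta l powr p * 2 powr - (real l * (p - real CARD('n))) * nbmass F \<mu> l z)"
    proof (rule sum_mono)
      fix z assume z: "z \<in> cell l ` F"
      have zS: "(l, z) \<in> S" using 2 z by (simp add: S)
      have "norm (?a l z) \<le> (\<Sum>j\<in>(UNIV::'n set). scoeff F \<mu> p l z)"
      proof (rule order_trans[OF norm_le_l1_cart], rule sum_mono)
        fix j :: 'n
        have "real (\<xi> (l, z) $ j) / real M \<le> 1" using \<xi> zS by (simp add: divide_le_eq less_imp_le)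
        then have "scoeff F \<mu> p l z * (real (\<xi> (l, z) $ j) / real M) \<le> scoeff F \<mu> p l z" using s0 by (intro mult_left_le) auto
        then show "\<bar>?a l z $ j\<bar> \<le> scoeff F \<mu> p l z"
          using zS 2 s0[of z] by (simp add: rcoeff_def abs_mult)
      qed
      also have "\<dots> = real CARD('n) * scoeff F \<mu> p l z" by simp
      finally have "norm (?a l z) powr p \<le> (real CARD('n) * scoeff F \<mu> p l z) powr p"
        using p by (intro powr_mono2) auto
      also have "\<dots> = real CARD('n) powr p * beta l powr p * 2 powr - (real l * (p - real CARD('n))) * nbmass F \<mu> l z"
        using p nb0 beta_pos(1)[of l] by (simp add: scoeff_def powr_mult powr_powr)
      finally show "norm (?a l z) powr p \<le> real CARD('n) powr p * beta l powr p * 2 powr - (real l * (p - real CARD('n))) * nbmass F \<mu> l z" .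
    qed
    also have "\<dots> = real CARD('n) powr p * beta l powr p * 2 powr - (real l * (p - real CARD('n))) * (\<Sum>z\<in>cell l ` F. nbmass F \<mu> l z)"
      by (simp add: sum_distrib_left)
    also have "\<dots> \<le> real CARD('n) powr p * beta l powr p * 2 powr - (real l * (p - real CARD('n))) * 7 ^ CARD('n)"
      using \<mu> assms by (intro mult_left_mono sum_nbmass) auto
    finally show ?thesis by (simp add: M0_def mult_ac)
  qed
qed

text \<open>Uniformity over all admissible coefficients is the point: a stage can bound what later
  stages will add.\<close>

lemma bump_series_tail:
  fixes E :: "(real^'n::finite) set"
  assumes "bounded E" "real CARD('n) < p" "0 \<le> M" "0 < \<eta>"
  shows "\<exists>K. \<forall>k\<ge>K. \<forall>a x. admissible E p M a \<longrightarrow> norm (bump_series E a x - (\<Sum>l<k. layer E a l x)) \<le> \<eta>"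
proof -
  define c where "c = 3 ^ CARD('n) * M powr (1 / p)"
  have sc: "summable (\<lambda>l. c * gam l)" by (intro summable_mult summable_gam)
  obtain K where K: "\<And>k. k \<ge> K \<Longrightarrow> norm (\<Sum>l. c * gam (l + k)) < \<eta>"
    using suminf_exist_split[OF assms(4) sc] by blast
  show ?thesis
  proof (intro exI[of _ K] allI impI)
    fix k a and x :: "real^'n" assume k: "K \<le> k" and a: "admissible E p M a"
    note sl = summable_layer[OF assms(1-3) a, of x]
    have "bump_series E a x - (\<Sum>l<k. layer E a l x) = (\<Sum>l. layer E a (l + k) x)"
      unfolding bump_series_def by (subst suminf_split_initial_segment[OF sl, of k]) simp
    also have "norm \<dots> \<le> (\<Sum>l. c * gam (l + k))"
    proof (rule norm_suminf_le)
      show "norm (layer E a (l + k) x) \<le> c * gam (l + k)" for l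
        unfolding c_def by (rule norm_layer_admissible(1)[OF assms(1-3) a])
      show "summable (\<lambda>l. c * gam (l + k))" by (rule summable_ignore_initial_segment[OF sc])
    qed
    also have "\<dots> \<le> \<eta>" using K[OF k] by simp
    finally show "norm (bump_series E a x - (\<Sum>l<k. layer E a l x)) \<le> \<eta>" .
  qed
qed

lemma total_decay:
  fixes \<theta> w w' K1 K2 K3 :: real
  assumes "0 < \<theta>" "0 < w" "0 < w'"
  shows "(\<lambda>k::nat. (real k / \<theta> + 2) * (K1 * 2 powr - (real k * w) +
     (real k / \<theta> + 2) * (K2 * (real k / \<theta> + 2) ^ q * 2 powr - (real k * w)) + K3 * 2 powr - (real k * w'))) \<longlonglongrightarrow> 0"
proof -
  have "(\<lambda>k::nat. K1 * ((real k / \<theta> + 2) ^ 1 * 2 powr - (real k * w)) +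
     K2 * ((real k / \<theta> + 2) ^ (q + 2) * 2 powr - (real k * w)) + K3 * ((real k / \<theta> + 2) ^ 1 * 2 powr - (real k * w')))
     \<longlonglongrightarrow> K1 * 0 + K2 * 0 + K3 * 0"
    by (rule tendsto_add[OF tendsto_add]; rule tendsto_mult_left; rule poly_decay; rule assms)
  moreover have "K1 * (Y ^ 1 * u) + K2 * (Y ^ (q + 2) * u) + K3 * (Y ^ 1 * v) = Y * (K1 * u + Y * (K2 * Y ^ q * u) + K3 * v)" for Y u v :: real
    by (simp add: algebra_simps power2_eq_square)
  ultimately show ?thesis by simp
qed

text \<open>\<open>R\<close> bounds both the level and the cost from below, so that validity for all
  \<open>R\<close> defeats every choice of the two constants in
  \<open>bounded_content\<close>.\<close>

definition large_image :: "real \<Rightarrow> (real^'n::finite) set \<Rightarrow> real \<Rightarrow> nat \<Rightarrow> bool" where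
  "large_image \<theta> A t R \<longleftrightarrow> (\<exists>m\<ge>R. \<forall>C. cell_cover \<theta> m A C \<longrightarrow> real R \<le> cover_cost t C)"

definition stage_premise :: "(real^'n::finite) set \<Rightarrow> real \<Rightarrow> real \<Rightarrow> real \<Rightarrow> real \<Rightarrow> bool" where
  "stage_premise E p \<theta> s t \<longleftrightarrow> 0 < \<theta> \<and> \<theta> \<le> 1 \<and> 0 < s \<and> \<not> bounded_content \<theta> E s \<and> 0 < t \<and> t < p * s / (p - real CARD('n) + s)"

text \<open>The three summands stem from pairs that stay unseparated, pairs separated after level
  \<open>J\<close>, and pairs separated at \<open>J\<close>. \<open>Y\<close> dominates the number
  of scales and of levels, and its power 4 N dominates 1 / beta l ^ N.\<close>

lemma stage_energy:
  fixes E :: "(real^'n::finite) set" and p \<theta> s t :: real and k J :: nat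
  defines "N \<equiv> CARD('n)" and "Y \<equiv> real k / \<theta> + 2" and "\<alpha> \<equiv> (p - real CARD('n) + s) / p"
  defines "m \<equiv> nat \<lfloor>\<alpha> * real k\<rfloor>" and "m1 \<equiv> top_level \<theta> (nat \<lfloor>\<alpha> * real k\<rfloor>)" and "k1 \<equiv> top_level \<theta> k"
    and "c \<equiv> 7 * 2 ^ CARD('n) :: real" and "\<omega> \<equiv> s - (p - real CARD('n) + s) / p * t"
  assumes "bounded E" "real N < p" "0 < \<theta>" "\<theta> \<le> 1" "0 < s" "s \<le> real N" "0 < t" "t < real N" "0 < \<omega>" "J \<le> k"
    and F: "finite F" "F \<subseteq> E" and \<mu>: "\<And>x. x \<in> F \<Longrightarrow> 0 < \<mu> x" "sum \<mu> F = 1"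
    and frost: "\<And>l z. k \<le> l \<Longrightarrow> l \<le> k1 \<Longrightarrow> sum \<mu> {y\<in>F. cell l y = z} \<le> 2 powr - (real l * s)"
  shows "\<exists>\<xi> S. (\<forall>c\<in>S. \<forall>j. \<xi> c $ j < 2 ^ m1) \<and> S = {(l, z). J \<le> l \<and> l \<le> k1 \<and> z \<in> cell l ` F} \<and>
    energy F \<mu> t m m1 3 (\<lambda>x. \<Sum>l\<le>k1. layer E (rcoeff a0 J S (scoeff F \<mu> p) (2 ^ m1) \<xi>) l x)
    \<le> Y * (7 ^ N * 2 powr t * 2 powr - (real k * \<omega>) +
         Y * (2 ^ N * c ^ N * 7 ^ N * Y ^ (4 * N) * 2 powr - (real k * \<omega>)) +
         c ^ N / beta J ^ N * 2 powr (real J * real N) * real (card (cell J ` E)) * 2 ^ N * 2 powr - (real k * (\<alpha> * (real N - t))))"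
proof -
  have p: "0 < p" using assms by (smt (verit) of_nat_0_le_iff)
  have \<alpha>: "0 < \<alpha>" "\<alpha> \<le> 1" using assms p by (auto simp: \<alpha>_def field_simps)
  have \<omega>\<alpha>: "\<omega> = s - \<alpha> * t" by (simp add: \<omega>_def \<alpha>_def)
  have \<mu>0: "\<And>x. x \<in> F \<Longrightarrow> 0 \<le> \<mu> x" using \<mu>(1) less_imp_le by blast
  define h where "h = scoeff F \<mu> p"
  define S where "S = {(l, z). J \<le> l \<and> l \<le> k1 \<and> z \<in> cell l ` F}"
  have c1: "1 \<le> c"
  proof -
    have "(1::real) \<le> 2 ^ CARD('n)" by simp
    then show ?thesis unfolding c_def by linarith
  qed
  have kk1: "k \<le> k1" unfolding k1_def by (rule le_top_level) (use assms in auto)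
  have m: "real m \<le> \<alpha> * real k" "\<alpha> * real k \<le> real m + 1"
  proof -
    have "0 \<le> \<alpha> * real k" using \<alpha> by simp
    then show "real m \<le> \<alpha> * real k" "\<alpha> * real k \<le> real m + 1" unfolding m_def by linarith+
  qed
  have k1: "real k / \<theta> \<le> real k1" "real k1 \<le> real k / \<theta> + 1"
    using top_level_bounds[OF assms(11), of k] by (auto simp: k1_def)
  have m1a: "real m1 \<le> \<alpha> * real k / \<theta> + 1"
  proof -
    have "real m1 \<le> real m / \<theta> + 1" using top_level_bounds[OF assms(11), of m] by (auto simp: m1_def m_def)
    also have "\<dots> \<le> \<alpha> * real k / \<theta> + 1" using m assms by (intro add_right_mono divide_right_mono) auto
    finally show ?thesis .
  qed
  have m1: "real m1 + 1 \<le> Y"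
  proof -
    have "\<alpha> * real k \<le> real k" using \<alpha> by (simp add: mult_left_le_one_le)
    then have "\<alpha> * real k / \<theta> \<le> real k / \<theta>" using assms by (intro divide_right_mono) auto
    then show ?thesis using m1a by (simp add: Y_def)
  qed
  have k1Y: "real k1 \<le> Y" using k1 by (simp add: Y_def)
  have Y0: "0 \<le> Y" using m1 by linarith
  have hpos: "0 < h l (cell l x) \<and> h l (cell l x) \<le> 1" if x: "x \<in> F" for l x
  proof -
    have nb: "0 < nbmass F \<mu> l (cell l x)" by (rule nbmass_pos[OF F(1) \<mu>(1) x])
    have nb1: "nbmass F \<mu> l (cell l x) \<le> 1" by (rule nbmass_le_1[OF F(1) \<mu>0 \<mu>(2)])
    have "2 powr - (real l * (p - real CARD('n))) \<le> 2 powr 0"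
      using assms by (intro powr_mono) auto
    then have "2 powr - (real l * (p - real CARD('n))) * nbmass F \<mu> l (cell l x) \<le> 1 * 1"
      using nb nb1 by (intro mult_mono) auto
    then have "(2 powr - (real l * (p - real CARD('n))) * nbmass F \<mu> l (cell l x)) powr (1 / p) \<le> 1"
      using nb p by (intro powr_le1) auto
    then have "h l (cell l x) \<le> 1 * 1" unfolding h_def scoeff_def using beta_pos[of l] by (intro mult_mono) auto
    moreover have "0 < h l (cell l x)" unfolding h_def scoeff_def using beta_pos[of l] nb by simp
    ultimately show ?thesis by simp
  qed
  define X where "X l x i = (c * 2 powr - real i / h l (cell l x)) ^ N" for l x i
  have X0: "0 \<le> X l x i" for l x i
  proof -
    have "0 \<le> h l (cell l x)" unfolding h_def scoeff_def using beta_pos[of l] by simp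
    then show ?thesis using c1 by (simp add: X_def)
  qed
  define D where "D = 2 ^ N * c ^ N * 7 ^ N * Y ^ (4 * N)"
  define A1 where "A1 = 7 ^ N * 2 powr t * 2 powr - (real k * \<omega>)"
  define A2 where "A2 = D * 2 powr - (real k * \<omega>)"
  define A3 where "A3 = c ^ N / beta J ^ N * 2 powr (real J * real N) * real (card (cell J ` E)) * 2 ^ N * 2 powr - (real k * (\<alpha> * (real N - t)))"
  have A0: "0 \<le> A1" "0 \<le> A2" "0 \<le> A3" using c1 Y0 beta_pos(1)[of J] by (auto simp: A1_def A2_def A3_def D_def)
  obtain \<xi> where \<xi>: "\<forall>c\<in>S. \<forall>j. \<xi> c $ j < 2 ^ m1"
    "energy F \<mu> t m m1 3 (\<lambda>x. \<Sum>l\<le>k1. layer E (rcoeff a0 J S h (2 ^ m1) \<xi>) l x)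
    \<le> (\<Sum>(x, y, i)\<in>F \<times> F \<times> {m..m1}. \<mu> x * \<mu> y * 2 powr (real i * t) *
       (if \<exists>l. sep J k1 x y l then min 1 (X (LEAST l. sep J k1 x y l) x i) else 1))"
    using random_coefficients[where h = h and J = J and ?k1.0 = k1 and ?m1.0 = m1 and t = t and ?a0.0 = a0 and m = m and \<mu> = \<mu>,
      OF assms(9) F \<mu>0 hpos] unfolding S_def X_def c_def N_def by blast
  have nbk: "nbmass F \<mu> l z \<le> 7 ^ N * 2 powr - (real l * s)" if "k \<le> l" "l \<le> k1" for l z
    unfolding N_def by (rule nbmass_le[OF F(1) frost[OF that] \<mu>0])
  have inv_beta: "1 / beta l ^ N \<le> Y ^ (4 * N)" if "l \<le> k1" for l
  proof -
    have "1 / beta l ^ N = (real l + 1) ^ (4 * N)" by (simp add: beta_def power_mult power_one_over)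
    also have "\<dots> \<le> Y ^ (4 * N)" using that k1 by (intro power_mono) (auto simp: Y_def)
    finally show ?thesis .
  qed
  have "(\<Sum>(x, y, i)\<in>F \<times> F \<times> {m..m1}. \<mu> x * \<mu> y * 2 powr (real i * t) *
       (if \<exists>l. sep J k1 x y l then min 1 (X (LEAST l. sep J k1 x y l) x i) else 1)) \<le> (real m1 + 1) * (A1 + real k1 * A2 + A3)"
  proof (rule expected_energy_le[OF F(1) _ \<mu>0 \<mu>(2) X0 _ _ _ A0])
    show "J \<le> k1" using assms(18) kk1 by simp
    \<comment> \<open>At the ends of the two windows the mass has exponent k s / \<theta> and the
      scale \<alpha> k t / \<theta>. Their difference k \<omega> / \<theta> is at least k \<omega>;
      rounding up in \<open>m1\<close> costs 2 powr t.\<close>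
    show "2 powr (real i * t) * nbmass F \<mu> k1 (cell k1 x) \<le> A1" if i: "i \<in> {m..m1}" for x i
    proof -
      have "2 powr (real i * t) * nbmass F \<mu> k1 (cell k1 x) \<le> 2 powr (real m1 * t) * (7 ^ N * 2 powr - (real k1 * s))"
        using i nbk[OF kk1] assms \<mu>0 by (intro mult_mono powr_mono mult_right_mono) (auto simp: nbmass_def intro: sum_nonneg)
      also have "\<dots> = 7 ^ N * 2 powr (real m1 * t - real k1 * s)" by (simp add: powr_diff powr_minus field_simps)
      also have "\<dots> \<le> 7 ^ N * 2 powr (t - real k * \<omega>)"
      proof (intro mult_left_mono powr_mono)
        have "real m1 * t \<le> (\<alpha> * real k / \<theta> + 1) * t" using m1a assms by (intro mult_right_mono) auto
        moreover have "real k / \<theta> * s \<le> real k1 * s" using k1 assms by (intro mult_right_mono) auto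
        ultimately have "real m1 * t - real k1 * s \<le> (\<alpha> * real k / \<theta> + 1) * t - real k / \<theta> * s" by linarith
        also have "\<dots> = t - (real k * \<omega>) / \<theta>" 
          unfolding \<omega>\<alpha> by (simp add: algebra_simps diff_divide_distrib add_divide_distrib)
        also have "\<dots> \<le> t - real k * \<omega>"
        proof -
          have "real k * \<omega> * 1 \<le> real k * \<omega> * (1 / \<theta>)" using assms by (intro mult_left_mono) auto
          then show ?thesis by simp
        qed
        finally show "real m1 * t - real k1 * s \<le> t - real k * \<omega>" .
      qed auto
      also have "\<dots> = A1" by (simp add: A1_def powr_diff powr_minus field_simps)
      finally show ?thesis .
    qed
    show "2 powr (real i * t) * (nbmass F \<mu> l (cell l x) * min 1 (X l x i)) \<le> A2" if x: "x \<in> F" and i: "i \<in> {m..m1}" and l: "l \<le> k1" for x i l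
    proof -
      have nb: "0 < nbmass F \<mu> l (cell l x)" by (rule nbmass_pos[OF F(1) \<mu>(1) x])
      note b = beta_pos[of l]
      show ?thesis
      proof (cases "k \<le> l")
        case True
        have "2 powr (real i * t) * (nbmass F \<mu> l (cell l x) * min 1 (X l x i)) \<le> c ^ N * 7 ^ N / beta l ^ N * 2 powr - (real l * \<omega>)"
          unfolding X_def h_def scoeff_def N_def[symmetric]
          by (rule fine_term_le) (use assms nb b c1 nbk[OF True l] in auto)
        also have "\<dots> = c ^ N * 7 ^ N * (1 / beta l ^ N) * 2 powr - (real l * \<omega>)" by simp
        also have "\<dots> \<le> c ^ N * 7 ^ N * Y ^ (4 * N) * 2 powr - (real k * \<omega>)"
          using True assms(17) c1 b Y0 by (intro mult_mono mult_left_mono inv_beta l powr_mono) (auto intro: mult_right_mono)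
        also have "\<dots> \<le> 2 ^ N * (c ^ N * 7 ^ N * Y ^ (4 * N) * 2 powr - (real k * \<omega>))"
        proof -
          have "0 \<le> c ^ N * 7 ^ N * Y ^ (4 * N) * 2 powr - (real k * \<omega>)" using c1 Y0 by simp
          moreover have "(1::real) \<le> 2 ^ N" by simp
          ultimately show ?thesis by (metis mult_right_mono mult_1)
        qed
        also have "\<dots> = A2" by (simp add: A2_def D_def)
        finally show ?thesis .
      next
        case False
        have nbl: "nbmass F \<mu> l (cell l x) \<le> 7 ^ N * (2 powr (real N * (real k - real l)) * 2 powr - (real k * s))"
          unfolding N_def by (rule nbmass_le[OF F(1) coarse_mass_le[OF F(1) _ frost] \<mu>0]) (use False kk1 \<mu>0 in auto)
        have "2 powr (real i * t) * (nbmass F \<mu> l (cell l x) * min 1 (X l x i)) \<le> 2 ^ N * c ^ N * 7 ^ N / beta l ^ N * 2 powr - (real k * \<omega>)"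
          unfolding X_def h_def scoeff_def N_def[symmetric]
        proof (rule coarse_term_le)
          show "(p - real N + s) / p * real k \<le> real i + 1" using m i by (simp add: \<alpha>_def N_def)
        qed (use assms nb b c1 nbl in auto)
        also have "\<dots> = 2 ^ N * c ^ N * 7 ^ N * (1 / beta l ^ N) * 2 powr - (real k * \<omega>)" by simp
        also have "\<dots> \<le> A2"
          unfolding A2_def D_def using c1 by (intro mult_right_mono mult_left_mono inv_beta l) auto
        finally show ?thesis .
      qed
    qed
    show "2 powr (real i * t) * (\<Sum>x\<in>F. \<mu> x * X J x i) \<le> A3" if i: "i \<in> {m..m1}" for i
    proof -
      have q: "\<alpha> * real k \<le> real i + 1" using m i by auto
      have c0: "0 < c" using c1 by simp
      have "2 powr (real i * t) * (\<Sum>x\<in>F. \<mu> x * X J x i)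
        \<le> c ^ N / beta J ^ N * 2 powr (real J * real N) * real (card (cell J ` F)) * 2 ^ N * 2 powr - (\<alpha> * real k * (real N - t))"
        unfolding X_def h_def scoeff_def N_def
        by (rule base_term_le[OF F(1) \<mu> assms(15) assms(16)[unfolded N_def] assms(10)[unfolded N_def] beta_pos(1) c0 q])
      also have "\<dots> \<le> c ^ N / beta J ^ N * 2 powr (real J * real N) * real (card (cell J ` E)) * 2 ^ N * 2 powr - (\<alpha> * real k * (real N - t))"
        using F c1 beta_pos[of J] finite_cell_image[OF assms(9)]
        by (intro mult_right_mono mult_left_mono of_nat_mono card_mono image_mono) auto
      also have "\<dots> = A3" by (simp add: A3_def mult_ac)
      finally show ?thesis .
    qed
  qed
  also have "\<dots> \<le> Y * (A1 + Y * A2 + A3)"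
    using A0 m1 k1Y Y0 by (intro mult_mono add_mono mult_right_mono) auto
  finally have "energy F \<mu> t m m1 3 (\<lambda>x. \<Sum>l\<le>k1. layer E (rcoeff a0 J S h (2 ^ m1) \<xi>) l x) \<le> Y * (A1 + Y * A2 + A3)"
    using \<xi>(2) by linarith
  then show ?thesis
    using \<xi>(1) unfolding A1_def A2_def A3_def D_def h_def
    by (intro exI[of _ \<xi>] exI[of _ S]) (simp add: S_def)
qed

text \<open>Levels below \<open>K\<close> decide the outcome: an admissible continuation moves
  points by at most 2 powr - m1, the finest scale that the energy sees. Later stages therefore
  cannot undo this one.\<close>

lemma stage:
  fixes E :: "(real^'n::finite) set" and p \<theta> s t :: real and R J :: nat
  defines "M0 \<equiv> real CARD('n) powr p * 7 ^ CARD('n)"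
  assumes "bounded E" "real CARD('n) < p" "admissible E p M0 a0"
  shows "\<exists>K a. J \<le> K \<and> admissible E p M0 a \<and> (\<forall>l<J. a l = a0 l) \<and>
     (stage_premise E p \<theta> s t \<longrightarrow>
       (\<forall>a'. admissible E p M0 a' \<longrightarrow> (\<forall>l<K. a' l = a l) \<longrightarrow> large_image \<theta> (bump_series E a' ` E) t R))"
proof (cases "stage_premise E p \<theta> s t")
  case False
  then show ?thesis using assms by (intro exI[of _ J] exI[of _ a0]) auto
next
  case True
  let ?n = "real CARD('n)" and ?N = "CARD('n)"
  have pr: "0 < \<theta>" "\<theta> \<le> 1" "0 < s" "\<not> bounded_content \<theta> E s" "0 < t" "t < p * s / (p - ?n + s)"
    using True by (auto simp: stage_premise_def)
  have p: "0 < p" using assms(3) by (smt (verit) of_nat_0_le_iff)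
  have M0: "0 \<le> M0" by (simp add: M0_def)
  have sn: "s \<le> ?n" using bounded_content_CARD[OF assms(2) pr(1,2), of s] pr(4) by linarith
  define \<alpha> where "\<alpha> = (p - ?n + s) / p"
  define \<omega> where "\<omega> = s - (p - ?n + s) / p * t"
  have \<alpha>: "0 < \<alpha>" using assms pr p by (simp add: \<alpha>_def)
  have \<omega>: "0 < \<omega>" using pr assms p by (simp add: \<omega>_def field_simps)
  have tn: "t < ?n"
  proof -
    have "s * (p - ?n) \<le> ?n * (p - ?n)" using sn assms by (intro mult_right_mono) auto
    then have "p * s \<le> ?n * (p - ?n + s)" by (simp add: algebra_simps)
    then have "p * s / (p - ?n + s) \<le> ?n" using assms pr by (simp add: pos_divide_le_eq)
    then show ?thesis using pr(6) by linarith
  qed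
  define c where "c = (7 * 2 ^ ?N :: real)"
  \<comment> \<open>\<open>J\<close> is fixed while \<open>k\<close> grows, so factors that depend
    on \<open>J\<close> do not prevent the decay.\<close>
  define Tot where "Tot k = (real k / \<theta> + 2) * (7 ^ ?N * 2 powr t * 2 powr - (real k * \<omega>) +
         (real k / \<theta> + 2) * (2 ^ ?N * c ^ ?N * 7 ^ ?N * (real k / \<theta> + 2) ^ (4 * ?N) * 2 powr - (real k * \<omega>)) +
         c ^ ?N / beta J ^ ?N * 2 powr (real J * ?n) * real (card (cell J ` E)) * 2 ^ ?N * 2 powr - (real k * (\<alpha> * (?n - t))))" for k :: nat
  have "Tot \<longlonglongrightarrow> 0"
    unfolding Tot_def by (rule total_decay) (use pr \<omega> \<alpha> tn in auto)
  then have "eventually (\<lambda>k. Tot k < 1 / (real R + 1)) sequentially"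
    by (rule order_tendstoD) simp
  then obtain K0 where K0: "\<And>k. k \<ge> K0 \<Longrightarrow> Tot k < 1 / (real R + 1)" by (auto simp: eventually_sequentially)
  define K1 where "K1 = max (max K0 J) (nat \<lceil>(real R + 1) / \<alpha>\<rceil>)"
  \<comment> \<open>Failure of \<open>bounded_content\<close> with the bound 1 supplies arbitrarily
    large levels at which every cover costs at least 1.\<close>
  obtain k where k: "k \<ge> K1" "\<And>C. cell_cover \<theta> k E C \<Longrightarrow> 1 \<le> cover_cost s C"
  proof -
    have "\<exists>k\<ge>K1. \<forall>C. cell_cover \<theta> k E C \<longrightarrow> \<not> cover_cost s C \<le> 1"
      using pr(4) unfolding bounded_content_def by blast
    then show ?thesis using that by (meson linear)
  qed
  define m where "m = nat \<lfloor>\<alpha> * real k\<rfloor>"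
  define m1 where "m1 = top_level \<theta> m"
  define k1 where "k1 = top_level \<theta> k"
  have mR: "R \<le> m"
  proof -
    have "(real R + 1) / \<alpha> \<le> real k" using k(1) unfolding K1_def by linarith
    then have "real R + 1 \<le> \<alpha> * real k" using \<alpha> by (simp add: pos_divide_le_eq mult.commute)
    then show ?thesis unfolding m_def by linarith
  qed
  have "\<exists>F \<mu>. finite F \<and> F \<subseteq> E \<and> (\<forall>x\<in>F. 0 < \<mu> x) \<and> sum \<mu> F = 1 \<and>
     (\<forall>l z. k \<le> l \<longrightarrow> l \<le> top_level \<theta> k \<longrightarrow> sum \<mu> {y\<in>F. cell l y = z} \<le> 2 powr - (real l * s))"
    by (rule frostman_weights[OF assms(2) pr(1,2)]) (rule k(2))
  then obtain F \<mu> where F\<mu>: "finite F \<and> F \<subseteq> E \<and> (\<forall>x\<in>F. 0 < \<mu> x) \<and> sum \<mu> F = 1 \<and>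
     (\<forall>l z. k \<le> l \<longrightarrow> l \<le> top_level \<theta> k \<longrightarrow> sum \<mu> {y\<in>F. cell l y = z} \<le> 2 powr - (real l * s))"
    by (elim exE) (rule that)
  have F: "finite F" "F \<subseteq> E" and \<mu>: "\<And>x. x \<in> F \<Longrightarrow> 0 < \<mu> x" "sum \<mu> F = 1"
    using F\<mu> by simp_all
  have frost: "sum \<mu> {y\<in>F. cell l y = z} \<le> 2 powr - (real l * s)" if "k \<le> l" "l \<le> k1" for l z
    using F\<mu> that unfolding k1_def by simp
  have \<mu>0: "\<And>x. x \<in> F \<Longrightarrow> 0 \<le> \<mu> x" using \<mu>(1) less_imp_le by blast
  have Jk: "J \<le> k" using k(1) by (simp add: K1_def)
  have "\<exists>\<xi> S. (\<forall>c\<in>S. \<forall>j. \<xi> c $ j < 2 ^ m1) \<and> S = {(l, z). J \<le> l \<and> l \<le> k1 \<and> z \<in> cell l ` F} \<and>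
    energy F \<mu> t m m1 3 (\<lambda>x. \<Sum>l\<le>k1. layer E (rcoeff a0 J S (scoeff F \<mu> p) (2 ^ m1) \<xi>) l x)
    \<le> Tot k"
    unfolding Tot_def \<omega>_def \<alpha>_def c_def m1_def m_def k1_def
    by (rule stage_energy[OF assms(2) assms(3) pr(1,2,3) sn pr(5) tn \<omega>[unfolded \<omega>_def] Jk F \<mu> frost[unfolded k1_def]])
  then obtain \<xi> S where \<xi>S: "(\<forall>c\<in>S. \<forall>j. \<xi> c $ j < 2 ^ m1) \<and> S = {(l, z). J \<le> l \<and> l \<le> k1 \<and> z \<in> cell l ` F} \<and>
    energy F \<mu> t m m1 3 (\<lambda>x. \<Sum>l\<le>k1. layer E (rcoeff a0 J S (scoeff F \<mu> p) (2 ^ m1) \<xi>) l x)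
    \<le> Tot k"
    by (elim exE) (rule that)
  note \<xi> = conjunct1[OF \<xi>S] and S = conjunct1[OF conjunct2[OF \<xi>S]] and en = conjunct2[OF conjunct2[OF \<xi>S]]
  define a where "a = rcoeff a0 J S (scoeff F \<mu> p) (2 ^ m1) \<xi>"
  have adm: "admissible E p M0 a"
    unfolding a_def M0_def by (rule admissible_rcoeff[OF assms(2,3) F \<mu>0 \<mu>(2) assms(4)[unfolded M0_def] \<xi> S])
  define w where "w x = (\<Sum>l\<le>k1. layer E a l x)" for x
  obtain K2 where K2: "\<And>q a x. q \<ge> K2 \<Longrightarrow> admissible E p M0 a \<Longrightarrow> norm (bump_series E a x - (\<Sum>l<q. layer E a l x)) \<le> 2 powr - real m1"
    using bump_series_tail[OF assms(2,3) M0, of "2 powr - real m1"] by auto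
  define K where "K = max (max K2 J) (Suc k1)"
  show ?thesis
  proof (intro exI[of _ K] exI[of _ a] conjI impI allI)
    show "J \<le> K" by (simp add: K_def)
    show "admissible E p M0 a" by (rule adm)
    show "a l = a0 l" if "l < J" for l using that by (simp add: a_def rcoeff_def fun_eq_iff)
    fix a' assume a': "admissible E p M0 a'" "\<forall>l<K. a' l = a l"
    define v where "v = bump_series E a'"
    have vw: "\<bar>v x $ j - w x $ j\<bar> \<le> 2 powr - real m1" for x j
    proof -
      have "(\<Sum>l<K. layer E a' l x) = (\<Sum>l<K. layer E a l x)"
        using a'(2) by (intro sum.cong refl) (simp add: layer_def)
      also have "\<dots> = w x"
        unfolding w_def
      proof (rule sum.mono_neutral_right)
        show "\<forall>l\<in>{..<K} - {..k1}. layer E a l x = 0"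
          using Jk le_top_level[OF pr(1,2), of k] by (auto simp: layer_def a_def rcoeff_def S k1_def)
      qed (auto simp: K_def)
      finally have "norm (v x - w x) \<le> 2 powr - real m1"
        using K2[of K a' x] a'(1) by (simp add: v_def K_def)
      then show ?thesis using component_le_norm_cart[of "v x - w x" j] by simp
    qed
    \<comment> \<open>Passing from the limit map to the partial sum changes each of the two images
      by at most 2 powr - m1 \<le> 2 powr - i, hence the factor 3.\<close>
    have le: "energy F \<mu> t m m1 1 v \<le> Tot k"
    proof (rule order_trans[OF _ en], unfold energy_def, rule sum_mono, clarify)
      fix x y i assume xyi: "x \<in> F" "y \<in> F" "i \<in> {m..m1}"
      have "of_bool (\<forall>j. \<bar>v x $ j - v y $ j\<bar> \<le> 2 powr - real i) \<le> (of_bool (\<forall>j. \<bar>w x $ j - w y $ j\<bar> \<le> 3 * 2 powr - real i) :: real)"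
      proof -
        have "2 powr - real m1 \<le> 2 powr - real i" using xyi by (intro powr_mono) auto
        then have "\<bar>w x $ j - w y $ j\<bar> \<le> 3 * 2 powr - real i" if "\<bar>v x $ j - v y $ j\<bar> \<le> 2 powr - real i" for j
          using that vw[of x j] vw[of y j] by linarith
        then show ?thesis by auto
      qed
      then show "\<mu> x * \<mu> y * 2 powr (real i * t) * of_bool (\<forall>j. \<bar>v x $ j - v y $ j\<bar> \<le> 1 * 2 powr - real i)
        \<le> \<mu> x * \<mu> y * 2 powr (real i * t) * of_bool (\<forall>j. \<bar>(\<Sum>l\<le>k1. layer E (rcoeff a0 J S (scoeff F \<mu> p) (2 ^ m1) \<xi>) l x) $ j -
          (\<Sum>l\<le>k1. layer E (rcoeff a0 J S (scoeff F \<mu> p) (2 ^ m1) \<xi>) l y) $ j\<bar> \<le> 3 * 2 powr - real i)"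
        unfolding w_def a_def mult_1 using \<mu>0 xyi by (intro mult_left_mono) auto
    qed
    show "large_image \<theta> (bump_series E a' ` E) t R"
      unfolding large_image_def
    proof (intro exI[of _ m] conjI allI impI mR)
      fix C assume C: "cell_cover \<theta> m (bump_series E a' ` E) C"
      have "1 \<le> energy F \<mu> t m m1 1 v * cover_cost t C"
        unfolding m1_def by (rule energy_cost[OF F \<mu>0 \<mu>(2)]) (use C in \<open>simp_all add: v_def\<close>)
      also have "\<dots> \<le> 1 / (real R + 1) * cover_cost t C"
        using le K0[of k] k(1) by (intro mult_right_mono cover_cost_nonneg) (auto simp: K1_def)
      finally have "real R + 1 \<le> cover_cost t C" by (simp add: field_simps)
      then show "real R \<le> cover_cost t C" by simp
    qed
  qed
qed

section \<open>Assembling the map\<close>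

text \<open>Rational parameters and bounds \<open>R\<close> are enumerated and the stages are
  chained by dependent choice. Each requirement is secured by one stage for all admissible
  continuations, so the limit inherits it.\<close>

lemma all_stages:
  fixes E :: "(real^'n::finite) set" and p :: real
  defines "M0 \<equiv> real CARD('n) powr p * 7 ^ CARD('n)"
  assumes "bounded E" "real CARD('n) < p"
  shows "\<exists>a. admissible E p M0 a \<and> (\<forall>\<theta> s t :: rat. \<forall>R.
     stage_premise E p (of_rat \<theta>) (of_rat s) (of_rat t) \<longrightarrow>
       large_image (of_rat \<theta>) (bump_series E a ` E) (of_rat t) R)"
proof -
  define good where "good a = (\<lambda>(\<theta> :: rat, s :: rat, t :: rat, R).
     stage_premise E p (of_rat \<theta>) (of_rat s) (of_rat t) \<longrightarrow>
       large_image (of_rat \<theta>) (bump_series E a ` E) (of_rat t) R)" for a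
  define P where "P n x \<longleftrightarrow> n \<le> fst x \<and> admissible E p M0 (snd x)" for n :: nat and x :: "nat \<times> (nat \<Rightarrow> int^'n \<Rightarrow> real^'n)"
  define Q where "Q n x y \<longleftrightarrow> fst x \<le> fst y \<and> (\<forall>l<fst x. snd y l = snd x l) \<and>
     (\<forall>a. admissible E p M0 a \<longrightarrow> (\<forall>l<fst y. a l = snd y l) \<longrightarrow> good a (from_nat n))"
    for n :: nat and x y :: "nat \<times> (nat \<Rightarrow> int^'n \<Rightarrow> real^'n)"
  have "\<exists>f. \<forall>n. P n (f n) \<and> Q n (f n) (f (Suc n))"
  proof (rule dependent_nat_choice)
    have "admissible E p M0 (\<lambda>_ _. 0)" by (simp add: admissible_def M0_def)
    then show "\<exists>x. P 0 x" by (auto simp: P_def)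
    fix x n assume x: "P n x"
    obtain \<theta> s t R where q: "(from_nat n :: rat \<times> rat \<times> rat \<times> nat) = (\<theta>, s, t, R)"
      by (metis prod.exhaust)
    have adm: "admissible E p (real CARD('n) powr p * 7 ^ CARD('n)) (snd x)" using x by (simp add: P_def M0_def)
    obtain K a where Ka: "fst x \<le> K" "admissible E p M0 a" "\<forall>l<fst x. a l = snd x l"
      "stage_premise E p (of_rat \<theta>) (of_rat s) (of_rat t) \<longrightarrow>
       (\<forall>a'. admissible E p M0 a' \<longrightarrow> (\<forall>l<K. a' l = a l) \<longrightarrow> large_image (of_rat \<theta>) (bump_series E a' ` E) (of_rat t) R)"
      using stage[OF assms(2,3) adm, of "fst x" "of_rat \<theta>" "of_rat s" "of_rat t" R] unfolding M0_def by blast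
    show "\<exists>y. P (Suc n) y \<and> Q n x y"
    proof (intro exI[of _ "(max K (Suc n), a)"] conjI)
      show "P (Suc n) (max K (Suc n), a)" using Ka by (simp add: P_def)
      show "Q n x (max K (Suc n), a)" using Ka by (auto simp: Q_def good_def q)
    qed
  qed
  then obtain f where f: "\<And>n. P n (f n)" "\<And>n. Q n (f n) (f (Suc n))" by blast
  have fst_mono: "fst (f i) \<le> fst (f j)" if "i \<le> j" for i j
    using that by (induction j rule: dec_induct) (use f(2) in \<open>auto simp: Q_def intro: order_trans\<close>)
  have stable: "snd (f j) l = snd (f i) l" if "i \<le> j" "l < fst (f i)" for i j l
    using that(1)
  proof (induction j rule: dec_induct)
    case (step j)
    have "l < fst (f j)" using fst_mono[OF step.hyps(1)] that(2) by simp
    then show ?case using step.IH f(2)[of j] by (simp add: Q_def)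
  qed simp
  \<comment> \<open>Level \<open>l\<close> is frozen from state \<open>Suc l\<close> on.\<close>
  define A where "A l = snd (f (Suc l)) l" for l
  have A: "A l = snd (f i) l" if "l < fst (f i)" for l i
  proof -
    have "l < fst (f (Suc l))" using f(1)[of "Suc l"] by (simp add: P_def)
    then have "snd (f (max i (Suc l))) l = A l" unfolding A_def by (intro stable) auto
    moreover have "snd (f (max i (Suc l))) l = snd (f i) l" using that by (intro stable) auto
    ultimately show ?thesis by simp
  qed
  \<comment> \<open>\<open>admissible\<close> is a condition on each level separately, so it passes
    to the limit.\<close>
  have admA: "admissible E p M0 A"
    using f(1) unfolding admissible_def P_def A_def by blast
  have "good A q" for q
  proof -
    obtain n where n: "q = from_nat n" using surj_from_nat by blast
    have "\<forall>l<fst (f (Suc n)). A l = snd (f (Suc n)) l" using A by blast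
    then show ?thesis using f(2)[of n] admA unfolding Q_def n by blast
  qed
  then show ?thesis using admA by (intro exI[of _ A]) (auto simp: good_def)
qed

section \<open>Dependence of the contents on the exponent and on theta\<close>

lemma bounded_content_mono:
  assumes "bounded_content \<theta> A s" "s \<le> s'"
  shows "bounded_content \<theta> A s'"
proof -
  have "cover_cost s' C \<le> cover_cost s C" for C :: "(nat \<times> (int^'n)) set"
    unfolding cover_cost_def using assms(2) by (intro sum_mono) (auto intro!: mult_left_mono)
  then show ?thesis using assms(1) unfolding bounded_content_def by (meson order_trans)
qed

lemma bounded_content_antimono_theta:
  assumes "bounded_content \<theta> A s" "0 < \<theta>'" "\<theta>' \<le> \<theta>"
  shows "bounded_content \<theta>' A s"
proof -
  have "top_level \<theta> k \<le> top_level \<theta>' k" for k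
  proof -
    have "real k / \<theta> \<le> real k / \<theta>'" using assms by (intro divide_left_mono) auto
    then show ?thesis unfolding top_level_def by (intro nat_mono ceiling_mono)
  qed
  then have "cell_cover \<theta>' k A C" if "cell_cover \<theta> k A C" for k C
    using that order_trans unfolding cell_cover_def by fastforce
  then show ?thesis using assms(1) unfolding bounded_content_def by meson
qed

text \<open>Cells finer than the window of \<theta> are replaced by their ancestors at its finest
  level \<open>T\<close>. The new exponent s1 satisfies (k / \<theta>) s1 = (k / \<theta>') s, so a
  replacement raises the cost by at most the factor 2 powr s.\<close>

lemma bounded_content_raise_theta:
  fixes A :: "(real^'n::finite) set"
  assumes bc: "bounded_content \<theta>' A s" and \<theta>: "0 < \<theta>'" "\<theta>' \<le> \<theta>" "\<theta> \<le> 1" and "0 < s"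
  shows "bounded_content \<theta> A (s * \<theta> / \<theta>')"
proof -
  define s1 where "s1 = s * \<theta> / \<theta>'"
  have s1: "s \<le> s1" using assms by (simp add: s1_def field_simps)
  obtain B K where BK: "\<And>k. k \<ge> K \<Longrightarrow> \<exists>C. cell_cover \<theta>' k A C \<and> cover_cost s C \<le> B"
    using bc unfolding bounded_content_def by blast
  show ?thesis
    unfolding bounded_content_def s1_def[symmetric]
  proof (rule exI, rule exI, intro allI impI)
    fix k assume "k \<ge> K"
    then obtain C where C: "cell_cover \<theta>' k A C" "cover_cost s C \<le> B" using BK by blast
    have finC: "finite C" using C by (simp add: cell_cover_def)
    define T where "T = top_level \<theta> k"
    have kT: "k \<le> T" unfolding T_def by (rule le_top_level) (use assms in auto)
    \<comment> \<open>A cell of \<open>C\<close> that misses \<open>A\<close> receives an arbitrary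
      point; its replacement is just one more cell of level \<open>T\<close>.\<close>
    define rep where "rep c = (SOME x. x \<in> A \<and> cell (fst c) x = snd c)" for c :: "nat \<times> (int^'n)"
    define g where "g c = (if fst c \<le> T then c else (T, cell T (rep c)))" for c
    have cov: "cell_cover \<theta> k A (g ` C)"
      unfolding cell_cover_def
    proof (intro conjI ballI)
      show "finite (g ` C)" using finC by simp
      show "case c of (l, z) \<Rightarrow> k \<le> l \<and> l \<le> top_level \<theta> k" if c: "c \<in> g ` C" for c
      proof -
        obtain d where d: "d \<in> C" "c = g d" using c by blast
        have "k \<le> fst d" using C(1) d(1) by (auto simp: cell_cover_def)
        then show ?thesis using d(2) kT by (auto simp: g_def T_def split: if_splits)
      qed
      fix x assume x: "x \<in> A"
      obtain l where l: "(l, cell l x) \<in> C" using C(1) x by (auto simp: cell_cover_def)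
      show "\<exists>l. (l, cell l x) \<in> g ` C"
      proof (cases "l \<le> T")
        case True
        then have "g (l, cell l x) = (l, cell l x)" by (simp add: g_def)
        then show ?thesis using l by (metis image_eqI)
      next
        case False
        have "cell l (rep (l, cell l x)) = cell l x"
          unfolding rep_def by (rule someI2[of _ x]) (use x in auto)
        then have "cell T (rep (l, cell l x)) = cell T x"
          using False by (intro cell_mono[of T l]) auto
        then have "g (l, cell l x) = (T, cell T x)" using False by (simp add: g_def)
        then show ?thesis using l by (metis image_eqI)
      qed
    qed
    have "cover_cost s1 (g ` C) \<le> (\<Sum>c\<in>C. (\<lambda>(l, z). 2 powr - (real l * s1)) (g c))"
      unfolding cover_cost_def using sum_image_le[OF finC, of "\<lambda>(l, z). 2 powr - (real l * s1)" g]
      by (simp add: case_prod_beta o_def)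
    also have "\<dots> \<le> (\<Sum>c\<in>C. 2 powr s * (\<lambda>(l, z). 2 powr - (real l * s)) c)"
    proof (rule sum_mono)
      fix c assume c: "c \<in> C"
      have "(\<lambda>(l, z). 2 powr - (real l * s1)) (g c) \<le> 2 powr (s - real (fst c) * s)"
      proof (cases "fst c \<le> T")
        case True
        have "real (fst c) * s \<le> real (fst c) * s1" using s1 by (intro mult_left_mono) auto
        then show ?thesis using True assms(5) by (simp add: g_def case_prod_beta)
      next
        case False
        have "real (fst c) \<le> real k / \<theta>' + 1"
          using C(1) c top_level_bounds[OF \<theta>(1), of k] by (force simp: cell_cover_def)
        then have "real (fst c) * s \<le> (real k / \<theta>' + 1) * s" using assms by (intro mult_right_mono) auto
        also have "\<dots> = real k / \<theta> * s1 + s" using assms by (simp add: s1_def field_simps)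
        also have "real k / \<theta> * s1 \<le> real T * s1"
          using top_level_bounds[of \<theta> k] assms s1 by (intro mult_right_mono) (auto simp: T_def)
        finally show ?thesis using False by (simp add: g_def)
      qed
      also have "\<dots> = 2 powr s * (\<lambda>(l, z). 2 powr - (real l * s)) c"
        by (simp add: case_prod_beta powr_diff powr_minus field_simps)
      finally show "(\<lambda>(l, z). 2 powr - (real l * s1)) (g c) \<le> 2 powr s * (\<lambda>(l, z). 2 powr - (real l * s)) c" .
    qed
    also have "\<dots> = 2 powr s * cover_cost s C" by (simp add: cover_cost_def sum_distrib_left)
    also have "\<dots> \<le> 2 powr s * B" using C(2) by (intro mult_left_mono) auto
    finally show "\<exists>C. cell_cover \<theta> k A C \<and> cover_cost s1 C \<le> 2 powr s * B" using cov by blast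
  qed
qed

lemma large_image_not_bounded:
  assumes "\<And>R. large_image \<theta> A t R"
  shows "\<not> bounded_content \<theta> A t"
proof
  assume "bounded_content \<theta> A t"
  then obtain B K where BK: "\<And>k. k \<ge> K \<Longrightarrow> \<exists>C. cell_cover \<theta> k A C \<and> cover_cost t C \<le> B"
    unfolding bounded_content_def by blast
  obtain R :: nat where R: "B < real R" using reals_Archimedean2 by blast
  obtain m where m: "m \<ge> max K R" "\<And>C. cell_cover \<theta> m A C \<Longrightarrow> real (max K R) \<le> cover_cost t C"
    using assms[of "max K R"] unfolding large_image_def by blast
  then obtain C where "cell_cover \<theta> m A C" "cover_cost t C \<le> B" using BK[of m] by auto
  with m(2)[of C] R show False by simp
qed

text \<open>The map sending t to t (p - n) / (p - t) is the inverse of the one sending s to p s / (p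
  - n + s). It turns the strict bound on t into a strict bound on s, below which a rational number
  fits.\<close>

lemma image_dim_mono:
  fixes p n s t :: real
  assumes "n < p" "0 \<le> s" "0 < n" "t < p * s / (p - n + s)"
  shows "t * (p - n) / (p - t) < s" "t < p"
proof -
  have d: "0 < p - n + s" using assms by simp
  have lt: "t * (p - n + s) < p * s" using assms(4) d by (simp add: pos_less_divide_eq)
  have "p * s < p * (p - n + s)" using assms by (intro mult_strict_left_mono) auto
  then have "p * s / (p - n + s) < p" using d by (simp add: pos_divide_less_eq)
  then show tp: "t < p" using assms(4) by linarith
  show "t * (p - n) / (p - t) < s" using lt tp by (simp add: pos_divide_less_eq algebra_simps)
qed

lemma image_dim_mono_conv:
  fixes p n s t :: real
  assumes "n < p" "0 \<le> s" "0 < n" "t < p" "t * (p - n) / (p - t) < s"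
  shows "t < p * s / (p - n + s)"
proof -
  have d: "0 < p - n + s" using assms by simp
  have "t * (p - n) < s * (p - t)" using assms by (simp add: pos_divide_less_eq)
  then show ?thesis using d by (simp add: pos_less_divide_eq algebra_simps)
qed

text \<open>Strictness leaves room for rational r < s, u > t and v < \<theta>. Boundedness of the
  image at (\<theta>, t) passes to (v, u) by monotonicity, whereas boundedness of E at (v, r) would
  return to \<theta> at an exponent of at most s by
  \<open>bounded_content_raise_theta\<close>.\<close>

lemma image_content_unbounded:
  fixes E F :: "(real^'n::finite) set" and p \<theta> s t :: real
  assumes "real CARD('n) < p"
    and stages: "\<And>\<theta> s t :: rat. \<And>R. stage_premise E p (of_rat \<theta>) (of_rat s) (of_rat t) \<Longrightarrow>
       large_image (of_rat \<theta>) F (of_rat t) R"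
    and \<theta>: "0 < \<theta>" "\<theta> \<le> 1" and s: "0 < s" "\<not> bounded_content \<theta> E s"
    and t: "0 < t" "t < p * s / (p - real CARD('n) + s)"
  shows "\<not> bounded_content \<theta> F t"
proof
  assume bcF: "bounded_content \<theta> F t"
  let ?n = "real CARD('n)"
  have n: "0 < ?n" by simp
  have inv: "t * (p - ?n) / (p - t) < s" "t < p" using image_dim_mono[OF assms(1) _ n t(2)] s by auto
  obtain r :: rat where r: "t * (p - ?n) / (p - t) < of_rat r" "of_rat r < s"
    using of_rat_dense[OF inv(1)] by blast
  have "0 \<le> t * (p - ?n) / (p - t)" using t inv assms(1) by simp
  then have r0: "0 < real_of_rat r" using r by linarith
  have tr: "t < p * of_rat r / (p - ?n + of_rat r)"
    using image_dim_mono_conv[OF assms(1) _ n inv(2) r(1)] r0 by simp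
  obtain u :: rat where u: "t < of_rat u" "of_rat u < p * of_rat r / (p - ?n + of_rat r)"
    using of_rat_dense[OF tr] by blast
  \<comment> \<open>The lower limit for \<open>v\<close> ensures r \<theta> / v \<le> s.\<close>
  have "\<theta> * of_rat r / s < \<theta>" using \<theta> r s by (simp add: divide_less_eq)
  then obtain v :: rat where v: "\<theta> * of_rat r / s < of_rat v" "of_rat v < \<theta>"
    using of_rat_dense by blast
  have "0 < \<theta> * of_rat r / s" using \<theta> r0 s by simp
  then have v0: "0 < real_of_rat v" using v by linarith
  have "\<not> bounded_content (of_rat v) E (of_rat r)"
  proof
    assume "bounded_content (of_rat v) E (of_rat r)"
    then have "bounded_content \<theta> E (of_rat r * \<theta> / of_rat v)"
      by (rule bounded_content_raise_theta) (use v v0 \<theta> r0 in auto)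
    moreover have "of_rat r * \<theta> / of_rat v \<le> s"
      using v v0 s by (simp add: field_simps)
    ultimately show False using s(2) bounded_content_mono by blast
  qed
  moreover have "real_of_rat v \<le> 1" "0 < real_of_rat u" using v \<theta> u t by linarith+
  ultimately have "stage_premise E p (of_rat v) (of_rat r) (of_rat u)"
    using v0 r0 u by (simp add: stage_premise_def)
  then have "\<not> bounded_content (of_rat v) F (of_rat u)"
    by (intro large_image_not_bounded stages)
  moreover have "bounded_content (of_rat v) F (of_rat u)"
    using bounded_content_antimono_theta[OF bounded_content_mono[OF bcF] v0] u v by simp
  ultimately show False by contradiction
qed

text \<open>Both bounds are used at exponents strictly on one side of the dimension
  \<open>d\<close>; continuity of \<open>g\<close> at \<open>d\<close> carries them to the value
  \<open>g d\<close>.\<close>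

lemma image_dim_eq:
  fixes E F :: "(real^'n::finite) set" and p \<theta> :: real
  assumes "bounded E" "bounded F" "real CARD('n) < p" "0 < \<theta>" "\<theta> \<le> 1"
    and up: "\<And>s t. 0 < s \<Longrightarrow> bounded_content \<theta> E s \<Longrightarrow> p * s / (p - real CARD('n) + s) < t \<Longrightarrow> bounded_content \<theta> F t"
    and low: "\<And>s t. 0 < s \<Longrightarrow> \<not> bounded_content \<theta> E s \<Longrightarrow> 0 < t \<Longrightarrow> t < p * s / (p - real CARD('n) + s) \<Longrightarrow> \<not> bounded_content \<theta> F t"
  shows "upper_intermediate_dim \<theta> F = p * upper_intermediate_dim \<theta> E / (p - real CARD('n) + upper_intermediate_dim \<theta> E)"
proof -
  let ?n = "real CARD('n)"
  have p: "0 < p" using assms(3) by (smt (verit) of_nat_0_le_iff)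
  define g where "g s = p * s / (p - ?n + s)" for s
  define S where "S = {s. 0 < s \<and> bounded_content \<theta> E s}"
  define d where "d = Inf S"
  have dE: "upper_intermediate_dim \<theta> E = d" unfolding d_def S_def by (rule upper_intermediate_dim_eq) (use assms in auto)
  have "?n \<in> S" unfolding S_def using bounded_content_CARD[OF assms(1,4,5), of ?n] by simp
  then have ne: "S \<noteq> {}" by blast
  have d0: "0 \<le> d" unfolding d_def by (rule cInf_greatest[OF ne]) (auto simp: S_def)
  have "isCont g d" unfolding g_def using d0 assms(3) by (intro continuous_intros) auto
  then have lim: "(g \<longlongrightarrow> g d) (at d)" by (simp add: isCont_def)
  have "Inf {t. 0 < t \<and> bounded_content \<theta> F t} = g d"
  proof (rule Inf_threshold)
    show "0 \<le> g d" using d0 p assms(3) by (simp add: g_def)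
    fix t :: real assume t: "0 < t"
    show "bounded_content \<theta> F t" if gt: "g d < t"
    proof -
      obtain e where e: "e > 0" "\<And>s. s \<noteq> d \<Longrightarrow> dist s d < e \<Longrightarrow> g s < t"
        using order_tendstoD(2)[OF lim gt] unfolding eventually_at by auto
      define s where "s = d + e / 2"
      have s: "d < s" "g s < t" using e by (auto simp: s_def dist_real_def)
      obtain u where u: "u \<in> S" "u < s" using cInf_lessD[OF ne, of s] s unfolding d_def by blast
      then have "bounded_content \<theta> E s" using bounded_content_mono[of \<theta> E u s] by (simp add: S_def)
      then show ?thesis using up[of s t] s d0 by (simp add: g_def)
    qed
    show "g d \<le> t" if bc: "bounded_content \<theta> F t"
    proof (rule ccontr)
      assume "\<not> g d \<le> t"
      then have gt: "t < g d" by simp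
      \<comment> \<open>A positive t below \<open>g d\<close> excludes d = 0, so there are positive
        exponents below \<open>d\<close> to which the lower bound applies.\<close>
      have "d \<noteq> 0" using gt t by (auto simp: g_def)
      then have dpos: "0 < d" using d0 by simp
      obtain e where e: "e > 0" "\<And>s. s \<noteq> d \<Longrightarrow> dist s d < e \<Longrightarrow> t < g s"
        using order_tendstoD(1)[OF lim gt] unfolding eventually_at by auto
      define s where "s = d - min (e / 2) (d / 2)"
      have s: "0 < s" "s < d" "t < g s" using e dpos by (auto simp: s_def dist_real_def min_def)
      have "\<not> bounded_content \<theta> E s"
        using Inf_threshold_props(2)[OF s(1), of "bounded_content \<theta> E"] s(2) unfolding d_def S_def by blast
      then show False using low[OF s(1) _ t] s(3) bc by (auto simp: g_def)
    qed
  qed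
  then show ?thesis
    using upper_intermediate_dim_eq[OF assms(2,4,5)] unfolding dE by (simp add: g_def)
qed

theorem theorem7p5:
  fixes E :: "(real^'n::finite) set" and p :: real
  assumes "compact E"
    and "p > real CARD('n)"
  shows "\<exists>f :: real^'n \<Rightarrow> real^'n.
           continuous_on UNIV f \<and> f \<in> sobolev_W1_maps p \<and>
           (\<forall>\<theta>. 0 < \<theta> \<and> \<theta> \<le> 1 \<longrightarrow>
              upper_intermediate_dim \<theta> (f ` E) =
                p * upper_intermediate_dim \<theta> E
                  / (p - real CARD('n) + upper_intermediate_dim \<theta> E))"
proof -
  define M0 where "M0 = real CARD('n) powr p * 7 ^ CARD('n)"
  have M0: "0 \<le> M0" by (simp add: M0_def)
  have bE: "bounded E" using assms(1) by (rule compact_imp_bounded)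
  obtain a where a: "admissible E p M0 a"
    and stages: "\<And>\<theta> s t :: rat. \<And>R. stage_premise E p (of_rat \<theta>) (of_rat s) (of_rat t) \<Longrightarrow>
       large_image (of_rat \<theta>) (bump_series E a ` E) (of_rat t) R"
    using all_stages[OF bE assms(2)] unfolding M0_def by blast
  define f where "f = bump_series E a"
  have cont: "continuous_on A f" for A
    unfolding f_def by (rule continuous_bump_series[OF bE assms(2) M0 a])
  have bF: "bounded (f ` E)"
    by (intro compact_imp_bounded compact_continuous_image cont assms)
  obtain D V where D0: "\<And>k Q. 0 \<le> D k Q" and V0: "0 \<le> V"
    and osc: "\<And>k x y j. x \<in> E \<Longrightarrow> y \<in> E \<Longrightarrow> cell k x = cell k y \<Longrightarrow> \<bar>f x $ j - f y $ j\<bar> \<le> D k (cell k x)"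
    and sumD: "\<And>k. (\<Sum>Q\<in>cell k ` E. D k Q powr p) \<le> V * 2 powr - (real k * (p - real CARD('n)))"
    using bump_series_osc[OF bE assms(2) M0 a] unfolding f_def by blast
  have "upper_intermediate_dim \<theta> (f ` E) = p * upper_intermediate_dim \<theta> E / (p - real CARD('n) + upper_intermediate_dim \<theta> E)"
    if \<theta>: "0 < \<theta>" "\<theta> \<le> 1" for \<theta>
  proof (rule image_dim_eq[OF bE bF assms(2) \<theta>])
    fix s t :: real
    show "bounded_content \<theta> (f ` E) t"
      if "0 < s" "bounded_content \<theta> E s" "p * s / (p - real CARD('n) + s) < t"
      by (rule bounded_content_image[OF bE bF assms(2) \<theta> that(1) D0 V0 osc sumD that(2,3)])
    show "\<not> bounded_content \<theta> (f ` E) t"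
      if "0 < s" "\<not> bounded_content \<theta> E s" "0 < t" "t < p * s / (p - real CARD('n) + s)"
      unfolding f_def by (rule image_content_unbounded[OF assms(2) stages \<theta> that])
  qed
  moreover have "f \<in> sobolev_W1_maps p"
    unfolding f_def by (rule bump_series_sobolev[OF bE assms(2) M0 a])
  ultimately show ?thesis using cont by (intro exI[of _ f]) auto
qed

end
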